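(* Let $N$ be a positive odd integer and let $\mathsf b\in\mathbb C$ with $\operatorname{Re}\mathsf b>0$ and either $|\mathsf b|=1$ or $\mathsf b\in\mathbb R$. Let $Z^{(N)}$ be the level-$N$ Weil–Gel'fand–Zak transform, let $\hat u,\hat v,\hat u^*,\hat v^*$ be the rescaled quantum Teichmüller operators on $L^2(\mathbb A_N)$, and let $\hat x,\hat y,\hat{\tilde x},\hat{\tilde y}$ be the quantum operators on sections of $\mathcal L^N$ over $\mathbb T\times\mathbb T$, all as defined in the context. Then $$Z^{(N)}\circ\hat u^*\circ(Z^{(N)})^{-1}=\hat y^{-1},\qquad Z^{(N)}\circ\hat v^*\circ(Z^{(N)})^{-1}=\hat x^{-1},$$ $$Z^{(N)}\circ\hat u\circ(Z^{(N)})^{-1}=\hat{\tilde y}^{-1},\qquad Z^{(N)}\circ\hat v\circ(Z^{(N)})^{-1}=\hat{\tilde x}^{-1}.$$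
   Context: $\mathbb A_N=\mathbb R\times\mathbb Z/N\mathbb Z$ with measure $\int f\,d(x,n)=\frac1{\sqrt N}\sum_n\int_{\mathbb R}f(x,n)\,dx$. Sections of $\mathcal L^N\to\mathbb T\times\mathbb T$ ($\mathbb T=\mathbb R/\mathbb Z$) are functions $s$ on $\mathbb R^2$ with coordinates $(n,m)$ satisfying $s(n+1,m)=e^{-\pi iNm}s(n,m)$ and $s(n,m+1)=e^{\pi iNn}s(n,m)$. On them there is the connection $\nabla_n=\partial_n-i\pi Nm$, $\nabla_m=\partial_m+i\pi Nn$. (These arise by geometric quantization of $\mathbb C^*\times\mathbb C^*$ with the polarization $\operatorname{Span}\{\partial_w+\partial_n,\partial_z-\partial_m\}$ on the covering $\mathbb R^4\ni(z,n,w,m)$, restricted to the transversal $z=w=0$.) Quantum operators (unbounded, densely defined): $$\hat x=\exp\!\Big(\tfrac{i\mathsf b}{N}\nabla_n-\tfrac1N\nabla_m+2\pi in\Big),\qquad \hat y=\exp\!\Big(\tfrac{i\mathsf b}{N}\nabla_m+\tfrac1N\nabla_n+2\pi im\Big),$$ $$\hat{\tilde x}=\exp\!\Big(\tfrac{i\mathsf b^{-1}}{N}\nabla_n+\tfrac1N\nabla_m-2\pi in\Big),\qquad \hat{\tilde y}=\exp\!\Big(\tfrac{i\mathsf b^{-1}}{N}\nabla_m-\tfrac1N\nabla_n-2\pi im\Big).$$ Here the exponential of $\alpha\partial$ with complex $\alpha$ is the shift of the (analytically continued) argument by $\alpha$. Rescaled quantum Teichmüller operators, acting on $f\in L^2(\mathbb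 A_N)$ (in their natural domains of functions analytic in $z$): $$\hat u^*f(z,l)=e^{2\pi\mathsf bz}e^{2\pi il/N}f(z,l),\qquad \hat uf(z,l)=e^{2\pi\mathsf b^{-1}z}e^{-2\pi il/N}f(z,l),$$ $$\hat v^*f(z,l)=f\big(z-\tfrac{i\mathsf b}{N},l-1\big),\qquad \hat vf(z,l)=f\big(z-\tfrac{i\mathsf b^{-1}}{N},l+1\big).$$ The star is part of the notation and in general is not the Hilbert space adjoint. The level-$N$ Weil–Gel'fand–Zak transform $Z^{(N)}:\mathcal S(\mathbb A_N)\to C^\infty(\mathbb T\times\mathbb T,\mathcal L^N)$, an isomorphism extending to an isometry $L^2(\mathbb A_N)\to L^2(\mathbb T\times\mathbb T,\mathcal L^N)$, is $$Z^{(N)}(f)(n,m)=\frac1{\sqrt N}e^{\pi iNmn}\sum_{p\in\mathbb Z}\sum_{l=0}^{N-1}f\big(n+\tfrac pN,l\big)e^{2\pi imp}e^{2\pi ilp/N}.$$ The operator identities are understood on the natural dense domains. *)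

theory Defs
  imports "HOL-Analysis.Analysis"
begin

text \<open>
  Functions on \<open>A_N = R \<times> Z/NZ\<close> are functions \<open>f x l\<close> with \<open>l :: int\<close> that are
  \<open>N\<close>-periodic in \<open>l\<close>. Unbounded operators are represented by their graphs, i.e. by relations
  consisting of pairs (argument, value): the domain of definition is part of the operator,
  composition is relational composition \<open>O\<close> (first factor applied first), and the
  inverse operator is the converse relation.
\<close>

section \<open>Functions on \<open>R \<times> Z/NZ\<close>\<close>

definition periodic_AN :: "nat \<Rightarrow> (real \<Rightarrow> int \<Rightarrow> complex) \<Rightarrow> bool" where
  "periodic_AN N f \<longleftrightarrow> (\<forall>x l. f x (l + int N) = f x l)"

definition L2_AN :: "nat \<Rightarrow> (real \<Rightarrow> int \<Rightarrow> complex) set" where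
  "L2_AN N = {f. periodic_AN N f \<and>
     (\<forall>l. (\<lambda>x. f x l) \<in> borel_measurable lborel \<and> integrable lborel (\<lambda>x. (cmod (f x l))\<^sup>2))}"

definition L2_norm_AN :: "nat \<Rightarrow> (real \<Rightarrow> int \<Rightarrow> complex) \<Rightarrow> real" where
  "L2_norm_AN N f =
     sqrt (1 / sqrt (real N) * (\<Sum>l\<in>{0..<int N}. LINT x|lborel. (cmod (f x l))\<^sup>2))"

definition dense_in_L2_AN :: "nat \<Rightarrow> (real \<Rightarrow> int \<Rightarrow> complex) set \<Rightarrow> bool" where
  "dense_in_L2_AN N D \<longleftrightarrow> D \<subseteq> L2_AN N \<and>
     (\<forall>f\<in>L2_AN N. \<forall>\<epsilon>>0. \<exists>g\<in>D. L2_norm_AN N (\<lambda>x l. f x l - g x l) < \<epsilon>)"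

definition schwartz :: "(real \<Rightarrow> complex) \<Rightarrow> bool" where
  "schwartz f \<longleftrightarrow> (\<exists>D :: nat \<Rightarrow> real \<Rightarrow> complex. D 0 = f \<and>
     (\<forall>k x. (D k has_vector_derivative D (Suc k) x) (at x)) \<and>
     (\<forall>j k. bounded (range (\<lambda>x. x ^ j *\<^sub>R D k x))))"

definition Schwartz_AN :: "nat \<Rightarrow> (real \<Rightarrow> int \<Rightarrow> complex) set" where
  "Schwartz_AN N = {f. periodic_AN N f \<and> (\<forall>l. schwartz (\<lambda>x. f x l))}"

section \<open>Smooth sections of \<open>L^N\<close> over the torus\<close>

definition smooth_plane :: "(real \<Rightarrow> real \<Rightarrow> complex) \<Rightarrow> bool" where
  "smooth_plane s \<longleftrightarrow> (\<exists>D :: nat \<Rightarrow> nat \<Rightarrow> real \<Rightarrow> real \<Rightarrow> complex. D 0 0 = s \<and>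
     (\<forall>j k. continuous_on UNIV (\<lambda>(n, m). D j k n m) \<and>
       (\<forall>n m. ((\<lambda>x. D j k x m) has_vector_derivative D (Suc j) k n m) (at n) \<and>
              ((\<lambda>y. D j k n y) has_vector_derivative D j (Suc k) n m) (at m))))"

definition smooth_sections :: "nat \<Rightarrow> (real \<Rightarrow> real \<Rightarrow> complex) set" where
  "smooth_sections N = {s. smooth_plane s \<and>
     (\<forall>n m. s (n + 1) m = exp (- (complex_of_real pi * \<i> * of_nat N * of_real m)) * s n m) \<and>
     (\<forall>n m. s n (m + 1) = exp (complex_of_real pi * \<i> * of_nat N * of_real n) * s n m)}"

section \<open>The Weil--Gel'fand--Zak transform\<close>

definition zak :: "nat \<Rightarrow> (real \<Rightarrow> int \<Rightarrow> complex) \<Rightarrow> real \<Rightarrow> real \<Rightarrow> complex" where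
  "zak N f n m = of_real (1 / sqrt (real N)) * exp (complex_of_real pi * \<i> * of_nat N * of_real m * of_real n) *
     (\<Sum>\<^sub>\<infinity>p\<in>(UNIV :: int set). \<Sum>l\<in>{0..<int N}.
        f (n + of_int p / real N) l * exp (2 * complex_of_real pi * \<i> * of_real m * of_int p)
          * exp (2 * complex_of_real pi * \<i> * of_int l * of_int p / of_nat N))"

definition zak_op :: "nat \<Rightarrow> ((real \<Rightarrow> int \<Rightarrow> complex) \<times> (real \<Rightarrow> real \<Rightarrow> complex)) set" where
  "zak_op N = {(f, s). f \<in> Schwartz_AN N \<and> s = zak N f}"

section \<open>Analytic continuation\<close>

text \<open>
  The closed strip between the real axis and its translate by \<open>a\<close>; for real \<open>a\<close> it degenerates
  to the real axis and has empty interior.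
\<close>

definition strip :: "complex \<Rightarrow> complex set" where
  "strip a = {z. Im z \<in> closed_segment 0 (Im a)}"

text \<open>
  A continuation of \<open>f\<close> to a strip is uniquely determined by \<open>f\<close>. Boundedness on
  the strip is the usual Hardy-type growth condition.
\<close>

definition strip_ext :: "complex \<Rightarrow> (real \<Rightarrow> complex) \<Rightarrow> (complex \<Rightarrow> complex) \<Rightarrow> bool" where
  "strip_ext a f F \<longleftrightarrow> (\<forall>x. F (of_real x) = f x) \<and> continuous_on (strip a) F \<and>
     F holomorphic_on interior (strip a) \<and> bounded (F ` strip a)"

text \<open>
  For sections no growth condition is needed: the continuation inherits the quasi-periodicity.
  If \<open>c\<close> is real, holomorphy in the second variable is required on the empty set only,
  and the second argument stays real; likewise for real \<open>a\<close>.
\<close>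

definition strip_ext2 ::
  "complex \<Rightarrow> complex \<Rightarrow> (real \<Rightarrow> real \<Rightarrow> complex) \<Rightarrow> (complex \<Rightarrow> complex \<Rightarrow> complex) \<Rightarrow> bool" where
  "strip_ext2 a c s S \<longleftrightarrow> (\<forall>n m. S (of_real n) (of_real m) = s n m) \<and>
     continuous_on (strip a \<times> strip c) (\<lambda>(z, w). S z w) \<and>
     (\<forall>w\<in>strip c. (\<lambda>z. S z w) holomorphic_on interior (strip a)) \<and>
     (\<forall>z\<in>strip a. (\<lambda>w. S z w) holomorphic_on interior (strip c))"

section \<open>Rescaled quantum Teichmueller operators\<close>

type_synonym AN_op = "((real \<Rightarrow> int \<Rightarrow> complex) \<times> (real \<Rightarrow> int \<Rightarrow> complex)) set"

definition mult_op :: "nat \<Rightarrow> (real \<Rightarrow> int \<Rightarrow> complex) \<Rightarrow> AN_op" where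
  "mult_op N q = {(f, g). f \<in> Schwartz_AN N \<and> g \<in> Schwartz_AN N \<and> (\<forall>z l. g z l = q z l * f z l)}"

definition shift_op :: "nat \<Rightarrow> complex \<Rightarrow> int \<Rightarrow> AN_op" where
  "shift_op N a j = {(f, g). f \<in> Schwartz_AN N \<and> g \<in> Schwartz_AN N \<and>
     (\<exists>F. (\<forall>l. strip_ext a (\<lambda>x. f x l) (F l)) \<and> (\<forall>z l. g z l = F (l + j) (of_real z + a)))}"

definition u_star :: "nat \<Rightarrow> complex \<Rightarrow> AN_op" where
  "u_star N b = mult_op N (\<lambda>z l. exp (2 * complex_of_real pi * b * of_real z) * exp (2 * complex_of_real pi * \<i> * of_int l / of_nat N))"

definition u_hat :: "nat \<Rightarrow> complex \<Rightarrow> AN_op" where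
  "u_hat N b = mult_op N
     (\<lambda>z l. exp (2 * complex_of_real pi * inverse b * of_real z) * exp (- (2 * complex_of_real pi * \<i> * of_int l / of_nat N)))"

definition v_star :: "nat \<Rightarrow> complex \<Rightarrow> AN_op" where
  "v_star N b = shift_op N (- (\<i> * b / of_nat N)) (- 1)"

definition v_hat :: "nat \<Rightarrow> complex \<Rightarrow> AN_op" where
  "v_hat N b = shift_op N (- (\<i> * inverse b / of_nat N)) 1"

section \<open>Quantum operators on sections\<close>

text \<open>
  \<open>FO a c W\<close> stands for the first-order operator \<open>a \<partial>\<^sub>n + c \<partial>\<^sub>m + W(n,m)\<close>, where the
  zeroth-order coefficient \<open>W\<close> is given for complex arguments.
\<close>

datatype first_order = FO complex complex "complex \<Rightarrow> complex \<Rightarrow> complex"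

fun fo_add :: "first_order \<Rightarrow> first_order \<Rightarrow> first_order" (infixl "\<oplus>\<^sub>D" 65) where
  "FO a c W \<oplus>\<^sub>D FO a' c' W' = FO (a + a') (c + c') (\<lambda>n m. W n m + W' n m)"

fun fo_scale :: "complex \<Rightarrow> first_order \<Rightarrow> first_order" (infixr "\<odot>\<^sub>D" 75) where
  "k \<odot>\<^sub>D FO a c W = FO (k * a) (k * c) (\<lambda>n m. k * W n m)"

definition fo_mult :: "(complex \<Rightarrow> complex \<Rightarrow> complex) \<Rightarrow> first_order" where
  "fo_mult V = FO 0 0 V"

definition nabla_n :: "nat \<Rightarrow> first_order" where
  "nabla_n N = FO 1 0 (\<lambda>n m. - (\<i> * complex_of_real pi * of_nat N * m))"

definition nabla_m :: "nat \<Rightarrow> first_order" where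
  "nabla_m N = FO 0 1 (\<lambda>n m. \<i> * complex_of_real pi * of_nat N * n)"

text \<open>
  \<open>fo_flow X \<tau>\<close> is \<open>exp (\<tau> X)\<close>: by the method of characteristics, the solution of
  \<open>\<partial>\<^sub>\<tau> u = X u\<close>, \<open>u(0) = S\<close> is the shift of the argument by \<open>\<tau> (a, c)\<close> multiplied by the
  exponential of the integral of \<open>W\<close> along the shift (see \<open>fo_flow_generator\<close> below). For
  \<open>X = a \<partial>\<^sub>n\<close> it is the plain shift. For affine \<open>W\<close>, it coincides with the
  Baker--Campbell--Hausdorff splitting of the exponential.
\<close>

fun fo_flow :: "first_order \<Rightarrow> real \<Rightarrow> (complex \<Rightarrow> complex \<Rightarrow> complex) \<Rightarrow> complex \<Rightarrow> complex \<Rightarrow> complex" where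
  "fo_flow (FO a c W) \<tau> S n m =
     exp (integral {0..\<tau>} (\<lambda>t. W (n + of_real t * a) (m + of_real t * c)))
       * S (n + of_real \<tau> * a) (m + of_real \<tau> * c)"

type_synonym section_op = "((real \<Rightarrow> real \<Rightarrow> complex) \<times> (real \<Rightarrow> real \<Rightarrow> complex)) set"

fun exp_op :: "nat \<Rightarrow> first_order \<Rightarrow> section_op" where
  "exp_op N (FO a c W) = {(s, t). s \<in> smooth_sections N \<and> t \<in> smooth_sections N \<and>
     (\<exists>S. strip_ext2 a c s S \<and> (\<forall>n m. t n m = fo_flow (FO a c W) 1 S (of_real n) (of_real m)))}"

definition x_hat :: "nat \<Rightarrow> complex \<Rightarrow> section_op" where
  "x_hat N b = exp_op N ((\<i> * b / of_nat N) \<odot>\<^sub>D nabla_n N \<oplus>\<^sub>D (- 1 / of_nat N) \<odot>\<^sub>D nabla_m N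
     \<oplus>\<^sub>D fo_mult (\<lambda>n m. 2 * complex_of_real pi * \<i> * n))"

definition y_hat :: "nat \<Rightarrow> complex \<Rightarrow> section_op" where
  "y_hat N b = exp_op N ((\<i> * b / of_nat N) \<odot>\<^sub>D nabla_m N \<oplus>\<^sub>D (1 / of_nat N) \<odot>\<^sub>D nabla_n N
     \<oplus>\<^sub>D fo_mult (\<lambda>n m. 2 * complex_of_real pi * \<i> * m))"

definition x_tilde :: "nat \<Rightarrow> complex \<Rightarrow> section_op" where
  "x_tilde N b = exp_op N ((\<i> * inverse b / of_nat N) \<odot>\<^sub>D nabla_n N \<oplus>\<^sub>D (1 / of_nat N) \<odot>\<^sub>D nabla_m N
     \<oplus>\<^sub>D fo_mult (\<lambda>n m. - (2 * complex_of_real pi * \<i> * n)))"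

definition y_tilde :: "nat \<Rightarrow> complex \<Rightarrow> section_op" where
  "y_tilde N b = exp_op N ((\<i> * inverse b / of_nat N) \<odot>\<^sub>D nabla_m N \<oplus>\<^sub>D (- 1 / of_nat N) \<odot>\<^sub>D nabla_n N
     \<oplus>\<^sub>D fo_mult (\<lambda>n m. - (2 * complex_of_real pi * \<i> * m)))"

lemma fo_flow_0: "fo_flow X 0 S n m = S n m"
  by (cases X) simp

lemma fo_flow_generator:
  assumes W: "continuous_on UNIV (\<lambda>(z, w). W z w)"
    and S: "\<And>z w. ((\<lambda>(z, w). S z w) has_derivative (\<lambda>(h, k). Sn z w * h + Sm z w * k)) (at (z, w))"
    and \<tau>: "\<tau> \<in> {0..1}"
  shows "((\<lambda>\<tau>. fo_flow (FO a c W) \<tau> S n m) has_vector_derivative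
           fo_flow (FO a c W) \<tau> (\<lambda>z w. a * Sn z w + c * Sm z w + W z w * S z w) n m)
         (at \<tau> within {0..1})"
proof -
  let ?w = "\<lambda>t::real. W (n + of_real t * a) (m + of_real t * c)"
  let ?I = "\<lambda>t. integral {0..t} ?w"
  have q: "continuous_on {0..1} (\<lambda>t::real. (n + of_real t * a, m + of_real t * c))"
    by (intro continuous_intros)
  have cw: "continuous_on {0..1} ?w"
    using continuous_on_compose2[OF W q] by simp
  have I: "(?I has_vector_derivative ?w \<tau>) (at \<tau> within {0..1})"
    by (rule integral_has_vector_derivative[OF cw \<tau>])
  have E: "((\<lambda>t. exp (?I t)) has_vector_derivative ?w \<tau> * exp (?I \<tau>)) (at \<tau> within {0..1})"
    using field_vector_diff_chain_within[OF I, of exp "exp (?I \<tau>)"]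
    by (simp add: o_def has_field_derivative_at_within DERIV_exp)
  have p: "((\<lambda>t::real. (n + of_real t * a, m + of_real t * c)) has_derivative
             (\<lambda>h. (of_real h * a, of_real h * c))) (at \<tau> within {0..1})"
    by (auto intro!: derivative_eq_intros)
  have T: "((\<lambda>t::real. S (n + of_real t * a) (m + of_real t * c)) has_vector_derivative
             (a * Sn (n + of_real \<tau> * a) (m + of_real \<tau> * c)
              + c * Sm (n + of_real \<tau> * a) (m + of_real \<tau> * c))) (at \<tau> within {0..1})"
    using has_derivative_compose[OF p S]
    by (simp add: has_vector_derivative_def scaleR_conv_of_real algebra_simps)
  show ?thesis
    using has_vector_derivative_mult[OF E T] by (simp add: algebra_simps)
qed

end

theory Submission
  imports Defs "HOL-Complex_Analysis.Complex_Analysis"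
begin

text \<open>
  For fixed \<open>n\<close> the section \<open>Z f (n, m)\<close>, stripped of the factor \<open>exp (\<pi> i N m n)\<close>, is a Fourier
  series in \<open>m\<close> with coefficients \<open>\<Sum>\<^sub>l f (n + p/N, l) exp (2 \<pi> i l p / N)\<close>; inverting the Fourier
  series and then the finite Fourier transform in \<open>l\<close> shows that \<open>Z\<close> is a bijection from Schwartz
  functions onto smooth sections. Each operator identity is an identity between such coefficients.
  The four operators on each side come in two types, indexed by \<open>\<beta> = b\<close> or \<open>\<beta> = 1/b\<close> and a sign \<open>e\<close>.

  If the shift is complex in \<open>m\<close>, the Fourier series converges on the strip exactly because both
  \<open>g\<close> and \<open>exp (- 2 \<pi> \<beta> x) g\<close> decay rapidly, and conversely moving the contour of the coefficient
  integral to the other edge of the strip multiplies the coefficients by an exponential. If it is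
  complex in \<open>n\<close>, a bounded continuation of \<open>f\<close> that decays on both edges decays inside, so that the
  series converges there; conversely the coefficients of a continued section, being integrals over a
  period, continue \<open>f\<close>. Quasi-periodicity passes to continuations by uniqueness.

  The domains contain all functions \<open>exp (- x\<^sup>2)\<close> times a trigonometric polynomial, which are dense in
  \<open>L\<^sup>2\<close> by the Weierstrass theorem.
\<close>

section \<open>Trigonometric polynomials and Fourier series\<close>

text \<open>Since operators are graphs, each identity equates domains as well as values, so two
  inclusions have to be shown. The weight of the multiplication operators is forced by the Fourier
  factors: at \<open>m + \<i> \<beta> / N\<close> the factor \<open>ee (p m)\<close> acquires exp (-
  2 pi \<beta> p / N), which equals exp (- 2 pi \<beta> x) at the sample point x = n + p/N up to a
  factor in n alone. This is the reciprocal weight, hence the converse relations in the statement.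
  The two sides differ in growth: continuations of functions must be bounded, continuations of
  sections carry no growth condition. For the shift operators the missing bound comes from
  compactness of a fundamental domain, once quasi-periodicity is known on the strip.\<close>

definition ee :: "complex \<Rightarrow> complex" where
  "ee z = exp (2 * complex_of_real pi * \<i> * z)"

lemma ee_add: "ee (z + w) = ee z * ee w"
  by (simp add: ee_def exp_add ring_distribs)

lemma ee_0 [simp]: "ee 0 = 1"
  by (simp add: ee_def)

lemma ee_minus: "ee (- z) = inverse (ee z)"
  by (simp add: ee_def exp_minus)

lemma ee_nonzero [simp]: "ee z \<noteq> 0"
  by (simp add: ee_def)

lemma ee_of_int [simp]: "ee (of_int k) = 1"
  unfolding ee_def by (simp add: exp_eq_1)

lemma ee_1 [simp]: "ee 1 = 1"
  using ee_of_int[of 1] by simp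

lemma norm_ee: "norm (ee z) = exp (- 2 * pi * Im z)"
  by (simp add: ee_def norm_exp_eq_Re)

lemma norm_ee_real [simp]: "norm (ee (of_real x)) = 1"
  by (simp add: norm_ee)

lemma norm_ee_Im0: "Im z = 0 \<Longrightarrow> norm (ee z) = 1"
  by (simp add: norm_ee)

lemma continuous_on_ee [continuous_intros]:
  "continuous_on A f \<Longrightarrow> continuous_on A (\<lambda>x. ee (f x))"
  unfolding ee_def by (intro continuous_intros)

lemma holomorphic_on_ee [holomorphic_intros]:
  "f holomorphic_on A \<Longrightarrow> (\<lambda>x. ee (f x)) holomorphic_on A"
  unfolding ee_def by (intro holomorphic_intros)

lemma ee_has_vector_derivative:
  "((\<lambda>x. ee (c * of_real x)) has_vector_derivative (2 * of_real pi * \<i> * c) * ee (c * of_real x)) (at x within A)"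
proof -
  have "((\<lambda>z. ee (c * z)) has_field_derivative (2 * of_real pi * \<i> * c) * ee (c * of_real x)) (at (of_real x))"
    unfolding ee_def by (auto intro!: derivative_eq_intros)
  from has_vector_derivative_real_field[OF this] show ?thesis
    by (auto intro: has_vector_derivative_at_within)
qed

lemma ee_integral:
  "integral {0..1} (\<lambda>x. ee (of_int j * of_real x)) = (if j = 0 then 1 else 0)"
proof (cases "j = 0")
  case False
  define f where "f = (\<lambda>x. ee (of_int j * of_real x) / (2 * of_real pi * \<i> * of_int j))"
  have "(f has_vector_derivative ee (of_int j * of_real x)) (at x within {0..1})" for x
    unfolding f_def using has_vector_derivative_divide[OF ee_has_vector_derivative[of "of_int j"],
       where a = "2 * of_real pi * \<i> * of_int j"] False by simp
  hence "((\<lambda>x. ee (of_int j * of_real x)) has_integral (f 1 - f 0)) {0..1}"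
    by (intro fundamental_theorem_of_calculus) auto
  thus ?thesis using False by (simp add: f_def integral_unique)
qed simp

section \<open>Uniform approximation of periodic functions by trigonometric polynomials\<close>

text \<open>Generating the class by closure rules turns periodicity, continuity, products and the
  vanishing of integrals into short inductions, without finite sets of frequencies.\<close>

inductive trig_poly :: "(real \<Rightarrow> complex) \<Rightarrow> bool" where
  trig_poly_ee: "trig_poly (\<lambda>x. ee (of_int k * of_real x))"
| trig_poly_scale: "trig_poly f \<Longrightarrow> trig_poly (\<lambda>x. c * f x)"
| trig_poly_add: "trig_poly f \<Longrightarrow> trig_poly g \<Longrightarrow> trig_poly (\<lambda>x. f x + g x)"

lemma trig_poly_const: "trig_poly (\<lambda>x. c)"
  using trig_poly_scale[OF trig_poly_ee[of 0], of c] by simp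

lemma trig_poly_mult:
  assumes "trig_poly f" "trig_poly g"
  shows "trig_poly (\<lambda>x. f x * g x)"
  using assms(1)
proof induction
  case (trig_poly_ee k)
  show ?case using assms(2)
  proof induction
    case (trig_poly_ee l)
    have "trig_poly (\<lambda>x. ee (of_int (k + l) * of_real x))" by (rule trig_poly.intros)
    thus ?case by (simp add: ee_add ring_distribs)
  next
    case (trig_poly_scale f c)
    from trig_poly.trig_poly_scale[OF trig_poly_scale.IH, of c] show ?case by (simp add: mult_ac)
  next
    case (trig_poly_add f g)
    from trig_poly.trig_poly_add[OF trig_poly_add.IH] show ?case by (simp add: ring_distribs)
  qed
next
  case (trig_poly_scale f c)
  from trig_poly.trig_poly_scale[OF trig_poly_scale.IH, of c] show ?case by (simp add: mult_ac)
next
  case (trig_poly_add f g)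
  from trig_poly.trig_poly_add[OF trig_poly_add.IH] show ?case by (simp add: ring_distribs)
qed

lemma continuous_on_trig_poly: "trig_poly f \<Longrightarrow> continuous_on A f"
  by (induction rule: trig_poly.induct) (auto intro!: continuous_intros)

lemma trig_poly_periodic: "trig_poly f \<Longrightarrow> f (x + 1) = f x"
  by (induction rule: trig_poly.induct) (auto simp: ring_distribs ee_add)

text \<open>By Euler's formulas Re and Im on the unit circle are combinations of \<open>ee x\<close>
  and \<open>ee (- x)\<close>, so linear forms are trigonometric polynomials, and the class is
  closed under products.\<close>

lemma trig_poly_polynomial:
  assumes "real_polynomial_function g"
  shows "trig_poly (\<lambda>x. of_real (g (ee (of_real x))))"
  using assms
proof induction
  case (linear f)
  interpret bounded_linear f by fact
  have *: "f z = Re z * f 1 + Im z * f \<i>" for z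
  proof -
    have "f z = f (Re z *\<^sub>R 1 + Im z *\<^sub>R \<i>)"
      by (rule arg_cong[where f = f]) (simp add: complex_eq_iff)
    also have "\<dots> = Re z * f 1 + Im z * f \<i>"
      by (simp only: add scaleR) simp
    finally show ?thesis .
  qed
  have "complex_of_real (f (ee (of_real x))) =
     (of_real (f 1) / 2 + of_real (f \<i>) / (2*\<i>)) * ee (of_int 1 * of_real x)
      + (of_real (f 1) / 2 - of_real (f \<i>) / (2*\<i>)) * ee (of_int (- 1) * of_real x)" for x
  proof -
    have e: "ee (of_real x) = cis (2 * pi * x)" "ee (- of_real x) = cis (- (2 * pi * x))"
      by (simp_all add: ee_def cis_conv_exp mult_ac)
    show ?thesis
      by (subst *) (simp add: e complex_eq_iff)
  qed
  thus ?case by (simp only:) (intro trig_poly.intros)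
next
  case (add f g)
  thus ?case by (simp add: trig_poly_add)
next
  case (mult f g)
  thus ?case by (simp add: trig_poly_mult)
qed (simp_all add: trig_poly_const)

lemma periodic_of_int:
  fixes u :: "real \<Rightarrow> 'a"
  assumes "\<And>x. u (x + 1) = u x"
  shows "u (x + of_int k) = u x"
proof (induction k rule: int_induct[where k = 0])
  case (step1 i)
  thus ?case using assms[of "x + of_int i"] by (simp add: add_ac)
next
  case (step2 i)
  thus ?case using assms[of "x + of_int (i - 1)"] by (simp add: add_ac)
qed simp

lemma periodic_frac:
  fixes u :: "real \<Rightarrow> 'a"
  assumes "\<And>x. u (x + 1) = u x"
  shows "u (frac x) = u x"
  using periodic_of_int[of u "frac x" "\<lfloor>x\<rfloor>"] assms by (simp add: frac_def)

text \<open>The periodic function descends to the unit circle, where Stone--Weierstrass applies; the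
  descended function is continuous because its graph is the image of a compact interval.\<close>

lemma trig_poly_approx_interval:
  assumes cont: "continuous_on {0..1} u" and per: "u 1 = u 0" and "\<epsilon> > 0"
  obtains q where "trig_poly q" "\<And>x. x \<in> {0..1} \<Longrightarrow> norm (u x - q x) < \<epsilon>"
proof -
  define U where "U z = u (Arg2pi z / (2 * pi))" for z
  have U: "U (ee (of_real x)) = u x" if "x \<in> {0..1}" for x
  proof (cases "x = 1")
    \<comment> \<open>At the right endpoint \<open>Arg2pi\<close> returns to 0, so \<open>U\<close>
      takes the value of \<open>u\<close> at 0; this is where \<open>per\<close> enters.\<close>
    case True
    thus ?thesis using per Arg2pi_of_real[of 1] by (simp add: U_def)
  next
    case False
    have "Arg2pi (ee (of_real x)) = 2 * pi * x"
      by (rule Arg2pi_unique[of 1]) (use that False in \<open>auto simp: ee_def mult_ac\<close>)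
    thus ?thesis by (simp add: U_def)
  qed
  have S: "sphere 0 1 = (\<lambda>x. ee (of_real x)) ` {0..1}"
  proof (intro equalityI subsetI)
    fix z :: complex assume "z \<in> sphere 0 1"
    hence z: "norm z = 1" by simp
    have "z = ee (of_real (Arg2pi z / (2 * pi)))"
      using complex_norm_eq_1_exp[of z] z by (simp add: ee_def mult_ac)
    thus "z \<in> (\<lambda>x. ee (of_real x)) ` {0..1}"
      using Arg2pi[of z] by (intro image_eqI[of _ _ "Arg2pi z / (2 * pi)"]) auto
  qed auto
  have "continuous_on (sphere 0 1) U"
  proof (rule continuous_from_closed_graph)
    show "compact (u ` {0..1})" by (intro compact_continuous_image cont) auto
    show "U \<in> sphere 0 1 \<rightarrow> u ` {0..1}" unfolding S using U by auto
    have "(\<lambda>z. (z, U z)) ` sphere 0 1 = (\<lambda>x. (ee (of_real x), u x)) ` {0..1}"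
      unfolding S image_image using U by (intro image_cong) auto
    moreover have "compact \<dots>"
      by (intro compact_continuous_image continuous_intros cont) auto
    ultimately show "closed ((\<lambda>z. (z, U z)) ` sphere 0 1)"
      by (simp add: compact_imp_closed)
  qed
  hence c: "continuous_on (sphere 0 1) (\<lambda>z. Re (U z))" "continuous_on (sphere 0 1) (\<lambda>z. Im (U z))"
    by (auto intro!: continuous_intros)
  obtain g1 where g1: "real_polynomial_function g1" "\<And>z. z \<in> sphere 0 1 \<Longrightarrow> \<bar>Re (U z) - g1 z\<bar> < \<epsilon> / 2"
    using Stone_Weierstrass_real_polynomial_function[OF compact_sphere c(1), of "\<epsilon> / 2"] \<open>\<epsilon> > 0\<close> by auto
  obtain g2 where g2: "real_polynomial_function g2" "\<And>z. z \<in> sphere 0 1 \<Longrightarrow> \<bar>Im (U z) - g2 z\<bar> < \<epsilon> / 2"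
    using Stone_Weierstrass_real_polynomial_function[OF compact_sphere c(2), of "\<epsilon> / 2"] \<open>\<epsilon> > 0\<close> by auto
  define q where "q x = of_real (g1 (ee (of_real x))) + \<i> * of_real (g2 (ee (of_real x)))" for x :: real
  have q: "trig_poly q"
    unfolding q_def by (intro trig_poly.intros trig_poly_polynomial g1 g2)
  have "norm (u x - q x) < \<epsilon>" if "x \<in> {0..1}" for x
  proof -
    have z: "ee (of_real x) \<in> sphere 0 1" by simp
    have "norm (u x - q x) \<le> \<bar>Re (u x - q x)\<bar> + \<bar>Im (u x - q x)\<bar>" by (rule cmod_le)
    also have "\<dots> < \<epsilon> / 2 + \<epsilon> / 2"
      using g1(2)[OF z] g2(2)[OF z] U[OF that] by (intro add_strict_mono) (simp_all add: q_def)
    finally show ?thesis by simp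
  qed
  with q show ?thesis by (rule that)
qed

lemma trig_poly_approx:
  assumes cont: "continuous_on UNIV u" and per: "\<And>x. u (x + 1) = u x" and "\<epsilon> > 0"
  obtains q where "trig_poly q" "\<And>x. norm (u x - q x) < \<epsilon>"
proof -
  obtain q where q: "trig_poly q" and *: "\<And>x. x \<in> {0..1} \<Longrightarrow> norm (u x - q x) < \<epsilon>"
    using trig_poly_approx_interval[OF continuous_on_subset[OF cont subset_UNIV], of \<epsilon>] per[of 0] \<open>\<epsilon> > 0\<close> by auto
  have "norm (u x - q x) < \<epsilon>" for x
    using *[of "frac x"] periodic_frac[of u x] periodic_frac[of q x] per trig_poly_periodic[OF q]
      frac_lt_1[of x] by (simp add: less_imp_le)
  with q show ?thesis by (rule that)
qed

section \<open>Uniqueness and convergence of Fourier series\<close>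

text \<open>If all coefficients vanish, \<open>u\<close> is orthogonal to every trigonometric
  polynomial. Subtracting one that is uniformly \<epsilon>-close to the conjugate of
  \<open>u\<close> bounds the integral of |u|^2 by \<epsilon> times that of |u|; continuity then
  forces \<open>u = 0\<close>.\<close>

lemma fourier_uniqueness:
  assumes cont: "continuous_on UNIV u" and per: "\<And>x. u (x + 1) = u x"
    and coeff: "\<And>k::int. integral {0..1} (\<lambda>x. u x * ee (- of_int k * of_real x)) = 0"
  shows "u x = 0"
proof -
  have cont': "continuous_on A u" for A
    using cont continuous_on_subset by blast
  have int: "(\<lambda>x. u x * q x) integrable_on {0..1}" if "continuous_on UNIV q" for q
    by (intro integrable_continuous_real continuous_intros cont' continuous_on_subset[OF that]) auto
  have zero: "integral {0..1} (\<lambda>x. u x * q x) = 0" if "trig_poly q" for q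
    using that
  proof induction
    case (trig_poly_ee k)
    show ?case using coeff[of "- k"] by simp
  next
    case (trig_poly_scale f c)
    have "integral {0..1} (\<lambda>x. u x * (c * f x)) = integral {0..1} (\<lambda>x. c * (u x * f x))"
      by (simp add: mult_ac)
    also have "\<dots> = 0" using trig_poly_scale by (simp only: integral_mult_right) simp
    finally show ?case .
  next
    case (trig_poly_add f g)
    thus ?case
      by (simp add: ring_distribs integral_add int continuous_on_trig_poly)
  qed
  define C where "C = integral {0..1} (\<lambda>x. norm (u x))"
  define I where "I = integral {0..1} (\<lambda>x. (norm (u x))\<^sup>2)"
  have C: "C \<ge> 0" unfolding C_def by (intro integral_nonneg integrable_continuous_real continuous_intros cont') auto
  have I0: "I \<ge> 0" unfolding I_def by (intro integral_nonneg integrable_continuous_real continuous_intros cont') auto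
  have le: "I \<le> \<epsilon> * C" if "\<epsilon> > 0" for \<epsilon>
  proof -
    obtain q where q: "trig_poly q" "\<And>x. norm (cnj (u x) - q x) < \<epsilon>"
      using trig_poly_approx[of "\<lambda>x. cnj (u x)" \<epsilon>] per \<open>\<epsilon> > 0\<close>
      by (auto intro!: continuous_intros cont)
    have "of_real I = integral {0..1} (\<lambda>x. complex_of_real ((norm (u x))\<^sup>2))"
      unfolding I_def using integral_linear[of "\<lambda>x. (norm (u x))\<^sup>2" "{0..1}" complex_of_real]
      by (simp add: o_def integrable_continuous_real continuous_intros cont' bounded_linear_of_real)
    also have "\<dots> = integral {0..1} (\<lambda>x. u x * cnj (u x))"
      by (simp only: complex_norm_square)
    also have "\<dots> = integral {0..1} (\<lambda>x. u x * cnj (u x) - u x * q x)"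
      using int[of "\<lambda>x. cnj (u x)"] int[OF continuous_on_trig_poly[OF q(1)]] zero[OF q(1)]
      by (subst integral_diff) (simp_all add: continuous_intros cont)
    also have "\<dots> = integral {0..1} (\<lambda>x. u x * (cnj (u x) - q x))"
      by (simp add: ring_distribs)
    finally have "norm (complex_of_real I) = norm (integral {0..1} (\<lambda>x. u x * (cnj (u x) - q x)))" by simp
    also have "\<dots> \<le> integral {0..1} (\<lambda>x. \<epsilon> * norm (u x))"
    proof (rule integral_norm_bound_integral)
      fix x show "norm (u x * (cnj (u x) - q x)) \<le> \<epsilon> * norm (u x)"
        using q(2)[of x] mult_right_mono[of "norm (cnj (u x) - q x)" \<epsilon> "norm (u x)"]
        by (simp add: norm_mult mult_ac)
    qed (auto intro!: int continuous_intros cont cont' continuous_on_trig_poly[OF q(1)] integrable_continuous_real)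
    finally show ?thesis using I0 by (simp add: C_def)
  qed
  have "I \<le> 0"
  proof (rule field_le_epsilon)
    fix e :: real assume "e > 0"
    \<comment> \<open>The added 1 keeps the denominator positive when \<open>C = 0\<close>.\<close>
    have "I \<le> e / (C + 1) * C" using C \<open>e > 0\<close> by (intro le) auto
    also have "\<dots> \<le> e" using C \<open>e > 0\<close> by (simp add: field_simps)
    finally show "I \<le> 0 + e" by simp
  qed
  hence "I = 0" using I0 by simp
  have "((\<lambda>x. (norm (u x))\<^sup>2) has_integral 0) (cbox 0 1)"
    using \<open>I = 0\<close> unfolding I_def
    by (metis box_real(2) cont' continuous_on_norm continuous_on_power integrable_continuous integrable_integral)
  moreover have "continuous_on (cbox 0 1) (\<lambda>x. (norm (u x))\<^sup>2)" by (intro continuous_intros cont')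
  ultimately have "(norm (u x))\<^sup>2 = 0" if "x \<in> cbox 0 1" for x
    using has_integral_0_cbox_imp_0[of 0 1 "\<lambda>x. (norm (u x))\<^sup>2"] that by auto
  from this[of "frac x"] show "u x = 0"
    using periodic_frac[of u x] per frac_lt_1[of x] by (simp add: less_imp_le)
qed

lemma continuous_on_infsum:
  fixes f :: "'a \<Rightarrow> 'b::topological_space \<Rightarrow> 'c::banach"
  assumes "\<And>p. continuous_on A (f p)" "\<And>p x. x \<in> A \<Longrightarrow> norm (f p x) \<le> M p" "M summable_on UNIV"
  shows "continuous_on A (\<lambda>x. \<Sum>\<^sub>\<infinity>p. f p x)"
  by (rule uniform_limit_theorem[OF _ Weierstrass_m_test_general[OF assms(2,3)]])
     (auto intro!: always_eventually continuous_intros assms)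

text \<open>Uniform convergence allows termwise integration. By orthogonality the integral over a
  finite index set is already \<open>c k\<close> once the set contains \<open>k\<close>, so the net
  of partial integrals is eventually constant.\<close>

lemma fourier_coeff_series:
  fixes c :: "int \<Rightarrow> complex"
  assumes "\<And>p. norm (c p) \<le> M p" "M summable_on UNIV"
  shows "integral {0..1} (\<lambda>x. (\<Sum>\<^sub>\<infinity>p. c p * ee (of_int p * of_real x)) * ee (- of_int k * of_real x)) = c k"
proof -
  define f where "f X x = (\<Sum>p\<in>X. c p * ee (of_int (p - k) * of_real x))" for X and x :: real
  define g where "g x = (\<Sum>\<^sub>\<infinity>p. c p * ee (of_int (p - k) * of_real x))" for x :: real
  have "uniform_limit (cbox 0 1) f g (finite_subsets_at_top UNIV)"
    unfolding f_def g_def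
    by (rule Weierstrass_m_test_general[OF _ assms(2)])
       (use assms(1) in \<open>simp add: norm_mult norm_ee\<close>)
  then obtain I J where IJ: "\<And>X. (f X has_integral I X) (cbox 0 1)" "(g has_integral J) (cbox 0 1)"
    "(I \<longlongrightarrow> J) (finite_subsets_at_top UNIV)"
    by (rule uniform_limit_integral_cbox) (auto simp: f_def intro!: continuous_intros)
  have I: "I X = c k" if "finite X" "k \<in> X" for X
  proof -
    have "I X = integral {0..1} (f X)" using IJ(1)[of X] by (simp add: integral_unique)
    also have "\<dots> = (\<Sum>p\<in>X. integral {0..1} (\<lambda>x. c p * ee (of_int (p - k) * of_real x)))"
      unfolding f_def by (intro integral_sum that integrable_continuous_real continuous_intros)
    also have "\<dots> = (\<Sum>p\<in>X. if p = k then c p else 0)"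
      by (intro sum.cong refl) (simp only: integral_mult_right ee_integral, simp)
    also have "\<dots> = c k" using that by simp
    finally show ?thesis .
  qed
  have "eventually (\<lambda>X. I X = c k) (finite_subsets_at_top UNIV)"
    using eventually_finite_subsets_at_top_finite[of "{k}"]
    by (auto simp: eventually_finite_subsets_at_top intro!: exI[of _ "{k}"] I)
  hence "(I \<longlongrightarrow> c k) (finite_subsets_at_top UNIV)" by (rule tendsto_eventually)
  with IJ(3) have "J = c k" using tendsto_unique finite_subsets_at_top_neq_bot by blast
  moreover have "g x = (\<Sum>\<^sub>\<infinity>p. c p * ee (of_int p * of_real x)) * ee (- of_int k * of_real x)" for x
    unfolding g_def by (subst infsum_cmult_left'[symmetric]) (simp add: ee_add[symmetric] algebra_simps)
  ultimately show ?thesis using IJ(2) integral_unique[of g "c k" "{0..1}"]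
    by (simp only: box_real) presburger
qed

text \<open>Termwise integration shows that the series has the same coefficients as
  \<open>u\<close>, so the difference vanishes by uniqueness.\<close>

lemma fourier_series:
  assumes cont: "continuous_on UNIV u" and per: "\<And>x. u (x + 1) = u x"
    and c: "\<And>k::int. c k = integral {0..1} (\<lambda>x. u x * ee (- of_int k * of_real x))"
    and M: "\<And>p. norm (c p) \<le> M p" "M summable_on UNIV"
  shows "u x = (\<Sum>\<^sub>\<infinity>p. c p * ee (of_int p * of_real x))"
proof -
  define v where "v x = (\<Sum>\<^sub>\<infinity>p. c p * ee (of_int p * of_real x))" for x :: real
  have cv: "continuous_on A v" for A
    unfolding v_def by (rule continuous_on_infsum[OF _ _ M(2)])
      (use M(1) in \<open>auto simp: norm_mult norm_ee intro!: continuous_intros\<close>)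
  have cu: "continuous_on A u" for A
    using cont continuous_on_subset by blast
  have "u x - v x = 0"
  proof (rule fourier_uniqueness)
    show "u (x + 1) - v (x + 1) = u x - v x" for x
      by (simp add: v_def per ring_distribs ee_add)
    show "integral {0..1} (\<lambda>x. (u x - v x) * ee (- of_int k * of_real x)) = 0" for k :: int
      using fourier_coeff_series[OF M, of k]
      by (simp only: left_diff_distrib integral_diff integrable_continuous_real continuous_intros cu cv c[of k] flip: v_def) simp
  qed (intro continuous_intros cu cv)
  thus ?thesis by (simp add: v_def)
qed

section \<open>Smooth functions on the plane\<close>

text \<open>Continuity is local, while the majorants of the series below are uniform only where the
  real part of the first variable is bounded; the sublevel sets of \<open>\<phi>\<close> supply such
  regions.\<close>

lemma continuous_on_exhaust:
  fixes f :: "'a::topological_space \<Rightarrow> 'b::topological_space" and \<phi> :: "'a \<Rightarrow> real"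
  assumes \<phi>: "continuous_on UNIV \<phi>" and f: "\<And>R. continuous_on (A \<inter> {x. \<phi> x < R}) f"
  shows "continuous_on A f"
  unfolding continuous_on_def
proof
  fix x assume x: "x \<in> A"
  define U where "U = {y. \<phi> y < \<phi> x + 1}"
  have U: "open U" "x \<in> U"
    unfolding U_def using \<phi> by (auto intro!: open_Collect_less continuous_intros)
  have "(f \<longlongrightarrow> f x) (at x within (A \<inter> U))"
    using f[of "\<phi> x + 1"] x U(2) unfolding continuous_on_def U_def by blast
  thus "(f \<longlongrightarrow> f x) (at x within A)"
    using at_within_nhd[of x U A "A \<inter> U"] U by auto
qed

text \<open>Obtained from integration: the fundamental theorem for finite sums passes to the uniform
  limit and shows that the sum is a primitive of the continuous function given by the differentiated
  series.\<close>

lemma has_vector_derivative_infsum: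
  fixes f :: "'i \<Rightarrow> real \<Rightarrow> 'c::banach"
  assumes deriv: "\<And>p x. (f p has_vector_derivative f' p x) (at x)"
    and cont: "\<And>p. continuous_on UNIV (f' p)"
    and bound: "\<And>R. \<exists>M. M summable_on UNIV \<and> (\<forall>p x. \<bar>x\<bar> \<le> R \<longrightarrow> norm (f p x) \<le> M p \<and> norm (f' p x) \<le> M p)"
  shows "((\<lambda>x. \<Sum>\<^sub>\<infinity>p. f p x) has_vector_derivative (\<Sum>\<^sub>\<infinity>p. f' p x)) (at x)"
proof -
  define R where "R = \<bar>x\<bar> + 1"
  obtain M where M: "M summable_on UNIV" "\<And>p y. \<bar>y\<bar> \<le> R \<Longrightarrow> norm (f p y) \<le> M p" "\<And>p y. \<bar>y\<bar> \<le> R \<Longrightarrow> norm (f' p y) \<le> M p"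
    using bound by metis
  have cont': "continuous_on A (f' p)" for A p
    using cont continuous_on_subset by blast
  define F where "F y = (\<Sum>\<^sub>\<infinity>p. f p y)" for y
  define F' where "F' y = (\<Sum>\<^sub>\<infinity>p. f' p y)" for y
  have uf: "uniform_limit {-R..R} (\<lambda>X y. \<Sum>p\<in>X. f p y) F (finite_subsets_at_top UNIV)"
    unfolding F_def by (rule Weierstrass_m_test_general[OF _ M(1)]) (auto intro: M(2))
  have cF': "continuous_on {-R..R} F'"
    unfolding F'_def by (rule continuous_on_infsum[OF _ _ M(1)]) (auto intro: M(3) cont')
  have eq: "F y = F (-R) + integral {-R..y} F'" if y: "y \<in> {-R..R}" for y
  proof -
    have u: "uniform_limit {-R..y} (\<lambda>X t. \<Sum>p\<in>X. f' p t) F' (finite_subsets_at_top UNIV)"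
      unfolding F'_def using y by (intro Weierstrass_m_test_general[OF _ M(1)]) (auto intro!: M(3))
    obtain I J where IJ: "\<And>X. ((\<lambda>t. \<Sum>p\<in>X. f' p t) has_integral I X) {-R..y}"
       "(F' has_integral J) {-R..y}" "(I \<longlongrightarrow> J) (finite_subsets_at_top UNIV)"
      by (rule uniform_limit_integral[OF u]) (auto intro!: continuous_intros cont')
    have "((\<lambda>t. \<Sum>p\<in>X. f' p t) has_integral ((\<Sum>p\<in>X. f p y) - (\<Sum>p\<in>X. f p (-R)))) {-R..y}" for X
      using y by (intro fundamental_theorem_of_calculus has_vector_derivative_sum
          has_vector_derivative_at_within[OF deriv]) auto
    hence "I = (\<lambda>X. (\<Sum>p\<in>X. f p y) - (\<Sum>p\<in>X. f p (-R)))"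
      using IJ(1) has_integral_unique by blast
    moreover have "((\<lambda>X. (\<Sum>p\<in>X. f p y) - (\<Sum>p\<in>X. f p (-R))) \<longlongrightarrow> F y - F (-R)) (finite_subsets_at_top UNIV)"
      using y by (intro tendsto_diff tendsto_uniform_limitI[OF uf]) auto
    ultimately have "J = F y - F (-R)"
      using IJ(3) tendsto_unique finite_subsets_at_top_neq_bot by blast
    thus ?thesis using IJ(2) by (simp add: integral_unique)
  qed
  have d: "((\<lambda>y. F (-R) + integral {-R..y} F') has_vector_derivative 0 + F' x) (at x within {-R..R})"
    by (intro has_vector_derivative_add has_vector_derivative_const integral_has_vector_derivative cF')
       (auto simp: R_def)
  have "(F has_vector_derivative 0 + F' x) (at x within {-R..R})"
    by (rule has_vector_derivative_transform[OF _ eq d]) (auto simp: R_def)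
  moreover have "at x within {-R..R} = at x"
    by (intro at_within_interior) (auto simp: R_def)
  ultimately show ?thesis unfolding F_def[abs_def] F'_def by simp
qed

text \<open>Exchange of partial derivatives, by differentiating
  \<open>F n m - F n a = \<integral>\<^sub>a\<^sup>m G n \<mu> d\<mu>\<close> in \<open>n\<close>.\<close>

lemma partial_derivatives_commute:
  fixes F :: "real \<Rightarrow> real \<Rightarrow> 'c::banach"
  assumes F: "\<And>n m. ((\<lambda>x. F x m) has_vector_derivative Fn n m) (at n)"
    and G: "\<And>n m. ((\<lambda>x. G x m) has_vector_derivative Gn n m) (at n)"
    and FG: "\<And>n m. ((\<lambda>y. F n y) has_vector_derivative G n m) (at m)"
    and cont: "continuous_on UNIV (\<lambda>(n, m). G n m)" "continuous_on UNIV (\<lambda>(n, m). Gn n m)"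
  shows "((\<lambda>y. Fn n y) has_vector_derivative Gn n m) (at m)"
proof -
  \<comment> \<open>Strictly below \<open>m\<close>, so that \<open>m\<close> is interior to
    \<open>{a..m+1}\<close> and the derivative within the interval is the full one.\<close>
  define a where "a = m - 1"
  have cG: "continuous_on A (G n)" for n A
    using continuous_on_compose2[OF cont(1), of A "\<lambda>y. (n, y)"] by (simp add: continuous_on_Pair)
  have cGn: "continuous_on A (Gn n)" for n A
    using continuous_on_compose2[OF cont(2), of A "\<lambda>y. (n, y)"] by (simp add: continuous_on_Pair)
  have eq: "Fn n y = Fn n a + integral {a..y} (Gn n)" if "y \<in> {a..m+1}" for y
  proof -
    have "F n' y = F n' a + integral {a..y} (G n')" for n'
    proof -
      have "(G n' has_integral (F n' y - F n' a)) {a..y}"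
        using that by (intro fundamental_theorem_of_calculus)
          (auto intro: has_vector_derivative_at_within FG)
      thus ?thesis by (simp add: integral_unique)
    qed
    hence "((\<lambda>n'. F n' a + integral {a..y} (G n')) has_vector_derivative Fn n y) (at n)"
      using F[of y n] by simp
    moreover have "((\<lambda>n'. integral (cbox a y) (G n')) has_vector_derivative integral (cbox a y) (Gn n)) (at n)"
      by (rule leibniz_rule_vector_derivative[where U = UNIV, simplified])
         (auto intro: G integrable_continuous_real cG continuous_on_subset[OF cont(2)])
    hence "((\<lambda>n'. F n' a + integral {a..y} (G n')) has_vector_derivative Fn n a + integral {a..y} (Gn n)) (at n)"
      by (intro has_vector_derivative_add F) simp
    ultimately show ?thesis by (rule vector_derivative_unique_at)
  qed
  have d: "((\<lambda>y. Fn n a + integral {a..y} (Gn n)) has_vector_derivative 0 + Gn n m) (at m within {a..m+1})"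
    by (intro has_vector_derivative_add has_vector_derivative_const integral_has_vector_derivative cGn)
       (auto simp: a_def)
  have "(Fn n has_vector_derivative 0 + Gn n m) (at m within {a..m+1})"
    by (rule has_vector_derivative_transform[OF _ eq d]) (auto simp: a_def)
  moreover have "at m within {a..m+1} = at m"
    by (intro at_within_interior) (auto simp: a_def)
  ultimately show ?thesis by simp
qed

section \<open>From first partial derivatives to the full jet\<close>

definition partials :: "(real \<Rightarrow> real \<Rightarrow> complex) \<Rightarrow> (real \<Rightarrow> real \<Rightarrow> complex) \<Rightarrow> (real \<Rightarrow> real \<Rightarrow> complex) \<Rightarrow> bool" where
  "partials u un um \<longleftrightarrow> (\<forall>n m. ((\<lambda>x. u x m) has_vector_derivative un n m) (at n) \<and>
     ((\<lambda>y. u n y) has_vector_derivative um n m) (at m))"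

text \<open>A class of continuous functions closed under first partials is enough. The chosen
  partials are iterated with all \<open>dm\<close> applied first; the m-derivative of such an
  iterate sits below the \<open>dn\<close>s and is reached by exchanging partial
  derivatives.\<close>

lemma smooth_plane_coinduct:
  assumes "P s"
    and step: "\<And>u. P u \<Longrightarrow> continuous_on UNIV (\<lambda>(n, m). u n m) \<and> (\<exists>un um. P un \<and> P um \<and> partials u un um)"
  shows "smooth_plane s"
proof -
  obtain dn dm where d: "\<And>u. P u \<Longrightarrow> P (dn u) \<and> P (dm u) \<and> partials u (dn u) (dm u)"
    using step by metis
  define D where "D j k = (dn ^^ j) ((dm ^^ k) s)" for j k
  have Pn: "P ((dn ^^ j) u)" if "P u" for u j
    by (induction j) (use that d in auto)
  have Pm: "P ((dm ^^ k) u)" if "P u" for u k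
    by (induction k) (use that d in auto)
  have P: "P (D j k)" for j k
    unfolding D_def by (intro Pn Pm \<open>P s\<close>)
  have cont: "continuous_on UNIV (\<lambda>(n, m). u n m)" if "P u" for u
    using step[OF that] by blast
  have comm: "((\<lambda>y. (dn ^^ j) u n y) has_vector_derivative (dn ^^ j) (dm u) n m) (at m)" if "P u" for u j n m
  proof (induction j arbitrary: n m)
    case 0
    show ?case using d[OF that] by (simp add: partials_def)
  next
    case (Suc j)
    have u: "P (dm u)" using d that by blast
    show ?case
      unfolding funpow.simps o_def
    proof (rule partial_derivatives_commute[where F = "(dn ^^ j) u" and G = "(dn ^^ j) (dm u)"])
      show "((\<lambda>x. (dn ^^ j) u x m) has_vector_derivative dn ((dn ^^ j) u) n m) (at n)" for n m
        using d[OF Pn[OF that, of j]] by (simp add: partials_def)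
      show "((\<lambda>x. (dn ^^ j) (dm u) x m) has_vector_derivative dn ((dn ^^ j) (dm u)) n m) (at n)" for n m
        using d[OF Pn[OF u, of j]] by (simp add: partials_def)
      show "continuous_on UNIV (\<lambda>(n, m). (dn ^^ j) (dm u) n m)" by (intro cont Pn u)
      show "continuous_on UNIV (\<lambda>(n, m). dn ((dn ^^ j) (dm u)) n m)"
        using Pn[OF u, of "Suc j"] by (intro cont) simp
    qed (rule Suc.IH)
  qed
  show ?thesis
    unfolding smooth_plane_def
  proof (intro exI[of _ D] conjI allI)
    show "D 0 0 = s" by (simp add: D_def)
    show "continuous_on UNIV (\<lambda>(n, m). D j k n m)" for j k by (intro cont P)
    show "((\<lambda>x. D j k x m) has_vector_derivative D (Suc j) k n m) (at n)" for j k n m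
      using d[OF P[of j k]] by (simp add: D_def partials_def)
    show "((\<lambda>y. D j k n y) has_vector_derivative D j (Suc k) n m) (at m)" for j k n m
      using comm[OF Pm[OF \<open>P s\<close>, of k], of j n m] by (simp add: D_def)
  qed
qed

text \<open>The algebra generated by a jet, the coordinates and one exponential in
  \<open>n m\<close>. Differentiating the exponential produces coordinates; including them makes the
  class closed under both partials, as the coinduction principle demands.\<close>

inductive exp_alg :: "complex \<Rightarrow> (nat \<Rightarrow> nat \<Rightarrow> real \<Rightarrow> real \<Rightarrow> complex) \<Rightarrow> (real \<Rightarrow> real \<Rightarrow> complex) \<Rightarrow> bool"
  for c D where
  exp_alg_jet: "exp_alg c D (D j k)"
| exp_alg_const: "exp_alg c D (\<lambda>n m. z)"
| exp_alg_fst: "exp_alg c D (\<lambda>n m. of_real n)"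
| exp_alg_snd: "exp_alg c D (\<lambda>n m. of_real m)"
| exp_alg_exp: "exp_alg c D (\<lambda>n m. exp (c * of_real n * of_real m))"
| exp_alg_add: "exp_alg c D u \<Longrightarrow> exp_alg c D v \<Longrightarrow> exp_alg c D (\<lambda>n m. u n m + v n m)"
| exp_alg_mult: "exp_alg c D u \<Longrightarrow> exp_alg c D v \<Longrightarrow> exp_alg c D (\<lambda>n m. u n m * v n m)"

lemma smooth_plane_exp_alg:
  assumes D: "\<And>j k. continuous_on UNIV (\<lambda>(n, m). D j k n m) \<and> partials (D j k) (D (Suc j) k) (D j (Suc k))"
    and s: "exp_alg c D s"
  shows "smooth_plane s"
proof (rule smooth_plane_coinduct[of "exp_alg c D"])
  let ?G = "\<lambda>u. continuous_on UNIV (\<lambda>(n, m). u n m) \<and> (\<exists>un um. exp_alg c D un \<and> exp_alg c D um \<and> partials u un um)"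
  have I: "?G u" if "continuous_on UNIV (\<lambda>z. u (fst z) (snd z))" "exp_alg c D un" "exp_alg c D um" "partials u un um" for u un um
    using that by (auto simp: case_prod_unfold)
  have ident: "((\<lambda>x. complex_of_real x) has_vector_derivative 1) (at n)" for n
    using has_vector_derivative_of_real[OF DERIV_ident] by simp
  have exp: "((\<lambda>x. exp (a * of_real x)) has_vector_derivative a * exp (a * of_real n)) (at n)" for a :: complex and n
    by (rule has_vector_derivative_real_field[where f = "\<lambda>z. exp (a * z)"]) (auto intro!: derivative_eq_intros)
  fix u assume "exp_alg c D u"
  thus "?G u"
  proof induction
    case (exp_alg_jet j k)
    show ?case using D[of j k] exp_alg.exp_alg_jet by blast
  next
    case (exp_alg_const z)
    show ?case
      by (rule I[where un = "\<lambda>n m. 0" and um = "\<lambda>n m. 0"]) (auto simp: partials_def intro!: exp_alg.intros)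
  next
    case exp_alg_fst
    show ?case
      by (rule I[where un = "\<lambda>n m. 1" and um = "\<lambda>n m. 0"])
         (auto simp: partials_def ident intro!: exp_alg.intros continuous_intros)
  next
    case exp_alg_snd
    show ?case
      by (rule I[where un = "\<lambda>n m. 0" and um = "\<lambda>n m. 1"])
         (auto simp: partials_def ident intro!: exp_alg.intros continuous_intros)
  next
    case exp_alg_exp
    show ?case
    proof (rule I[where un = "\<lambda>n m. (c * of_real m) * exp (c * of_real n * of_real m)"
             and um = "\<lambda>n m. (c * of_real n) * exp (c * of_real n * of_real m)"])
      show "partials (\<lambda>n m. exp (c * of_real n * of_real m)) (\<lambda>n m. (c * of_real m) * exp (c * of_real n * of_real m))
         (\<lambda>n m. (c * of_real n) * exp (c * of_real n * of_real m))"
        unfolding partials_def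
      proof (intro allI conjI)
        fix n m :: real
        show "((\<lambda>x. exp (c * of_real x * of_real m)) has_vector_derivative c * of_real m * exp (c * of_real n * of_real m)) (at n)"
          using exp[of "c * of_real m" n] by (simp add: mult_ac)
        show "((\<lambda>x. exp (c * of_real n * of_real x)) has_vector_derivative c * of_real n * exp (c * of_real n * of_real m)) (at m)"
          by (rule exp)
      qed
    qed (intro exp_alg.intros continuous_intros)+
  next
    case (exp_alg_add u v)
    then obtain un um vn vm where *: "exp_alg c D un" "exp_alg c D um" "exp_alg c D vn" "exp_alg c D vm"
      "partials u un um" "partials v vn vm" by blast
    show ?case
    proof (rule I[where un = "\<lambda>n m. un n m + vn n m" and um = "\<lambda>n m. um n m + vm n m"])
      show "partials (\<lambda>n m. u n m + v n m) (\<lambda>n m. un n m + vn n m) (\<lambda>n m. um n m + vm n m)"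
        using * by (auto simp: partials_def intro!: has_vector_derivative_add)
      show "continuous_on UNIV (\<lambda>z. u (fst z) (snd z) + v (fst z) (snd z))"
        using exp_alg_add.IH by (intro continuous_on_add) (auto simp: case_prod_unfold)
    qed (intro exp_alg.intros *)+
  next
    case (exp_alg_mult u v)
    then obtain un um vn vm where *: "exp_alg c D un" "exp_alg c D um" "exp_alg c D vn" "exp_alg c D vm"
      "partials u un um" "partials v vn vm" by blast
    show ?case
    proof (rule I[where un = "\<lambda>n m. u n m * vn n m + un n m * v n m" and um = "\<lambda>n m. u n m * vm n m + um n m * v n m"])
      show "partials (\<lambda>n m. u n m * v n m) (\<lambda>n m. u n m * vn n m + un n m * v n m) (\<lambda>n m. u n m * vm n m + um n m * v n m)"
        using * by (auto simp: partials_def intro!: has_vector_derivative_mult)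
      show "continuous_on UNIV (\<lambda>z. u (fst z) (snd z) * v (fst z) (snd z))"
        using exp_alg_mult.IH by (intro continuous_on_mult) (auto simp: case_prod_unfold)
    qed (intro exp_alg.intros * exp_alg_mult.hyps)+
  qed
qed (rule s)

lemma smooth_plane_exp_mult:
  assumes "smooth_plane s"
  shows "smooth_plane (\<lambda>n m. z * exp (c * of_real n * of_real m) * s n m)"
proof -
  obtain D where D: "D 0 0 = s" "\<And>j k. continuous_on UNIV (\<lambda>(n, m). D j k n m) \<and> partials (D j k) (D (Suc j) k) (D j (Suc k))"
    using assms unfolding smooth_plane_def partials_def by blast
  have "exp_alg c D (\<lambda>n m. z * exp (c * of_real n * of_real m) * D 0 0 n m)"
    by (intro exp_alg.intros)
  from smooth_plane_exp_alg[OF D(2) this] show ?thesis by (simp add: D(1))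
qed

section \<open>The Zak transform of rapidly decreasing functions\<close>

text \<open>The p-th Fourier coefficient in \<open>m\<close> of the stripped transform, up to 1 /
  sqrt N. The argument type is polymorphic so that one formula serves functions on the line and
  their continuations.\<close>

definition zc :: "nat \<Rightarrow> ('a::field \<Rightarrow> int \<Rightarrow> complex) \<Rightarrow> int \<Rightarrow> 'a \<Rightarrow> complex" where
  "zc N G p z = (\<Sum>l\<in>{0..<int N}. G (z + of_int p / of_nat N) l * ee (of_int l * of_int p / of_nat N))"

text \<open>The inverse finite Fourier transform in \<open>l\<close>: translating by
  \<open>- p / N\<close> brings every coefficient back to the same point. One residue system of
  \<open>p\<close> suffices because \<open>zc\<close> at \<open>p + N\<close> is \<open>zc\<close>
  at \<open>p\<close> translated by 1.\<close>

definition zinv :: "nat \<Rightarrow> (int \<Rightarrow> 'a::field \<Rightarrow> complex) \<Rightarrow> 'a \<Rightarrow> int \<Rightarrow> complex" where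
  "zinv N C z l = (\<Sum>p\<in>{0..<int N}. C p (z - of_int p / of_nat N) * ee (- (of_int l * of_int p / of_nat N))) / of_nat N"

section \<open>Inversion of the finite Fourier transform\<close>

lemma ee_eq_1_iff: "ee z = 1 \<longleftrightarrow> z \<in> \<int>"
proof
  assume "ee z = 1"
  then obtain n :: int where n: "Re (2 * complex_of_real pi * \<i> * z) = 0" "Im (2 * complex_of_real pi * \<i> * z) = of_int (2 * n) * pi"
    unfolding ee_def exp_eq_1 by blast
  hence "z = of_int n" by (simp add: complex_eq_iff)
  thus "z \<in> \<int>" by simp
qed (auto elim: Ints_cases)

lemma ee_power: "ee z ^ n = ee (of_nat n * z)"
  unfolding ee_def exp_of_nat_mult[symmetric] by (simp add: mult_ac)

lemma sum_int_range:
  fixes f :: "int \<Rightarrow> 'b::comm_monoid_add"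
  shows "(\<Sum>l\<in>{0..<int N}. f l) = (\<Sum>l<N. f (int l))"
  by (rule sum.reindex_bij_witness[of _ int nat]) auto

lemma sum_roots_of_unity:
  assumes "N > 0"
  shows "(\<Sum>l\<in>{0..<int N}. ee (of_int l * of_int k / of_nat N)) = (if int N dvd k then of_nat N else 0)"
proof -
  define w where "w = ee (of_int k / of_nat N)"
  have sum: "(\<Sum>l\<in>{0..<int N}. ee (of_int l * of_int k / of_nat N)) = (\<Sum>l<N. w ^ l)"
    by (simp add: sum_int_range w_def ee_power)
  have "w = 1 \<longleftrightarrow> int N dvd k"
  proof
    assume "w = 1"
    then obtain j :: int where "complex_of_int k / of_nat N = of_int j"
      unfolding w_def ee_eq_1_iff by (auto elim: Ints_cases)
    hence "complex_of_int k = of_int (j * int N)" using assms by (simp add: field_simps)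
    hence "k = j * int N" using of_int_eq_iff by blast
    thus "int N dvd k" by simp
  next
    assume "int N dvd k"
    then obtain j where "k = int N * j" by blast
    thus "w = 1" using assms by (simp add: w_def)
  qed
  moreover have "w ^ N = 1" using assms by (simp add: w_def ee_power)
  ultimately show ?thesis unfolding sum by (auto simp: sum_gp_strict)
qed

lemma int_periodic_mod:
  fixes \<phi> :: "int \<Rightarrow> 'b"
  assumes "\<And>l. \<phi> (l + int N) = \<phi> l"
  shows "\<phi> (l mod int N) = \<phi> l"
proof -
  have "\<phi> (l + int N * j) = \<phi> l" for l j
  proof (induction j rule: int_induct[where k = 0])
    case (step1 i)
    thus ?case using assms[of "l + int N * i"] by (simp add: algebra_simps)
  next
    case (step2 i)
    thus ?case using assms[of "l + int N * (i - 1)"] by (simp add: algebra_simps)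
  qed simp
  from this[of "l mod int N" "l div int N"] show ?thesis by (simp add: mult.commute)
qed

lemma sum_dvd_delta:
  assumes N: "N > 0" and \<phi>: "\<And>l::int. \<phi> (l + int N) = (\<phi> l :: 'b::comm_monoid_add)"
  shows "(\<Sum>k\<in>{0..<int N}. if int N dvd (k - l) then \<phi> k else 0) = \<phi> l"
proof -
  have "(\<Sum>k\<in>{0..<int N}. if int N dvd (k - l) then \<phi> k else 0) = (\<Sum>k\<in>{0..<int N}. if k = l mod int N then \<phi> k else 0)"
  proof (intro sum.cong if_cong refl)
    fix k assume k: "k \<in> {0..<int N}"
    have "int N dvd (k - l) \<longleftrightarrow> k mod int N = l mod int N" by (simp add: mod_eq_dvd_iff)
    also have "k mod int N = k" using k by simp
    finally show "int N dvd (k - l) \<longleftrightarrow> k = l mod int N" .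
  qed
  also have "\<dots> = \<phi> (l mod int N)" using N by simp
  also have "\<dots> = \<phi> l" by (rule int_periodic_mod[of \<phi>, OF \<phi>])
  finally show ?thesis .
qed

text \<open>Once the translations are undone, all values of \<open>G\<close> are taken at
  \<open>z\<close>, and the sum over \<open>p\<close> is orthogonality of characters, which selects
  the \<open>k\<close> congruent to \<open>l\<close>.\<close>

lemma zinv_zc:
  fixes G :: "'a::field \<Rightarrow> int \<Rightarrow> complex"
  assumes N: "N > 0" and per: "\<And>l. G z (l + int N) = G z l"
  shows "zinv N (zc N G) z l = G z l"
proof -
  have "(\<Sum>p\<in>{0..<int N}. zc N G p (z - of_int p / of_nat N) * ee (- (of_int l * of_int p / of_nat N))) =
     (\<Sum>p\<in>{0..<int N}. \<Sum>k\<in>{0..<int N}. G z k * ee (of_int p * of_int (k - l) / of_nat N))"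
    unfolding zc_def
    by (intro sum.cong refl) (simp add: sum_distrib_right mult.assoc flip: ee_add,
         simp add: algebra_simps diff_divide_distrib)
  also have "\<dots> = (\<Sum>k\<in>{0..<int N}. G z k * (\<Sum>p\<in>{0..<int N}. ee (of_int p * of_int (k - l) / of_nat N)))"
    by (subst sum.swap) (simp add: sum_distrib_left)
  also have "\<dots> = (\<Sum>k\<in>{0..<int N}. if int N dvd (k - l) then G z k * of_nat N else 0)"
    unfolding sum_roots_of_unity[OF N] by (intro sum.cong) auto
  also have "\<dots> = G z l * of_nat N"
    by (rule sum_dvd_delta[OF N]) (simp add: per)
  finally show ?thesis using N by (simp add: zinv_def)
qed

text \<open>Here the sum over \<open>l\<close> is the orthogonality relation. It selects the
  \<open>q\<close> congruent to \<open>p\<close>, and the hypothesis on \<open>C\<close> makes the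
  translated value at \<open>q\<close> agree with that at \<open>p\<close>.\<close>

lemma zc_zinv:
  fixes C :: "int \<Rightarrow> 'a::field_char_0 \<Rightarrow> complex"
  assumes N: "N > 0" and C: "\<And>p z. C (p + int N) z = C p (z + 1)"
  shows "zc N (zinv N C) p z = C p z"
proof -
  have "zc N (zinv N C) p z = (\<Sum>l\<in>{0..<int N}. \<Sum>q\<in>{0..<int N}.
     C q (z + of_int (p - q) / of_nat N) * ee (of_int l * of_int (p - q) / of_nat N)) / of_nat N"
    unfolding zc_def zinv_def sum_divide_distrib
    by (intro sum.cong refl) (simp add: sum_distrib_right sum_divide_distrib mult.assoc flip: ee_add,
       simp add: algebra_simps diff_divide_distrib)
  also have "\<dots> = (\<Sum>q\<in>{0..<int N}. C q (z + of_int (p - q) / of_nat N) *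
      (\<Sum>l\<in>{0..<int N}. ee (of_int l * of_int (p - q) / of_nat N))) / of_nat N"
    by (subst sum.swap) (simp add: sum_distrib_left)
  also have "\<dots> = (\<Sum>q\<in>{0..<int N}. if int N dvd (q - p) then C q (z + of_int (p - q) / of_nat N) * of_nat N else 0) / of_nat N"
    unfolding sum_roots_of_unity[OF N] by (intro arg_cong2[where f = "(/)"] sum.cong) (auto simp: dvd_diff_commute)
  also have "(\<Sum>q\<in>{0..<int N}. if int N dvd (q - p) then C q (z + of_int (p - q) / of_nat N) * of_nat N else 0) = C p (z + of_int (p - p) / of_nat N) * of_nat N"
  proof (rule sum_dvd_delta[OF N])
    fix l
    have *: "z + of_int (p - (l + int N)) / of_nat N + 1 = z + of_int (p - l) / (of_nat N :: 'a)"
      using N by (simp add: field_simps)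
    show "C (l + int N) (z + of_int (p - (l + int N)) / of_nat N) * of_nat N = C l (z + of_int (p - l) / of_nat N) * of_nat N"
      by (simp only: C *)
  qed
  finally show ?thesis using N by simp
qed

lemma zinv_periodic:
  assumes "N > 0"
  shows "zinv N C z (l + int N) = zinv N C z l"
proof -
  have "ee (- (of_int (l + int N) * of_int p / of_nat N)) = ee (- (of_int l * of_int p / of_nat N))" for p
  proof -
    have "- (of_int (l + int N) * of_int p / of_nat N) = - (of_int l * of_int p / of_nat N) + complex_of_int (- p)"
      using assms by (simp add: field_simps)
    thus ?thesis by (simp only: ee_add ee_of_int mult_1_right)
  qed
  thus ?thesis by (simp only: zinv_def)
qed

lemma zc_quasi_periodic:
  assumes "N > 0"
  shows "zc N G p (z + 1) = zc N G (p + int N) (z :: 'a::field_char_0)"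
proof -
  have *: "z + 1 + of_int p / of_nat N = z + of_int (p + int N) / of_nat N"
    "of_int l * of_int (p + int N) / (of_nat N :: complex) = of_int l * of_int p / of_nat N + of_int l" for l
    using assms by (simp_all add: field_simps)
  show ?thesis by (simp only: zc_def * ee_add ee_of_int mult_1_right)
qed

section \<open>The transform as a Fourier series, and its quasi-periodicity\<close>

text \<open>The candidate for the continuation of a section: \<open>G\<close> continues the function
  in the first variable, and the Fourier factors are entire in the second. Convergence depends on
  the decay of \<open>G\<close>.\<close>

definition zak_ext :: "nat \<Rightarrow> (complex \<Rightarrow> int \<Rightarrow> complex) \<Rightarrow> complex \<Rightarrow> complex \<Rightarrow> complex" where
  "zak_ext N G z w = of_real (1 / sqrt (real N)) * ee (of_nat N * w * z / 2) *
     (\<Sum>\<^sub>\<infinity>p. zc N G p z * ee (of_int p * w))"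

lemma zak_eq:
  "zak N f n m = of_real (1 / sqrt (real N)) * ee (of_nat N * of_real m * of_real n / 2) *
     (\<Sum>\<^sub>\<infinity>p. zc N f p n * ee (of_int p * of_real m))"
proof -
  have "exp (complex_of_real pi * \<i> * of_nat N * of_real m * of_real n) = ee (of_nat N * of_real m * of_real n / 2)"
    by (simp add: ee_def mult_ac)
  moreover have "exp (2 * complex_of_real pi * \<i> * of_real m * of_int p) = ee (of_int p * of_real m)" for p
    by (simp add: ee_def mult_ac)
  moreover have "exp (2 * complex_of_real pi * \<i> * of_int l * of_int p / of_nat N) = ee (of_int l * of_int p / of_nat N)" for l p
    by (simp add: ee_def mult_ac)
  moreover have "f (n + of_int p / real N) l * ee (of_int p * of_real m) * ee (of_int l * of_int p / of_nat N) =
      f (n + of_int p / real N) l * ee (of_int l * of_int p / of_nat N) * ee (of_int p * of_real m)" for l p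
    by simp
  ultimately show ?thesis
    by (simp only: zak_def zc_def sum_distrib_right)
qed

lemma zak_ext_eq_zak:
  assumes "\<And>x l. G (of_real x) l = f x l"
  shows "zak_ext N G (of_real n) (of_real m) = zak N f n m"
proof -
  have "zc N G p (of_real n) = zc N f p n" for p
    using assms[of "n + of_int p / real N"] by (simp add: zc_def)
  thus ?thesis by (simp add: zak_ext_def zak_eq)
qed

lemma infsum_int_shift:
  fixes f :: "int \<Rightarrow> 'b::{comm_monoid_add, t2_space}"
  shows "(\<Sum>\<^sub>\<infinity>p. f (p + k)) = (\<Sum>\<^sub>\<infinity>p. f p)"
  by (intro infsum_reindex_bij_betw bij_betw_byWitness[of _ "\<lambda>p. p - k"]) auto

text \<open>Translating \<open>n\<close> by 1 moves the summation index by \<open>N\<close>, which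
  yields \<open>ee (- N m)\<close>; the quadratic prefactor contributes \<open>ee (N m / 2)\<close>,
  leaving the required half.\<close>

lemma zak_quasi_periodic:
  assumes "N > 0"
  shows "zak N f (n + 1) m = exp (- (complex_of_real pi * \<i> * of_nat N * of_real m)) * zak N f n m"
    and "zak N f n (m + 1) = exp (complex_of_real pi * \<i> * of_nat N * of_real n) * zak N f n m"
proof -
  have e: "exp (complex_of_real pi * \<i> * of_nat N * z) = ee (of_nat N * z / 2)"
     "exp (- (complex_of_real pi * \<i> * of_nat N * z)) = ee (- (of_nat N * z / 2))" for z
    by (simp_all add: ee_def mult_ac)
  have "(\<Sum>\<^sub>\<infinity>p. zc N f p (n + 1) * ee (of_int p * of_real m)) =
     (\<Sum>\<^sub>\<infinity>p. ee (- (of_nat N * of_real m)) * (zc N f (p + int N) n * ee (of_int (p + int N) * of_real m)))"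
  proof (rule infsum_cong)
    fix p
    have "ee (- (of_nat N * of_real m)) * ee (of_int (p + int N) * of_real m) = ee (of_int p * of_real m)"
      unfolding ee_add[symmetric] by (rule arg_cong[where f = ee]) (simp add: algebra_simps)
    thus "zc N f p (n + 1) * ee (of_int p * of_real m) =
       ee (- (of_nat N * of_real m)) * (zc N f (p + int N) n * ee (of_int (p + int N) * of_real m))"
      unfolding zc_quasi_periodic[OF assms] by (metis mult.left_commute)
  qed
  also have "\<dots> = ee (- (of_nat N * of_real m)) * (\<Sum>\<^sub>\<infinity>p. zc N f p n * ee (of_int p * of_real m))"
    by (simp only: infsum_cmult_right') (simp only: infsum_int_shift[where k = "int N" and f = "\<lambda>p. zc N f p n * ee (of_int p * of_real m)"])
  finally have S: "(\<Sum>\<^sub>\<infinity>p. zc N f p (n + 1) * ee (of_int p * of_real m)) = ee (- (of_nat N * of_real m)) * (\<Sum>\<^sub>\<infinity>p. zc N f p n * ee (of_int p * of_real m))" .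
  have E: "ee (of_nat N * of_real m * of_real (n + 1) / 2) * ee (- (of_nat N * of_real m)) =
      ee (- (of_nat N * of_real m / 2)) * ee (of_nat N * of_real m * of_real n / 2)"
    unfolding ee_add[symmetric] by (rule arg_cong[where f = ee]) (simp add: field_simps)
  have "c * x * (a * S) = b * (c * y * S)" if "x * a = b * y" for a b c x y S :: complex
    using arg_cong[OF that, of "\<lambda>u. c * u * S"] by (simp only: mult_ac)
  from this[OF E] show "zak N f (n + 1) m = exp (- (complex_of_real pi * \<i> * of_nat N * of_real m)) * zak N f n m"
    unfolding zak_eq e mult.assoc[of "complex_of_real pi * \<i>"] S by (simp only: e(2)[simplified mult.assoc] mult.assoc)
  have "ee (of_int p * of_real (m + 1)) = ee (of_int p * of_real m)" for p
    by (simp add: ring_distribs ee_add)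
  moreover have "ee (of_nat N * of_real (m + 1) * of_real n / 2) = ee (of_nat N * of_real n / 2) * ee (of_nat N * of_real m * of_real n / 2)"
    unfolding ee_add[symmetric] by (rule arg_cong[where f = ee]) (simp add: field_simps)
  ultimately show "zak N f n (m + 1) = exp (complex_of_real pi * \<i> * of_nat N * of_real n) * zak N f n m"
    unfolding zak_eq e by (simp only: mult_ac)
qed

section \<open>Rapid decrease and majorants for periodized series\<close>

text \<open>The positive weight (1 + |y|)^K, equivalent to the monomials in \<open>schwartz\<close>,
  is submultiplicative under translation and compares directly with the index \<open>p\<close> of a
  sample point.\<close>

definition rapid :: "(real \<Rightarrow> complex) \<Rightarrow> bool" where
  "rapid \<phi> \<longleftrightarrow> (\<forall>K::nat. \<exists>C. \<forall>y. (1 + \<bar>y\<bar>) ^ K * norm (\<phi> y) \<le> C)"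

lemma one_plus_power_le:
  fixes t :: real assumes "t \<ge> 0" shows "(1 + t) ^ K \<le> 2 ^ K * (1 + t ^ K)"
proof -
  have "(1 + t) ^ K \<le> (2 * max 1 t) ^ K" using assms by (intro power_mono) auto
  also have "\<dots> = 2 ^ K * max 1 t ^ K" by (simp add: power_mult_distrib)
  also have "max 1 t ^ K \<le> 1 + t ^ K" using assms by (auto simp: max_def)
  finally show ?thesis by simp
qed

lemma rapid_iff: "rapid \<phi> \<longleftrightarrow> (\<forall>j. bounded (range (\<lambda>x. x ^ j *\<^sub>R \<phi> x)))"
proof
  assume r: "rapid \<phi>"
  show "\<forall>j. bounded (range (\<lambda>x. x ^ j *\<^sub>R \<phi> x))"
  proof
    fix j
    obtain C where C: "\<And>y. (1 + \<bar>y\<bar>) ^ j * norm (\<phi> y) \<le> C" using r unfolding rapid_def by blast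
    have "norm (y ^ j *\<^sub>R \<phi> y) \<le> C" for y
    proof -
      have "norm (y ^ j *\<^sub>R \<phi> y) = \<bar>y\<bar> ^ j * norm (\<phi> y)" by (simp add: power_abs)
      also have "\<dots> \<le> (1 + \<bar>y\<bar>) ^ j * norm (\<phi> y)" by (intro mult_right_mono power_mono) auto
      finally show ?thesis using C[of y] by simp
    qed
    thus "bounded (range (\<lambda>x. x ^ j *\<^sub>R \<phi> x))" by (auto simp: bounded_iff)
  qed
next
  assume b: "\<forall>j. bounded (range (\<lambda>x. x ^ j *\<^sub>R \<phi> x))"
  show "rapid \<phi>" unfolding rapid_def
  proof
    fix K
    obtain A where A: "\<And>y. norm (y ^ 0 *\<^sub>R \<phi> y) \<le> A" using b[rule_format, of 0] unfolding bounded_iff by blast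
    obtain B where B: "\<And>y. norm (y ^ K *\<^sub>R \<phi> y) \<le> B" using b[rule_format, of K] unfolding bounded_iff by blast
    have "(1 + \<bar>y\<bar>) ^ K * norm (\<phi> y) \<le> 2 ^ K * (A + B)" for y
    proof -
      have "(1 + \<bar>y\<bar>) ^ K * norm (\<phi> y) \<le> 2 ^ K * (1 + \<bar>y\<bar> ^ K) * norm (\<phi> y)"
        by (intro mult_right_mono one_plus_power_le) auto
      also have "\<dots> = 2 ^ K * (norm (y ^ 0 *\<^sub>R \<phi> y) + norm (y ^ K *\<^sub>R \<phi> y))"
        by (simp add: power_abs algebra_simps)
      also have "\<dots> \<le> 2 ^ K * (A + B)" by (intro mult_left_mono add_mono A B) auto
      finally show ?thesis .
    qed
    thus "\<exists>C. \<forall>y. (1 + \<bar>y\<bar>) ^ K * norm (\<phi> y) \<le> C" by blast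
  qed
qed

lemma rapid_add: "rapid \<phi> \<Longrightarrow> rapid \<psi> \<Longrightarrow> rapid (\<lambda>x. \<phi> x + \<psi> x)"
  unfolding rapid_def
proof
  fix K assume "\<forall>K. \<exists>C. \<forall>y. (1 + \<bar>y\<bar>) ^ K * norm (\<phi> y) \<le> C" "\<forall>K. \<exists>C. \<forall>y. (1 + \<bar>y\<bar>) ^ K * norm (\<psi> y) \<le> C"
  then obtain A B where AB: "\<And>y. (1 + \<bar>y\<bar>) ^ K * norm (\<phi> y) \<le> A" "\<And>y. (1 + \<bar>y\<bar>) ^ K * norm (\<psi> y) \<le> B" by metis
  have "(1 + \<bar>y\<bar>) ^ K * norm (\<phi> y + \<psi> y) \<le> A + B" for y
  proof -
    have "(1 + \<bar>y\<bar>) ^ K * norm (\<phi> y + \<psi> y) \<le> (1 + \<bar>y\<bar>) ^ K * (norm (\<phi> y) + norm (\<psi> y))"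
      by (intro mult_left_mono norm_triangle_ineq) auto
    also have "\<dots> \<le> A + B" using AB[of y] by (simp add: ring_distribs)
    finally show ?thesis .
  qed
  thus "\<exists>C. \<forall>y. (1 + \<bar>y\<bar>) ^ K * norm (\<phi> y + \<psi> y) \<le> C" by blast
qed

lemma rapid_mult_bounded:
  assumes "rapid \<phi>" "\<And>x. norm (\<psi> x) \<le> B"
  shows "rapid (\<lambda>x. \<psi> x * \<phi> x)"
  unfolding rapid_def
proof
  fix K
  obtain A where A: "\<And>y. (1 + \<bar>y\<bar>) ^ K * norm (\<phi> y) \<le> A" using assms(1) unfolding rapid_def by blast
  have "(1 + \<bar>y\<bar>) ^ K * norm (\<psi> y * \<phi> y) \<le> B * A" for y
  proof -
    have "(1 + \<bar>y\<bar>) ^ K * norm (\<psi> y * \<phi> y) = norm (\<psi> y) * ((1 + \<bar>y\<bar>) ^ K * norm (\<phi> y))" by (simp add: norm_mult)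
    also have "\<dots> \<le> B * A" using assms(2)[of y] order_trans[OF norm_ge_zero assms(2)[of y]]
      by (intro mult_mono A) auto
    finally show ?thesis .
  qed
  thus "\<exists>C. \<forall>y. (1 + \<bar>y\<bar>) ^ K * norm (\<psi> y * \<phi> y) \<le> C" by blast
qed

lemma rapid_translate:
  assumes "rapid \<phi>" shows "rapid (\<lambda>x. \<phi> (x - a))"
  unfolding rapid_def
proof
  fix K
  obtain A where A: "\<And>y. (1 + \<bar>y\<bar>) ^ K * norm (\<phi> y) \<le> A" using assms(1) unfolding rapid_def by blast
  have "(1 + \<bar>y\<bar>) ^ K * norm (\<phi> (y - a)) \<le> (1 + \<bar>a\<bar>) ^ K * A" for y
  proof -
    have "1 + \<bar>y\<bar> \<le> (1 + \<bar>a\<bar>) * (1 + \<bar>y - a\<bar>)"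
    proof -
      have "(1 + \<bar>a\<bar>) * (1 + \<bar>y - a\<bar>) = 1 + \<bar>a\<bar> + \<bar>y - a\<bar> + \<bar>a\<bar> * \<bar>y - a\<bar>" by (simp add: ring_distribs)
      moreover have "\<bar>a\<bar> * \<bar>y - a\<bar> \<ge> 0" by simp
      ultimately show ?thesis by linarith
    qed
    hence "(1 + \<bar>y\<bar>) ^ K * norm (\<phi> (y - a)) \<le> ((1 + \<bar>a\<bar>) * (1 + \<bar>y - a\<bar>)) ^ K * norm (\<phi> (y - a))"
      by (intro mult_right_mono power_mono) auto
    also have "\<dots> = (1 + \<bar>a\<bar>) ^ K * ((1 + \<bar>y - a\<bar>) ^ K * norm (\<phi> (y - a)))" by (simp add: power_mult_distrib)
    also have "\<dots> \<le> (1 + \<bar>a\<bar>) ^ K * A" by (intro mult_left_mono A) auto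
    finally show ?thesis .
  qed
  thus "\<exists>C. \<forall>y. (1 + \<bar>y\<bar>) ^ K * norm (\<phi> (y - a)) \<le> C" by blast
qed

lemma schwartz_iff:
  "schwartz f \<longleftrightarrow> (\<exists>D :: nat \<Rightarrow> real \<Rightarrow> complex. D 0 = f \<and>
     (\<forall>k x. (D k has_vector_derivative D (Suc k) x) (at x)) \<and> (\<forall>k. rapid (D k)))"
  unfolding schwartz_def rapid_iff by blast

lemma schwartz_add:
  assumes "schwartz f" "schwartz g" shows "schwartz (\<lambda>x. f x + g x)"
proof -
  obtain D where D: "D 0 = f" "\<And>k x. (D k has_vector_derivative D (Suc k) x) (at x)" "\<And>k. rapid (D k)"
    using assms(1) unfolding schwartz_iff by blast
  obtain E where E: "E 0 = g" "\<And>k x. (E k has_vector_derivative E (Suc k) x) (at x)" "\<And>k. rapid (E k)"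
    using assms(2) unfolding schwartz_iff by blast
  show ?thesis unfolding schwartz_iff
    by (rule exI[of _ "\<lambda>k x. D k x + E k x"]) (auto simp: D E intro!: has_vector_derivative_add rapid_add)
qed

lemma schwartz_cmult:
  assumes "schwartz f" shows "schwartz (\<lambda>x. c * f x)"
proof -
  obtain D where D: "D 0 = f" "\<And>k x. (D k has_vector_derivative D (Suc k) x) (at x)" "\<And>k. rapid (D k)"
    using assms(1) unfolding schwartz_iff by blast
  show ?thesis unfolding schwartz_iff
    by (rule exI[of _ "\<lambda>k x. c * D k x"])
       (auto simp: D intro!: has_vector_derivative_mult_right rapid_mult_bounded[of _ "\<lambda>x. c" "norm c"])
qed

lemma schwartz_translate:
  assumes "schwartz f" shows "schwartz (\<lambda>x. f (x - a))"
proof -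
  obtain D where D: "D 0 = f" "\<And>k x. (D k has_vector_derivative D (Suc k) x) (at x)" "\<And>k. rapid (D k)"
    using assms(1) unfolding schwartz_iff by blast
  have "((\<lambda>x. D k (x - a)) has_vector_derivative D (Suc k) (x - a)) (at x)" for k x
  proof -
    have "((\<lambda>x. x - a) has_vector_derivative 1) (at x)" by (auto intro!: derivative_eq_intros)
    from vector_diff_chain_at[OF this D(2)] show ?thesis by (simp add: o_def)
  qed
  thus ?thesis unfolding schwartz_iff
    by (intro exI[of _ "\<lambda>k x. D k (x - a)"]) (auto simp: D intro!: rapid_translate)
qed

lemma schwartz_0: "schwartz (\<lambda>x. 0)"
  unfolding schwartz_iff by (rule exI[of _ "\<lambda>k x. 0"]) (auto simp: rapid_def)

lemma schwartz_sum:
  assumes "\<And>i. i \<in> I \<Longrightarrow> schwartz (f i)"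
  shows "schwartz (\<lambda>x. \<Sum>i\<in>I. f i x)"
  using assms by (induction I rule: infinite_finite_induct) (auto intro: schwartz_0 schwartz_add)

lemma schwartz_rapid: "schwartz f \<Longrightarrow> rapid f"
  unfolding schwartz_iff by auto

lemma schwartz_continuous: "schwartz f \<Longrightarrow> continuous_on A f"
  unfolding schwartz_iff
  by (metis continuous_at_imp_continuous_on has_vector_derivative_continuous)

lemma summable_inverse_square_int: "(\<lambda>p::int. 1 / (1 + real_of_int p ^ 2)) summable_on UNIV"
proof -
  have *: "(\<lambda>n::nat. 1 / (1 + real n ^ 2)) summable_on UNIV"
  proof (rule norm_summable_imp_summable_on)
    show "summable (\<lambda>n. norm (1 / (1 + real n ^ 2)))"
    proof (rule summable_comparison_test'[of "\<lambda>n. 1 / real n ^ 2" 1])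
      show "summable (\<lambda>n. 1 / real n ^ 2)" using inverse_power_summable[of 2, where 'a = real] by (simp add: field_simps)
    qed (auto simp: field_simps add_pos_pos)
  qed
  have "(\<lambda>p::int. 1 / (1 + real_of_int p ^ 2)) summable_on (range int)"
    by (subst summable_on_reindex) (auto simp: o_def *)
  moreover have "(\<lambda>p::int. 1 / (1 + real_of_int p ^ 2)) summable_on (range (\<lambda>n. - int n))"
    by (subst summable_on_reindex) (auto simp: o_def * inj_on_def)
  ultimately have "(\<lambda>p::int. 1 / (1 + real_of_int p ^ 2)) summable_on (range int \<union> range (\<lambda>n. - int n))"
    by (rule summable_on_union)
  also have "range int \<union> range (\<lambda>n. - int n) = UNIV"
  proof -
    have "p \<in> range int \<union> range (\<lambda>n. - int n)" for p by (cases p rule: int_cases2) auto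
    thus ?thesis by blast
  qed
  finally show ?thesis .
qed

text \<open>Of the \<open>k + 2\<close> powers of decay, \<open>k\<close> pay for the factor |p|^k,
  which arises from differentiating in \<open>m\<close>, and two make the majorant summable.\<close>

lemma rapid_periodization_bound:
  assumes \<phi>: "rapid \<phi>" and N: "N > 0"
  shows "\<exists>M. M summable_on UNIV \<and> (\<forall>p x. \<bar>x\<bar> \<le> R \<longrightarrow> \<bar>real_of_int p\<bar> ^ k * norm (\<phi> (x + of_int p / real N)) \<le> M p)"
proof -
  \<comment> \<open>Chosen so that 1 + |p| \<le> A (1 + |y|) at y = x + p/N whenever |x| \<le>
    R.\<close>
  define A where "A = 1 + real N + real N * \<bar>R\<bar>"
  obtain C where C: "\<And>y. (1 + \<bar>y\<bar>) ^ (k + 2) * norm (\<phi> y) \<le> C" using \<phi> unfolding rapid_def by blast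
  have A: "A \<ge> 0" by (simp add: A_def)
  have main: "\<bar>real_of_int p\<bar> ^ k * norm (\<phi> (x + of_int p / real N)) \<le> (A ^ (k + 2) * C) * (1 / (1 + real_of_int p ^ 2))"
    if x: "\<bar>x\<bar> \<le> R" for p x
  proof -
    define y where "y = x + of_int p / real N"
    have "\<bar>real_of_int p\<bar> = \<bar>real N * y - real N * x\<bar>" using N by (simp add: y_def field_simps)
    also have "\<dots> \<le> real N * \<bar>y\<bar> + real N * \<bar>x\<bar>"
      using abs_triangle_ineq4[of "real N * y" "real N * x"] by (simp add: abs_mult)
    also have "\<dots> \<le> real N * \<bar>y\<bar> + real N * \<bar>R\<bar>" using x by (intro add_left_mono mult_left_mono) auto
    finally have "\<bar>real_of_int p\<bar> \<le> real N * \<bar>y\<bar> + real N * \<bar>R\<bar>" .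
    have "1 + \<bar>real_of_int p\<bar> \<le> A * (1 + \<bar>y\<bar>)"
    proof -
      have "A * (1 + \<bar>y\<bar>) = 1 + real N + real N * \<bar>R\<bar> + \<bar>y\<bar> + real N * \<bar>y\<bar> + (real N * \<bar>R\<bar>) * \<bar>y\<bar>"
        by (simp add: A_def algebra_simps)
      moreover have "(real N * \<bar>R\<bar>) * \<bar>y\<bar> \<ge> 0" by simp
      ultimately show ?thesis using \<open>\<bar>real_of_int p\<bar> \<le> real N * \<bar>y\<bar> + real N * \<bar>R\<bar>\<close> by linarith
    qed
    hence le: "(1 + \<bar>real_of_int p\<bar>) ^ (k + 2) \<le> (A * (1 + \<bar>y\<bar>)) ^ (k + 2)" by (intro power_mono) auto
    have "\<bar>real_of_int p\<bar> ^ k * (1 + real_of_int p ^ 2) \<le> (1 + \<bar>real_of_int p\<bar>) ^ k * (1 + \<bar>real_of_int p\<bar>) ^ 2"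
      by (intro mult_mono power_mono) (auto simp: power2_eq_square algebra_simps abs_mult_self_eq)
    also have "\<dots> \<le> (A * (1 + \<bar>y\<bar>)) ^ (k + 2)" using le by (simp only: power_add)
    finally have "\<bar>real_of_int p\<bar> ^ k * (1 + real_of_int p ^ 2) * norm (\<phi> y) \<le> (A * (1 + \<bar>y\<bar>)) ^ (k + 2) * norm (\<phi> y)"
      by (intro mult_right_mono) auto
    also have "\<dots> = A ^ (k + 2) * ((1 + \<bar>y\<bar>) ^ (k + 2) * norm (\<phi> y))" by (simp only: power_mult_distrib mult.assoc)
    also have "\<dots> \<le> A ^ (k + 2) * C" using A by (intro mult_left_mono C) auto
    finally have "\<bar>real_of_int p\<bar> ^ k * (1 + real_of_int p ^ 2) * norm (\<phi> y) \<le> A ^ (k + 2) * C" .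
    moreover have "1 + real_of_int p ^ 2 > 0" by (simp add: add_pos_nonneg)
    ultimately show ?thesis unfolding y_def[symmetric] by (simp add: field_simps)
  qed
  show ?thesis
    by (rule exI[of _ "\<lambda>p. (A ^ (k + 2) * C) * (1 / (1 + real_of_int p ^ 2))"])
       (use main summable_on_cmult_right[OF summable_inverse_square_int] in auto)
qed

lemma zc_rapid_bound:
  assumes \<phi>: "\<And>l. rapid (\<lambda>x. f x l)" and N: "N > 0"
  shows "\<exists>M. M summable_on UNIV \<and> (\<forall>p x. \<bar>x\<bar> \<le> R \<longrightarrow> \<bar>real_of_int p\<bar> ^ k * norm (zc N f p x) \<le> M p)"
proof -
  obtain M where M: "\<And>l. M l summable_on UNIV"
    "\<And>l p x. \<bar>x\<bar> \<le> R \<Longrightarrow> \<bar>real_of_int p\<bar> ^ k * norm (f (x + of_int p / real N) l) \<le> M l p"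
    using rapid_periodization_bound[OF \<phi> N, of R k] by metis
  have "\<bar>real_of_int p\<bar> ^ k * norm (zc N f p x) \<le> (\<Sum>l\<in>{0..<int N}. M l p)" if "\<bar>x\<bar> \<le> R" for p x
  proof -
    have "norm (zc N f p x) \<le> (\<Sum>l\<in>{0..<int N}. norm (f (x + of_int p / real N) l))"
      unfolding zc_def by (rule sum_norm_le) (simp add: norm_mult norm_ee)
    hence "\<bar>real_of_int p\<bar> ^ k * norm (zc N f p x) \<le> (\<Sum>l\<in>{0..<int N}. \<bar>real_of_int p\<bar> ^ k * norm (f (x + of_int p / real N) l))"
      unfolding sum_distrib_left[symmetric] by (intro mult_left_mono) auto
    also have "\<dots> \<le> (\<Sum>l\<in>{0..<int N}. M l p)" by (intro sum_mono M that)
    finally show ?thesis .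
  qed
  moreover have "(\<lambda>p. \<Sum>l\<in>{0..<int N}. M l p) summable_on UNIV"
    by (rule finite_induct[of "{0..<int N}" "\<lambda>X. (\<lambda>p. \<Sum>l\<in>X. M l p) summable_on UNIV"])
       (simp_all add: summable_on_add M)
  ultimately show ?thesis by blast
qed

section \<open>The Zak transform onto smooth sections\<close>

lemma zc_has_vector_derivative:
  assumes "\<And>l x. ((\<lambda>x. f x l) has_vector_derivative f' x l) (at x)"
  shows "(zc N f p has_vector_derivative zc N f' p x) (at x)"
proof -
  have *: "((\<lambda>x. f (x + of_int p / of_nat N) l) has_vector_derivative f' (x + of_int p / of_nat N) l) (at x)" for l x
  proof -
    have "((\<lambda>x. x + of_int p / of_nat N) has_vector_derivative 1) (at x)" by (auto intro!: derivative_eq_intros)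
    from vector_diff_chain_at[OF this assms] show ?thesis by (simp add: o_def)
  qed
  have "((\<lambda>x. zc N f p x) has_vector_derivative zc N f' p x) (at x)"
    unfolding zc_def by (intro has_vector_derivative_sum has_vector_derivative_mult_left *)
  thus ?thesis .
qed

lemma continuous_on_zc_real:
  fixes f :: "real \<Rightarrow> int \<Rightarrow> complex"
  assumes "\<And>l. continuous_on UNIV (\<lambda>x. f x l)"
  shows "continuous_on A (zc N f p)"
proof -
  have "continuous_on A (\<lambda>x. zc N f p x)"
    unfolding zc_def
    by (intro continuous_on_sum continuous_on_mult continuous_on_const continuous_on_compose2[OF assms] continuous_intros) auto
  thus ?thesis by simp
qed

text \<open>A derivative in \<open>n\<close> falls on \<open>f\<close>, a derivative in
  \<open>m\<close> multiplies by 2 pi i p. The functions \<open>\<theta>\<close> form the jet of the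
  stripped transform; rapid decay majorises each of them for bounded \<open>n\<close>, and the
  prefactor is restored at the end.\<close>

lemma zak_smooth_section:
  assumes f: "f \<in> Schwartz_AN N" and N: "N > 0"
  shows "zak N f \<in> smooth_sections N"
proof -
  have "\<exists>D :: nat \<Rightarrow> real \<Rightarrow> complex. D 0 = (\<lambda>x. f x l) \<and>
     (\<forall>k x. (D k has_vector_derivative D (Suc k) x) (at x)) \<and> (\<forall>k. rapid (D k))" for l
    using f unfolding Schwartz_AN_def schwartz_iff by blast
  then obtain D where D: "\<And>l. D l 0 = (\<lambda>x. f x l)" "\<And>l k x. (D l k has_vector_derivative D l (Suc k) x) (at x)"
     "\<And>l k. rapid (D l k)" by metis
  let ?T = "\<lambda>j k p n m. zc N (\<lambda>x l. D l j x) p n * ((2 * of_real pi * \<i> * of_int p) ^ k * ee (of_int p * complex_of_real m))"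
  define \<theta> where "\<theta> j k n m = (\<Sum>\<^sub>\<infinity>p. ?T j k p n m)" for j k and n m :: real
  have bound: "\<exists>M. M summable_on UNIV \<and> (\<forall>p n m. \<bar>n\<bar> \<le> R \<longrightarrow>
     norm (?T j k p n m) \<le> M p)" for R j k
  proof -
    obtain M where M: "M summable_on UNIV" "\<And>p x. \<bar>x\<bar> \<le> R \<Longrightarrow> \<bar>real_of_int p\<bar> ^ k * norm (zc N (\<lambda>x l. D l j x) p x) \<le> M p"
      using zc_rapid_bound[of "\<lambda>x l. D l j x" N R k] D(3) N by auto
    have "norm (?T j k p n m) \<le> (2 * pi) ^ k * M p"
      if "\<bar>n\<bar> \<le> R" for p n m
    proof -
      have "norm (ee (of_int p * complex_of_real m)) = 1" by (rule norm_ee_Im0) simp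
      hence "norm (?T j k p n m) =
        (2 * pi) ^ k * (\<bar>real_of_int p\<bar> ^ k * norm (zc N (\<lambda>x l. D l j x) p n))"
        by (simp add: norm_mult norm_power power_mult_distrib)
      also have "\<dots> \<le> (2 * pi) ^ k * M p" by (intro mult_left_mono M that) auto
      finally show ?thesis .
    qed
    thus ?thesis using summable_on_cmult_right[OF M(1), of "(2 * pi) ^ k"] by blast
  qed
  have czc: "continuous_on A (zc N (\<lambda>x l. D l j x) p)" for A j p
    by (rule continuous_on_zc_real) (use D(2) in \<open>auto intro!: continuous_at_imp_continuous_on has_vector_derivative_continuous\<close>)
  have cont: "continuous_on UNIV (\<lambda>(n, m). \<theta> j k n m)" for j k
  proof (rule continuous_on_exhaust[of "\<lambda>z. \<bar>fst z\<bar>"])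
    fix R :: real
    obtain M where M: "M summable_on UNIV" "\<And>p n m. \<bar>n\<bar> \<le> R \<Longrightarrow>
       norm (?T j k p n m) \<le> M p"
      using bound[of R j k] by blast
    show "continuous_on (UNIV \<inter> {x. \<bar>fst x\<bar> < R}) (\<lambda>(n, m). \<theta> j k n m)"
      unfolding \<theta>_def case_prod_unfold
      by (rule continuous_on_infsum[OF _ _ M(1)])
         (auto intro!: M(2) continuous_intros continuous_on_compose2[OF czc])
  qed (auto intro!: continuous_intros)
  have dn: "((\<lambda>x. \<theta> j k x m) has_vector_derivative \<theta> (Suc j) k n m) (at n)" for j k n m
    unfolding \<theta>_def
  proof (rule has_vector_derivative_infsum)
    fix R
    obtain M where M: "M summable_on UNIV" "\<And>p n m. \<bar>n\<bar> \<le> R \<Longrightarrow>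
       norm (?T j k p n m) \<le> M p"
      using bound[of R j k] by blast
    obtain M' where M': "M' summable_on UNIV" "\<And>p n m. \<bar>n\<bar> \<le> R \<Longrightarrow>
       norm (?T (Suc j) k p n m) \<le> M' p"
      using bound[of R "Suc j" k] by blast
    \<comment> \<open>Majorants of norms are nonnegative, so the sum of two dominates both the term
      and its derivative.\<close>
    have le: "norm u \<le> M p + M' p" "norm v \<le> M p + M' p" if "norm u \<le> M p" "norm v \<le> M' p" for u v :: complex and p
      using that norm_ge_zero[of u] norm_ge_zero[of v] by linarith+
    show "\<exists>M. M summable_on UNIV \<and> (\<forall>p x. \<bar>x\<bar> \<le> R \<longrightarrow>
       norm (?T j k p x m) \<le> M p \<and>
       norm (?T (Suc j) k p x m) \<le> M p)"
      by (rule exI[of _ "\<lambda>p. M p + M' p"]) (use le[OF M(2) M'(2)] summable_on_add[OF M(1) M'(1)] in blast)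
  qed (intro has_vector_derivative_mult_left zc_has_vector_derivative D continuous_intros czc)+
  have dm: "((\<lambda>y. \<theta> j k n y) has_vector_derivative \<theta> j (Suc k) n m) (at m)" for j k n m
    unfolding \<theta>_def
  proof (rule has_vector_derivative_infsum)
    fix p and m :: real
    show "((\<lambda>m. ?T j k p n m) has_vector_derivative
       ?T j (Suc k) p n m) (at m)"
      unfolding power_Suc2 mult.assoc[of "_ ^ k"]
      by (intro has_vector_derivative_mult_right ee_has_vector_derivative)
  next
    fix R
    obtain M where M: "M summable_on UNIV" "\<And>p m.
       norm (?T j k p n m) \<le> M p"
      using bound[of "\<bar>n\<bar>" j k] by blast
    obtain M' where M': "M' summable_on UNIV" "\<And>p m.
       norm (?T j (Suc k) p n m) \<le> M' p"
      using bound[of "\<bar>n\<bar>" j "Suc k"] by blast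
    have le: "norm u \<le> M p + M' p" "norm v \<le> M p + M' p" if "norm u \<le> M p" "norm v \<le> M' p" for u v :: complex and p
      using that norm_ge_zero[of u] norm_ge_zero[of v] by linarith+
    show "\<exists>M. M summable_on UNIV \<and> (\<forall>p x. \<bar>x\<bar> \<le> R \<longrightarrow>
       norm (?T j k p n x) \<le> M p \<and>
       norm (?T j (Suc k) p n x) \<le> M p)"
      by (rule exI[of _ "\<lambda>p. M p + M' p"]) (use le[OF M(2) M'(2)] summable_on_add[OF M(1) M'(1)] in blast)
  qed (intro continuous_intros)+
  have "smooth_plane (\<theta> 0 0)"
    unfolding smooth_plane_def using cont dn dm by blast
  from smooth_plane_exp_mult[OF this, of "of_real (1 / sqrt (real N))" "of_real pi * \<i> * of_nat N"]
  have "smooth_plane (zak N f)"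
    unfolding zak_eq[abs_def] \<theta>_def by (simp add: ee_def D(1) mult_ac)
  thus ?thesis
    using zak_quasi_periodic[OF N] by (auto simp: smooth_sections_def)
qed

section \<open>Fourier coefficients of sections and surjectivity of the transform\<close>

text \<open>Removes the quadratic prefactor and the scaling by 1 / sqrt N. The point
  \<open>z\<close> is separate from \<open>T\<close> so that \<open>T\<close> can be the slice of a
  continued section at a complex point.\<close>

definition section_coeff :: "nat \<Rightarrow> (real \<Rightarrow> complex) \<Rightarrow> int \<Rightarrow> complex \<Rightarrow> complex" where
  "section_coeff N T p z = of_real (sqrt (real N)) *
     integral {0..1} (\<lambda>m. ee (- (of_nat N * of_real m * z / 2)) * T m * ee (- (of_int p * of_real m)))"

lemma section_coeff_zak:
  assumes f: "f \<in> Schwartz_AN N" and N: "N > 0"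
  shows "section_coeff N (zak N f n) p (of_real n) = zc N f p n"
proof -
  obtain M where M: "M summable_on UNIV" "\<And>p x. \<bar>x\<bar> \<le> \<bar>n\<bar> \<Longrightarrow> \<bar>real_of_int p\<bar> ^ 0 * norm (zc N f p x) \<le> M p"
    using zc_rapid_bound[of f N "\<bar>n\<bar>" 0] f N by (auto simp: Schwartz_AN_def schwartz_rapid)
  have le: "norm (zc N f p n) \<le> M p" for p
    using M(2)[of n p] by simp
  have "ee (- (of_nat N * of_real m * of_real n / 2)) * zak N f n m * ee (- (of_int p * of_real m)) =
     of_real (1 / sqrt (real N)) * ((\<Sum>\<^sub>\<infinity>p. zc N f p n * ee (of_int p * of_real m)) * ee (- of_int p * of_real m))" for m
    unfolding zak_eq by (simp add: ee_minus field_simps)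
  hence "integral {0..1} (\<lambda>m. ee (- (of_nat N * of_real m * of_real n / 2)) * zak N f n m * ee (- (of_int p * of_real m))) =
     of_real (1 / sqrt (real N)) * zc N f p n"
    using fourier_coeff_series[OF le M(1), of p] by simp
  thus ?thesis using N by (simp add: section_coeff_def)
qed

lemma periodic_AN_AN: "f \<in> Schwartz_AN N \<Longrightarrow> f x (l + int N) = f x l"
  by (simp add: Schwartz_AN_def periodic_AN_def)

lemma Schwartz_AN_eqI:
  assumes "N > 0" "\<And>x l. f x (l + int N) = f x l" "\<And>x l. g x (l + int N) = g x l"
    and "\<And>p x. zc N f p x = zc N g p x"
  shows "f x l = g x l"
proof -
  have "zc N f = zc N g" using assms(4) by blast
  thus ?thesis using zinv_zc[of N f x l] zinv_zc[of N g x l] assms by simp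
qed

text \<open>Integration by parts over a period, with cancelling boundary terms, trades an
  m-derivative for a factor 2 pi i q. Compactness of \<open>{a..b} \<times> {0..1}\<close> bounds
  the coefficients uniformly in \<open>q\<close>.\<close>

lemma smooth_section_coeff_rapid:
  fixes D :: "nat \<Rightarrow> nat \<Rightarrow> real \<Rightarrow> real \<Rightarrow> complex"
  assumes cont: "\<And>j k. continuous_on UNIV (\<lambda>(n, m). D j k n m)"
    and dm: "\<And>j k n m. ((\<lambda>y. D j k n y) has_vector_derivative D j (Suc k) n m) (at m)"
    and per: "\<And>j k n m. D j k n (m + 1) = D j k n m"
  defines "c \<equiv> (\<lambda>j k q x. integral {0..1} (\<lambda>m. D j k x m * ee (- of_int q * of_real m)))"
  shows "c j (Suc k) q x = (2 * of_real pi * \<i> * of_int q) * c j k q x"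
    and "\<exists>M. \<forall>q. \<forall>x\<in>{a..b}. norm (c j k q x) \<le> M"
proof -
  have cD: "continuous_on A (D j k x)" for A j k x
    using continuous_on_compose2[OF cont[of j k], of A "\<lambda>y. (x, y)"] by (simp add: continuous_on_Pair)
  have "((\<lambda>m. D j k x m * ((2 * of_real pi * \<i> * (- of_int q)) * ee (- of_int q * of_real m)) + D j (Suc k) x m * ee (- of_int q * of_real m))
     has_integral (D j k x 1 * ee (- of_int q * of_real 1) - D j k x 0 * ee (- of_int q * of_real 0))) {0..1}"
    by (intro fundamental_theorem_of_calculus has_vector_derivative_mult has_vector_derivative_at_within[OF dm] ee_has_vector_derivative) auto
  moreover have "D j k x 1 * ee (- of_int q * of_real 1) - D j k x 0 * ee (- of_int q * of_real 0) = 0"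
    using per[of j k x 0] ee_of_int[of "- q"] by simp
  ultimately have "((\<lambda>m. (2 * of_real pi * \<i> * (- of_int q)) * (D j k x m * ee (- of_int q * of_real m)) + D j (Suc k) x m * ee (- of_int q * of_real m))
     has_integral 0) {0..1}" by (simp add: mult_ac)
  hence "0 = integral {0..1} (\<lambda>m. (2 * of_real pi * \<i> * (- of_int q)) * (D j k x m * ee (- of_int q * of_real m)) + D j (Suc k) x m * ee (- of_int q * of_real m))"
    by (simp only: integral_unique)
  also have "\<dots> = (2 * of_real pi * \<i> * (- of_int q)) * c j k q x + c j (Suc k) q x"
    unfolding c_def
    by (subst integral_add) (auto intro!: integrable_continuous_real continuous_intros cD simp only: integral_mult_right)
  finally show "c j (Suc k) q x = (2 * of_real pi * \<i> * of_int q) * c j k q x" by simp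
  have "compact ((\<lambda>(n, m). D j k n m) ` ({a..b} \<times> {0..1}))"
    by (intro compact_continuous_image continuous_on_subset[OF cont] compact_Times) auto
  then obtain M where "\<forall>x\<in>{a..b}. \<forall>m\<in>{0..1}. norm (D j k x m) \<le> M"
    by (auto dest!: compact_imp_bounded simp: bounded_iff)
  hence M: "\<And>x m. x \<in> {a..b} \<Longrightarrow> m \<in> {0..1} \<Longrightarrow> norm (D j k x m) \<le> M" by blast
  have "norm (c j k q x) \<le> M" if x: "x \<in> {a..b}" for q x
  proof -
    have "norm (c j k q x) \<le> integral {0..1} (\<lambda>m::real. M)"
      unfolding c_def
      by (rule integral_norm_bound_integral)
         (auto intro!: integrable_continuous_real continuous_intros cD M[OF x] simp: norm_mult norm_ee)
    thus ?thesis by simp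
  qed
  thus "\<exists>M. \<forall>q. \<forall>x\<in>{a..b}. norm (c j k q x) \<le> M" by blast
qed

lemma smooth_sections_quasi_periodic:
  assumes "t \<in> smooth_sections N"
  shows "t (n + 1) m = ee (- (of_nat N * of_real m / 2)) * t n m"
    "t n (m + 1) = ee (of_nat N * of_real n / 2) * t n m"
proof -
  have e: "exp (complex_of_real pi * \<i> * of_nat N * z) = ee (of_nat N * z / 2)"
     "exp (- (complex_of_real pi * \<i> * of_nat N * z)) = ee (- (of_nat N * z / 2))" for z
    by (simp_all add: ee_def mult_ac)
  show "t (n + 1) m = ee (- (of_nat N * of_real m / 2)) * t n m"
    "t n (m + 1) = ee (of_nat N * of_real n / 2) * t n m"
    using assms unfolding smooth_sections_def e by blast+
qed

text \<open>Periodicity in \<open>m\<close> passes to all derivatives by uniqueness of derivatives.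
  The law in \<open>n\<close> has a factor depending on \<open>m\<close>, so it is kept for the pure
  n-derivatives, from which the coefficients are formed.\<close>

lemma smooth_section_jet:
  assumes t: "t \<in> smooth_sections N"
  obtains D :: "nat \<Rightarrow> nat \<Rightarrow> real \<Rightarrow> real \<Rightarrow> complex" where
    "D 0 0 = (\<lambda>n m. ee (- (of_nat N * of_real m * of_real n / 2)) * t n m)"
    "\<And>j k. continuous_on UNIV (\<lambda>(n, m). D j k n m)"
    "\<And>j k n m. ((\<lambda>x. D j k x m) has_vector_derivative D (Suc j) k n m) (at n)"
    "\<And>j k n m. ((\<lambda>y. D j k n y) has_vector_derivative D j (Suc k) n m) (at m)"
    "\<And>j k n m. D j k n (m + 1) = D j k n m"
    "\<And>j n m. D j 0 (n + 1) m = ee (- (of_nat N * of_real m)) * D j 0 n m"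
proof -
  note q = smooth_sections_quasi_periodic[OF t]
  have sp: "smooth_plane t" using t by (simp add: smooth_sections_def)
  have "smooth_plane (\<lambda>n m. ee (- (of_nat N * of_real m * of_real n / 2)) * t n m)"
    using smooth_plane_exp_mult[OF sp, of 1 "- (of_real pi * \<i> * of_nat N)"] by (simp add: ee_def mult_ac)
  then obtain D where D: "D 0 0 = (\<lambda>n m. ee (- (of_nat N * of_real m * of_real n / 2)) * t n m)"
    "\<And>j k. continuous_on UNIV (\<lambda>(n, m). D j k n m)"
    "\<And>j k n m. ((\<lambda>x. D j k x m) has_vector_derivative D (Suc j) k n m) (at n)"
    "\<And>j k n m. ((\<lambda>y. D j k n y) has_vector_derivative D j (Suc k) n m) (at m)"
    unfolding smooth_plane_def by blast
  have shift: "((\<lambda>x. f (x + 1)) has_vector_derivative f' (x + 1)) (at x)"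
    if "\<And>x. (f has_vector_derivative f' x) (at x)" for f f' :: "real \<Rightarrow> complex" and x
  proof -
    have "((\<lambda>x. x + 1) has_vector_derivative 1) (at x)" for x :: real by (auto intro!: derivative_eq_intros)
    from vector_diff_chain_at[OF this that] show ?thesis by (simp add: o_def)
  qed
  have per0: "D j 0 n (m + 1) = D j 0 n m" for j n m
  proof (induction j arbitrary: n m)
    case 0
    have "ee (- (of_nat N * of_real (m + 1) * of_real n / 2)) * ee (of_nat N * of_real n / 2) = ee (- (of_nat N * of_real m * of_real n / 2))"
      unfolding ee_add[symmetric] by (rule arg_cong[where f = ee]) (simp add: field_simps)
    thus ?case unfolding D(1) q(2) by (metis mult.assoc)
  next
    case (Suc j)
    show ?case
      using vector_derivative_unique_at[OF D(3)[of j 0 "m + 1" n]] D(3)[of j 0 m n] by (simp add: Suc.IH)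
  qed
  have per: "D j k n (m + 1) = D j k n m" for j k n m
  proof (induction k arbitrary: m)
    case 0
    show ?case by (rule per0)
  next
    case (Suc k)
    show ?case
      using vector_derivative_unique_at[OF shift[OF D(4)]] D(4)[of j k n m] by (simp add: Suc.IH)
  qed
  have per': "D j 0 (n + 1) m = ee (- (of_nat N * of_real m)) * D j 0 n m" for j n m
  proof (induction j arbitrary: n)
    case 0
    have "ee (- (of_nat N * of_real m * of_real (n + 1) / 2)) * ee (- (of_nat N * of_real m / 2)) =
       ee (- (of_nat N * of_real m)) * ee (- (of_nat N * of_real m * of_real n / 2))"
      unfolding ee_add[symmetric] by (rule arg_cong[where f = ee]) (simp add: field_simps)
    thus ?case unfolding D(1) q(1) by (metis mult.assoc)
  next
    case (Suc j)
    have "((\<lambda>x. D j 0 (x + 1) m) has_vector_derivative D (Suc j) 0 (n + 1) m) (at n)"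
      by (rule shift[OF D(3)])
    moreover have "((\<lambda>x. D j 0 (x + 1) m) has_vector_derivative ee (- (of_nat N * of_real m)) * D (Suc j) 0 n m) (at n)"
      unfolding Suc.IH by (intro has_vector_derivative_mult_right D)
    ultimately show ?case by (rule vector_derivative_unique_at)
  qed
  show ?thesis by (rule that[OF D per per'])
qed

text \<open>Quasi-periodicity in \<open>n\<close> exchanges position for frequency:
  \<open>c j 0 q (x + r) = c j 0 (q + N r) x\<close>. Decay in \<open>q\<close>, uniform on a
  period, therefore becomes rapid decay of the coefficient functions along the line, and
  \<open>zinv\<close> assembles them to \<open>g\<close>.\<close>

lemma zak_surj:
  assumes t: "t \<in> smooth_sections N" and N: "N > 0"
  obtains g where "g \<in> Schwartz_AN N" "t = zak N g"
proof -
  obtain D where D: "D 0 0 = (\<lambda>n m. ee (- (of_nat N * of_real m * of_real n / 2)) * t n m)"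
    "\<And>j k. continuous_on UNIV (\<lambda>(n, m). D j k n m)"
    "\<And>j k n m. ((\<lambda>x. D j k x m) has_vector_derivative D (Suc j) k n m) (at n)"
    "\<And>j k n m. ((\<lambda>y. D j k n y) has_vector_derivative D j (Suc k) n m) (at m)"
    "\<And>j k n m. D j k n (m + 1) = D j k n m"
    "\<And>j n m. D j 0 (n + 1) m = ee (- (of_nat N * of_real m)) * D j 0 n m"
    using smooth_section_jet[OF t] by blast
  define c where "c = (\<lambda>j k q x. integral {0..1} (\<lambda>m. D j k x m * ee (- of_int q * of_real m)))"
  have c_props: "c j (Suc k) q x = (2 * of_real pi * \<i> * of_int q) * c j k q x"
    "\<exists>M. \<forall>q. \<forall>x\<in>{a..b}. norm (c j k q x) \<le> M" for j k q x a b
    unfolding c_def using smooth_section_coeff_rapid[where D = D, OF D(2,4,5)] by blast+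
  have ck: "c j k q x = (2 * of_real pi * \<i> * of_int q) ^ k * c j 0 q x" for j k q x
  proof (induction k)
    case (Suc k)
    show ?case unfolding c_props(1) power_Suc Suc.IH by (simp only: mult.assoc)
  qed simp
  have cper: "c j 0 q (x + 1) = c j 0 (q + int N) x" for j q x
  proof -
    have "D j 0 (x + 1) m * ee (- of_int q * of_real m) = D j 0 x m * ee (- of_int (q + int N) * of_real m)" for m
    proof -
      have "ee (- (of_nat N * of_real m)) * ee (- of_int q * of_real m) = ee (- of_int (q + int N) * of_real m)"
        unfolding ee_add[symmetric] by (rule arg_cong[where f = ee]) (simp add: algebra_simps)
      thus ?thesis unfolding D(6) by (metis mult.assoc mult.commute)
    qed
    thus ?thesis by (simp only: c_def)
  qed
  have cperk: "c j 0 q (x + of_int r) = c j 0 (q + int N * r) x" for j q x r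
  proof (induction r arbitrary: q rule: int_induct[where k = 0])
    case (step1 i)
    thus ?case using cper[of j q "x + of_int i"] by (simp add: algebra_simps)
  next
    case (step2 i)
    thus ?case using cper[of j "q - int N" "x + of_int (i - 1)"] by (simp add: algebra_simps)
  qed simp
  have decay: "\<exists>C. \<forall>q. \<forall>x\<in>{a..b}. (1 + \<bar>real_of_int q\<bar>) ^ k * norm (c j 0 q x) \<le> C" for j k a b
  proof -
    obtain A where A: "\<And>q x. x \<in> {a..b} \<Longrightarrow> norm (c j 0 q x) \<le> A" using c_props(2)[of a b j 0] by blast
    obtain B where B: "\<And>q x. x \<in> {a..b} \<Longrightarrow> norm (c j k q x) \<le> B" using c_props(2)[of a b j k] by blast
    have "(1 + \<bar>real_of_int q\<bar>) ^ k * norm (c j 0 q x) \<le> 2 ^ k * (A + B)" if x: "x \<in> {a..b}" for q x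
    proof -
      have "\<bar>real_of_int q\<bar> ^ k * norm (c j 0 q x) \<le> (2 * pi * \<bar>real_of_int q\<bar>) ^ k * norm (c j 0 q x)"
      proof (intro mult_right_mono power_mono)
        show "\<bar>real_of_int q\<bar> \<le> 2 * pi * \<bar>real_of_int q\<bar>"
          using mult_right_mono[of 1 "2 * pi" "\<bar>real_of_int q\<bar>"] pi_gt3 by simp
      qed auto
      also have "\<dots> = norm (c j k q x)" by (simp add: ck[of j k] norm_mult norm_power)
      also have "\<dots> \<le> B" by (rule B[OF x])
      finally have 1: "\<bar>real_of_int q\<bar> ^ k * norm (c j 0 q x) \<le> B" .
      have "(1 + \<bar>real_of_int q\<bar>) ^ k * norm (c j 0 q x) \<le> 2 ^ k * (1 + \<bar>real_of_int q\<bar> ^ k) * norm (c j 0 q x)"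
        by (intro mult_right_mono one_plus_power_le) auto
      also have "\<dots> = 2 ^ k * (norm (c j 0 q x) + \<bar>real_of_int q\<bar> ^ k * norm (c j 0 q x))" by (simp add: algebra_simps)
      also have "\<dots> \<le> 2 ^ k * (A + B)" by (intro mult_left_mono add_mono 1 A[OF x]) auto
      finally show ?thesis .
    qed
    thus ?thesis by blast
  qed
  have rapid: "rapid (c j 0 p)" for j p
    unfolding rapid_def
  proof
    fix K
    obtain C where C: "\<And>q x. x \<in> {0..1} \<Longrightarrow> (1 + \<bar>real_of_int q\<bar>) ^ K * norm (c j 0 q x) \<le> C" using decay by metis
    have "(1 + \<bar>y\<bar>) ^ K * norm (c j 0 p y) \<le> (2 + \<bar>real_of_int p\<bar>) ^ K * C" for y
    proof -
      \<comment> \<open>The integer part of \<open>y\<close> is moved into the frequency; since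
        \<open>N \<ge> 1\<close>, |y| is bounded by 1 + |p| + |q|.\<close>
      define q where "q = p + int N * \<lfloor>y\<rfloor>"
      have eq: "c j 0 p y = c j 0 q (frac y)"
        using cperk[of j p "frac y" "\<lfloor>y\<rfloor>"] by (simp add: q_def frac_def)
      have "\<bar>y\<bar> \<le> 1 + \<bar>real_of_int \<lfloor>y\<rfloor>\<bar>" by linarith
      moreover have "\<bar>real_of_int \<lfloor>y\<rfloor>\<bar> \<le> \<bar>real_of_int (int N * \<lfloor>y\<rfloor>)\<bar>"
        using mult_right_mono[of 1 "real N" "\<bar>real_of_int \<lfloor>y\<rfloor>\<bar>"] N by (simp add: abs_mult)
      moreover have "\<bar>real_of_int (int N * \<lfloor>y\<rfloor>)\<bar> \<le> \<bar>real_of_int p\<bar> + \<bar>real_of_int q\<bar>"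
        unfolding q_def by simp
      ultimately have "1 + \<bar>y\<bar> \<le> 2 + \<bar>real_of_int p\<bar> + \<bar>real_of_int q\<bar>" by linarith
      also have "\<dots> \<le> (2 + \<bar>real_of_int p\<bar>) * (1 + \<bar>real_of_int q\<bar>)"
      proof -
        have "(2 + \<bar>real_of_int p\<bar>) * (1 + \<bar>real_of_int q\<bar>) = 2 + \<bar>real_of_int p\<bar> + 2 * \<bar>real_of_int q\<bar> + \<bar>real_of_int p\<bar> * \<bar>real_of_int q\<bar>"
          by (simp add: algebra_simps)
        moreover have "\<bar>real_of_int p\<bar> * \<bar>real_of_int q\<bar> \<ge> 0" by simp
        ultimately show ?thesis by linarith
      qed
      finally have "(1 + \<bar>y\<bar>) ^ K * norm (c j 0 p y) \<le> ((2 + \<bar>real_of_int p\<bar>) * (1 + \<bar>real_of_int q\<bar>)) ^ K * norm (c j 0 p y)"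
        by (intro mult_right_mono power_mono) auto
      also have "\<dots> = (2 + \<bar>real_of_int p\<bar>) ^ K * ((1 + \<bar>real_of_int q\<bar>) ^ K * norm (c j 0 q (frac y)))"
        by (simp only: eq power_mult_distrib mult.assoc)
      also have "\<dots> \<le> (2 + \<bar>real_of_int p\<bar>) ^ K * C"
        using frac_lt_1[of y] by (intro mult_left_mono C) (auto simp: less_imp_le)
      finally show ?thesis .
    qed
    thus "\<exists>C. \<forall>y. (1 + \<bar>y\<bar>) ^ K * norm (c j 0 p y) \<le> C" by blast
  qed
  have cD: "continuous_on A (D j k x)" for A j k x
    using continuous_on_compose2[OF D(2)[of j k], of A "\<lambda>y. (x, y)"] by (simp add: continuous_on_Pair)
  have deriv: "(c j 0 p has_vector_derivative c (Suc j) 0 p x) (at x)" for j p x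
  proof -
    have cont: "continuous_on (UNIV \<times> cbox 0 1) (\<lambda>(x, m). D (Suc j) 0 x m * ee (- of_int p * of_real m))"
      unfolding case_prod_unfold using continuous_on_subset[OF D(2)[of "Suc j" 0], of "UNIV \<times> cbox 0 1"]
      by (intro continuous_on_mult continuous_intros) (simp add: case_prod_unfold)
    have "((\<lambda>x. integral (cbox 0 1) (\<lambda>m. D j 0 x m * ee (- of_int p * of_real m))) has_vector_derivative
       integral (cbox 0 1) (\<lambda>m. D (Suc j) 0 x m * ee (- of_int p * of_real m))) (at x within UNIV)"
      by (rule leibniz_rule_vector_derivative[OF _ _ cont])
         (intro has_vector_derivative_mult_left D(3) integrable_continuous continuous_intros cD | simp)+
    thus ?thesis by (simp add: c_def)
  qed
  have schw: "schwartz (c 0 0 p)" for p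
    unfolding schwartz_iff by (rule exI[of _ "\<lambda>j. c j 0 p"]) (auto intro: deriv rapid)
  \<comment> \<open>The factor sqrt N compensates the scaling in \<open>zak\<close>.\<close>
  define g where "g x l = of_real (sqrt (real N)) * zinv N (c 0 0) x l" for x :: real and l
  have g: "g \<in> Schwartz_AN N"
  proof -
    have "schwartz (\<lambda>x. g x l)" for l
    proof -
      have eq: "(\<lambda>x. g x l) = (\<lambda>x. (of_real (sqrt (real N)) / of_nat N) * (\<Sum>p\<in>{0..<int N}. ee (- (of_int l * of_int p / of_nat N)) * c 0 0 p (x - of_int p / of_nat N)))"
        by (simp add: g_def zinv_def mult_ac)
      show ?thesis unfolding eq by (intro schwartz_cmult schwartz_sum schwartz_translate schw)
    qed
    thus ?thesis by (simp add: Schwartz_AN_def periodic_AN_def g_def zinv_periodic[OF N])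
  qed
  have "zak N g n m = t n m" for n m
  proof -
    have zc: "zc N g p n = of_real (sqrt (real N)) * c 0 0 p n" for p
    proof -
      have "zc N g p n = of_real (sqrt (real N)) * zc N (zinv N (c 0 0)) p n"
        by (simp add: zc_def g_def sum_distrib_left mult_ac)
      also have "zc N (zinv N (c 0 0)) p n = c 0 0 p n"
        by (rule zc_zinv[OF N]) (simp add: cper)
      finally show ?thesis .
    qed
    \<comment> \<open>The locally uniform decay is used at the single point \<open>n\<close>; the
      exponent 2 gives a summable majorant.\<close>
    obtain C where C: "\<And>q x. x \<in> {n..n} \<Longrightarrow> (1 + \<bar>real_of_int q\<bar>) ^ 2 * norm (c 0 0 q x) \<le> C" using decay by metis
    have bd: "norm (c 0 0 q n) \<le> C * (1 / (1 + real_of_int q ^ 2))" for q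
    proof -
      have "(1 + real_of_int q ^ 2) * norm (c 0 0 q n) \<le> (1 + \<bar>real_of_int q\<bar>) ^ 2 * norm (c 0 0 q n)"
        by (intro mult_right_mono) (auto simp: power2_eq_square algebra_simps abs_mult_self_eq)
      also have "\<dots> \<le> C" by (rule C) simp
      finally have "(1 + real_of_int q ^ 2) * norm (c 0 0 q n) \<le> C" .
      moreover have "1 + real_of_int q ^ 2 > 0" by (simp add: add_pos_nonneg)
      ultimately show ?thesis by (simp add: field_simps)
    qed
    have "D 0 0 n m = (\<Sum>\<^sub>\<infinity>p. c 0 0 p n * ee (of_int p * of_real m))"
      by (rule fourier_series[OF _ _ _ bd summable_on_cmult_right[OF summable_inverse_square_int]])
         (simp_all add: cD D(5) c_def)
    hence "zak N g n m = of_real (1 / sqrt (real N)) * ee (of_nat N * of_real m * of_real n / 2) * (of_real (sqrt (real N)) * D 0 0 n m)"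
      unfolding zak_eq zc by (simp only: mult.assoc infsum_cmult_right')
    thus ?thesis using N unfolding D(1) by (simp add: ee_minus)
  qed
  hence "t = zak N g" by (intro ext) simp
  with g show ?thesis by (rule that)
qed

section \<open>Continuation to strips\<close>

lemma strip_Im_0:
  assumes "Im a = 0"
  shows "strip a = {z. Im z = 0}" "interior (strip a) = {}"
proof -
  show s: "strip a = {z. Im z = 0}" using assms by (auto simp: strip_def)
  have "{z. Im z = 0} = {z. \<i> \<bullet> z = 0}" by (auto simp: inner_complex_def)
  also have "interior \<dots> = {}" by (rule interior_hyperplane) simp
  finally show "interior (strip a) = {}" by (simp add: s)
qed

lemma strip_Im_pos:
  assumes "Im a > 0"
  shows "strip a = {z. 0 \<le> Im z \<and> Im z \<le> Im a}" "interior (strip a) = {z. 0 < Im z \<and> Im z < Im a}"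
proof -
  show s: "strip a = {z. 0 \<le> Im z \<and> Im z \<le> Im a}"
    using assms by (auto simp: strip_def closed_segment_eq_real_ivl)
  have "{z. 0 \<le> Im z \<and> Im z \<le> Im a} = {z. \<i> \<bullet> z \<ge> 0} \<inter> {z. \<i> \<bullet> z \<le> Im a}" by (auto simp: inner_complex_def)
  also have "interior \<dots> = {z. \<i> \<bullet> z > 0} \<inter> {z. \<i> \<bullet> z < Im a}"
    by (simp only: interior_Int interior_halfspace_ge interior_halfspace_le complex_i_not_zero not_False_eq_True)
  also have "\<dots> = {z. 0 < Im z \<and> Im z < Im a}" by (auto simp: inner_complex_def)
  finally show "interior (strip a) = {z. 0 < Im z \<and> Im z < Im a}" by (simp add: s)
qed

lemma convex_strip: "convex (strip a)"
proof -
  have "strip a = Im -` closed_segment 0 (Im a)" by (auto simp: strip_def)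
  moreover have "linear Im" by (rule bounded_linear.linear[OF bounded_linear_Im])
  ultimately show ?thesis by (simp add: convex_linear_vimage)
qed

lemma strip_real_translate: "z + of_real r \<in> strip a \<longleftrightarrow> z \<in> strip a"
  by (simp add: strip_def)

lemma of_real_in_strip [simp]: "of_real x \<in> strip a"
  by (simp add: strip_def)

lemma holomorphic_on_infsum:
  fixes f :: "'i \<Rightarrow> complex \<Rightarrow> complex"
  assumes U: "open U" and f: "\<And>p. f p holomorphic_on U" "\<And>p z. z \<in> U \<Longrightarrow> norm (f p z) \<le> M p" "M summable_on UNIV"
  shows "(\<lambda>z. \<Sum>\<^sub>\<infinity>p. f p z) holomorphic_on U"
proof -
  have "(\<lambda>z. \<Sum>\<^sub>\<infinity>p. f p z) field_differentiable at z" if z: "z \<in> U" for z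
  proof -
    obtain r where r: "r > 0" "cball z r \<subseteq> U" using U z open_contains_cball by blast
    have ul: "uniform_limit (cball z r) (\<lambda>X z. \<Sum>p\<in>X. f p z) (\<lambda>z. \<Sum>\<^sub>\<infinity>p. f p z) (finite_subsets_at_top UNIV)"
      by (rule Weierstrass_m_test_general[OF _ f(3)]) (use r f(2) in blast)
    have "\<forall>X. continuous_on (cball z r) (\<lambda>z. \<Sum>p\<in>X. f p z) \<and> (\<lambda>z. \<Sum>p\<in>X. f p z) holomorphic_on ball z r"
    proof (intro allI conjI)
      fix X
      show "(\<lambda>z. \<Sum>p\<in>X. f p z) holomorphic_on ball z r"
        using r by (intro holomorphic_on_sum holomorphic_on_subset[OF f(1)]) (auto simp: subset_iff)
      show "continuous_on (cball z r) (\<lambda>z. \<Sum>p\<in>X. f p z)"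
        using r by (intro continuous_on_sum holomorphic_on_imp_continuous_on holomorphic_on_subset[OF f(1)])
    qed
    hence "\<forall>\<^sub>F X in finite_subsets_at_top UNIV. continuous_on (cball z r) (\<lambda>z. \<Sum>p\<in>X. f p z) \<and>
        (\<lambda>z. \<Sum>p\<in>X. f p z) holomorphic_on ball z r" by (rule always_eventually)
    from holomorphic_uniform_limit[OF this ul] have "(\<lambda>z. \<Sum>\<^sub>\<infinity>p. f p z) holomorphic_on ball z r"
      by simp
    thus ?thesis using r by (auto intro: holomorphic_on_imp_differentiable_at)
  qed
  thus ?thesis using U holomorphic_on_def field_differentiable_at_within by blast
qed

section \<open>The extended transform on a product of strips\<close>

text \<open>With y = Re z + p/N, the modulus of \<open>ee (p w)\<close> is exp (- 2 pi N (Im w) y)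
  times exp (2 pi N (Im w) (Re z)). The hypothesis on \<open>G\<close> absorbs the first factor, the
  bounds on Re z and Im w control the second, and 1 / (1 + y^2) is compared with 1 / (1 +
  p^2).\<close>

lemma zak_ext_term_bound:
  assumes N: "N > 0" and R: "\<bar>Re z\<bar> \<le> R" and B: "\<bar>Im w\<bar> \<le> B"
    and G: "\<And>l x. norm (G (z + of_real x) l) * exp (- 2 * pi * real N * Im w * Re (z + of_real x)) \<le> K / (1 + Re (z + of_real x) ^ 2)"
  shows "norm (zc N G p z * ee (of_int p * w)) \<le>
     (real N * K * (1 + 2 * real N ^ 2 + 2 * real N ^ 2 * R ^ 2) * exp (2 * pi * real N * (B * R))) * (1 / (1 + real_of_int p ^ 2))"
proof -
  define y where "y = Re z + of_int p / real N"
  \<comment> \<open>Gives 1 + p^2 \<le> A (1 + y^2), by (y - Re z)^2 \<le> 2 y^2 + 2 R^2.\<close>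
  define A where "A = 1 + 2 * real N ^ 2 + 2 * real N ^ 2 * R ^ 2"
  have K: "K \<ge> 0" using order_trans[OF _ G[of 0 0], of 0] add_pos_nonneg[of 1 "Re z ^ 2"]
    by (simp add: zero_le_divide_iff)
  have pos: "1 + y ^ 2 > 0" "1 + real_of_int p ^ 2 > 0" by (simp_all add: add_pos_nonneg)
  have A0: "A \<ge> 0" by (simp add: A_def)
  have p: "real_of_int p = real N * (y - Re z)" using N by (simp add: y_def)
  have "Re z ^ 2 \<le> R ^ 2" using R by (metis abs_ge_zero power2_abs power_mono)
  have "(y - Re z) ^ 2 \<le> 2 * y ^ 2 + 2 * Re z ^ 2"
    using zero_le_power2[of "y + Re z"] by (simp add: power2_eq_square algebra_simps)
  also have "\<dots> \<le> 2 * y ^ 2 + 2 * R ^ 2" using \<open>Re z ^ 2 \<le> R ^ 2\<close> by simp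
  finally have "real N ^ 2 * (y - Re z) ^ 2 \<le> real N ^ 2 * (2 * y ^ 2 + 2 * R ^ 2)" by (intro mult_left_mono) auto
  hence "1 + real_of_int p ^ 2 \<le> 1 + real N ^ 2 * (2 * y ^ 2 + 2 * R ^ 2)" by (simp add: p power_mult_distrib)
  also have "\<dots> \<le> A * (1 + y ^ 2)"
  proof -
    have "A * (1 + y ^ 2) = 1 + real N ^ 2 * (2 * y ^ 2 + 2 * R ^ 2) + (y ^ 2 + 2 * real N ^ 2 + 2 * real N ^ 2 * R ^ 2 * y ^ 2)"
      by (simp add: A_def algebra_simps)
    moreover have "y ^ 2 + 2 * real N ^ 2 + 2 * real N ^ 2 * R ^ 2 * y ^ 2 \<ge> 0" by simp
    ultimately show ?thesis by linarith
  qed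
  finally have pe: "1 / (1 + y ^ 2) \<le> A * (1 / (1 + real_of_int p ^ 2))"
    using pos by (simp add: field_simps)
  have "norm (G (z + of_int p / of_nat N) l * ee (of_int l * of_int p / of_nat N) * ee (of_int p * w))
     \<le> K * (A * (1 / (1 + real_of_int p ^ 2))) * exp (2 * pi * real N * (B * R))" for l
  proof -
    have e: "norm (ee (of_int l * of_int p / of_nat N)) = 1" by (rule norm_ee_Im0) simp
    have zz: "z + of_int p / of_nat N = z + of_real (of_int p / real N)" by simp
    have Rey: "Re (z + of_real (of_int p / real N)) = y" by (simp add: y_def)
    have "norm (ee (of_int p * w)) = exp (- 2 * pi * real N * Im w * y) * exp (2 * pi * real N * (Im w * Re z))"
      by (simp add: norm_ee p exp_add[symmetric]) (simp add: algebra_simps)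
    hence "norm (G (z + of_int p / of_nat N) l * ee (of_int l * of_int p / of_nat N) * ee (of_int p * w)) =
      (norm (G (z + of_real (of_int p / real N)) l) * exp (- 2 * pi * real N * Im w * y)) * exp (2 * pi * real N * (Im w * Re z))"
      by (simp only: norm_mult e zz mult_1_right mult.assoc)
    also have "\<dots> \<le> (K / (1 + y ^ 2)) * exp (2 * pi * real N * (B * R))"
    proof (intro mult_mono)
      show "norm (G (z + of_real (of_int p / real N)) l) * exp (- 2 * pi * real N * Im w * y) \<le> K / (1 + y ^ 2)"
        using G[of "of_int p / real N" l] unfolding Rey .
      have "Im w * Re z \<le> \<bar>Im w\<bar> * \<bar>Re z\<bar>" by (simp add: abs_mult[symmetric])
      also have "\<dots> \<le> B * R" using R B by (intro mult_mono) auto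
      finally show "exp (2 * pi * real N * (Im w * Re z)) \<le> exp (2 * pi * real N * (B * R))" using N by simp
      show "0 \<le> K / (1 + y ^ 2)" using K pos by simp
    qed auto
    also have "K / (1 + y ^ 2) \<le> K * (A * (1 / (1 + real_of_int p ^ 2)))"
      using mult_left_mono[OF pe K] by simp
    finally show ?thesis by simp
  qed
  hence "norm (zc N G p z * ee (of_int p * w)) \<le> (\<Sum>l\<in>{0..<int N}. K * (A * (1 / (1 + real_of_int p ^ 2))) * exp (2 * pi * real N * (B * R)))"
    unfolding zc_def sum_distrib_right by (intro sum_norm_le)
  also have "\<dots> = (real N * K * A * exp (2 * pi * real N * (B * R))) * (1 / (1 + real_of_int p ^ 2))"
    by simp
  finally show ?thesis unfolding A_def .
qed

text \<open>The decay condition couples \<open>G\<close> with the exponential due to Im w, so that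
  it covers both uses: a genuine strip in \<open>z\<close> and a genuine strip in \<open>w\<close>.
  The majorant depends on a bound for Re z, hence the exhaustion by |Re z| < R.\<close>

lemma zak_ext_regular:
  assumes N: "N > 0"
    and cont: "\<And>l. continuous_on (strip a) (\<lambda>z. G z l)" and holo: "\<And>l. (\<lambda>z. G z l) holomorphic_on interior (strip a)"
    and decay: "\<And>l z w. z \<in> strip a \<Longrightarrow> w \<in> strip c \<Longrightarrow>
       norm (G z l) * exp (- 2 * pi * real N * Im w * Re z) \<le> K / (1 + Re z ^ 2)"
  shows "continuous_on (strip a \<times> strip c) (\<lambda>(z, w). zak_ext N G z w)"
    and "\<And>w. w \<in> strip c \<Longrightarrow> (\<lambda>z. zak_ext N G z w) holomorphic_on interior (strip a)"
    and "\<And>z. z \<in> strip a \<Longrightarrow> (\<lambda>w. zak_ext N G z w) holomorphic_on interior (strip c)"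
proof -
  define M where "M R p = (real N * K * (1 + 2 * real N ^ 2 + 2 * real N ^ 2 * R ^ 2) * exp (2 * pi * real N * (\<bar>Im c\<bar> * R))) * (1 / (1 + real_of_int p ^ 2))" for R p
  have M: "M R summable_on UNIV" for R
    unfolding M_def by (rule summable_on_cmult_right[OF summable_inverse_square_int])
  have bound: "norm (zc N G p z * ee (of_int p * w)) \<le> M R p" if "z \<in> strip a" "w \<in> strip c" "\<bar>Re z\<bar> \<le> R" for z w R p
    unfolding M_def
  proof (rule zak_ext_term_bound[OF N])
    show "\<bar>Im w\<bar> \<le> \<bar>Im c\<bar>" using \<open>w \<in> strip c\<close> by (auto simp: strip_def closed_segment_eq_real_ivl split: if_splits)
    show "norm (G (z + of_real x) l) * exp (- 2 * pi * real N * Im w * Re (z + of_real x)) \<le> K / (1 + Re (z + of_real x) ^ 2)" for l x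
      by (rule decay) (use that in \<open>simp_all add: strip_real_translate\<close>)
  qed (use that in auto)
  have tr: "z + of_int p / of_nat N \<in> strip a \<longleftrightarrow> z \<in> strip a" for z p
    using strip_real_translate[of z "of_int p / real N" a] by simp
  have tri: "z + of_int p / of_nat N \<in> interior (strip a)" if "z \<in> interior (strip a)" for z p
  proof -
    have "(\<lambda>z. z + of_int p / of_nat N) ` interior (strip a) = interior ((\<lambda>z. z + of_int p / of_nat N) ` strip a)"
      using interior_translation[of "of_int p / of_nat N" "strip a"] by (simp add: add.commute)
    also have "\<dots> \<subseteq> interior (strip a)" by (intro interior_mono) (auto simp: tr)
    finally show ?thesis using that by blast
  qed
  have czc: "continuous_on (strip a) (zc N G p)" for p
  proof -
    have "continuous_on (strip a) (\<lambda>z. zc N G p z)"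
      unfolding zc_def
      by (intro continuous_on_sum continuous_on_mult continuous_on_const continuous_on_compose2[OF cont] continuous_intros)
         (auto simp: tr)
    thus ?thesis by simp
  qed
  have hzc: "zc N G p holomorphic_on interior (strip a)" for p
  proof -
    have "(\<lambda>z. zc N G p z) holomorphic_on interior (strip a)"
      unfolding zc_def
    proof (intro holomorphic_on_sum holomorphic_on_mult holomorphic_on_const)
      fix l
      have "((\<lambda>z. G z l) \<circ> (\<lambda>z. z + of_int p / of_nat N)) holomorphic_on interior (strip a)"
        by (rule holomorphic_on_compose_gen[OF _ holo]) (auto intro!: holomorphic_intros tri)
      thus "(\<lambda>z. G (z + of_int p / of_nat N) l) holomorphic_on interior (strip a)" by (simp add: o_def)
    qed
    thus ?thesis by simp
  qed
  show "continuous_on (strip a \<times> strip c) (\<lambda>(z, w). zak_ext N G z w)"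
    unfolding zak_ext_def case_prod_unfold
  proof (intro continuous_on_mult)
    show "continuous_on (strip a \<times> strip c) (\<lambda>x. \<Sum>\<^sub>\<infinity>p. zc N G p (fst x) * ee (of_int p * snd x))"
    proof (rule continuous_on_exhaust[of "\<lambda>x. \<bar>Re (fst x)\<bar>"])
      fix R
      show "continuous_on (strip a \<times> strip c \<inter> {x. \<bar>Re (fst x)\<bar> < R}) (\<lambda>x. \<Sum>\<^sub>\<infinity>p. zc N G p (fst x) * ee (of_int p * snd x))"
        by (rule continuous_on_infsum[OF _ _ M[of R]])
           (auto intro!: bound continuous_intros continuous_on_compose2[OF czc])
    qed (auto intro!: continuous_intros)
  qed (intro continuous_intros; simp)+
  show "(\<lambda>z. zak_ext N G z w) holomorphic_on interior (strip a)" if w: "w \<in> strip c" for w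
    unfolding zak_ext_def
  proof (intro holomorphic_on_mult)
    have "(\<lambda>z. \<Sum>\<^sub>\<infinity>p. zc N G p z * ee (of_int p * w)) holomorphic_on interior (strip a) \<inter> {z. \<bar>Re z\<bar> < R}" for R
    proof (rule holomorphic_on_infsum[OF _ _ _ M[of R]])
      show "open (interior (strip a) \<inter> {z. \<bar>Re z\<bar> < R})"
        by (intro open_Int open_interior open_Collect_less continuous_intros)
      show "norm (zc N G p z * ee (of_int p * w)) \<le> M R p" if "z \<in> interior (strip a) \<inter> {z. \<bar>Re z\<bar> < R}" for p z
        using that interior_subset[of "strip a"] by (intro bound w) auto
    qed (auto intro!: holomorphic_intros holomorphic_on_subset[OF hzc])
    hence "(\<lambda>z. \<Sum>\<^sub>\<infinity>p. zc N G p z * ee (of_int p * w)) holomorphic_on (\<Union>R. interior (strip a) \<inter> {z. \<bar>Re z\<bar> < R})"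
      by (intro holomorphic_on_UN_open open_Int open_interior open_Collect_less continuous_intros)
    moreover have "(\<Union>R. interior (strip a) \<inter> {z. \<bar>Re z\<bar> < R}) = interior (strip a)" by (auto intro: gt_ex)
    ultimately show "(\<lambda>z. \<Sum>\<^sub>\<infinity>p. zc N G p z * ee (of_int p * w)) holomorphic_on interior (strip a)"
      by simp
  qed (intro holomorphic_intros; simp)+
  show "(\<lambda>w. zak_ext N G z w) holomorphic_on interior (strip c)" if z: "z \<in> strip a" for z
    unfolding zak_ext_def
  proof (intro holomorphic_on_mult)
    show "(\<lambda>w. \<Sum>\<^sub>\<infinity>p. zc N G p z * ee (of_int p * w)) holomorphic_on interior (strip c)"
    proof (rule holomorphic_on_infsum[OF _ _ _ M[of "\<bar>Re z\<bar>"]])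
      show "norm (zc N G p z * ee (of_int p * w)) \<le> M \<bar>Re z\<bar> p" if "w \<in> interior (strip c)" for p w
        using that interior_subset[of "strip c"] by (intro bound z) auto
    qed (auto intro!: holomorphic_intros)
  qed (intro holomorphic_intros; simp)+
qed

section \<open>Uniqueness, contour shift, decay and parameter integrals on a strip\<close>

text \<open>Extended by 0 below the real axis, \<open>D\<close> is holomorphic across the axis by
  pasting along a line, so it vanishes throughout the half plane below height \<open>h\<close>.
  Continuity along vertical segments reaches the upper edge.\<close>

lemma strip_unique:
  assumes h: "h > 0" and cont: "continuous_on {z. 0 \<le> Im z \<and> Im z \<le> h} D"
    and holo: "D holomorphic_on {z. 0 < Im z \<and> Im z < h}" and zero: "\<And>x. D (of_real x) = 0"
    and z: "0 \<le> Im z" "Im z \<le> h"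
  shows "D z = 0"
proof -
  define S where "S = {z. Im z < h}"
  define E where "E z = (if Im z \<le> 0 then 0 else D z)" for z
  have S: "open S" "convex S" unfolding S_def by (auto simp: open_halfspace_Im_lt convex_halfspace_Im_lt)
  have "continuous_on S E"
    unfolding E_def
  proof (rule continuous_on_cases_le)
    show "continuous_on {t \<in> S. 0 \<le> Im t} D" by (rule continuous_on_subset[OF cont]) (auto simp: S_def)
    show "0 = D t" if "Im t = 0" for t
      using zero[of "Re t"] that by (metis complex_is_Real_iff of_real_Re)
  qed (auto intro!: continuous_intros)
  moreover have "E holomorphic_on S \<inter> {z. \<i> \<bullet> z < 0}"
    by (rule holomorphic_transform[OF holomorphic_on_const[of 0]]) (auto simp: E_def inner_complex_def)
  moreover have "E holomorphic_on S \<inter> {z. 0 < \<i> \<bullet> z}"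
    by (rule holomorphic_transform[OF holomorphic_on_subset[OF holo]]) (auto simp: E_def S_def inner_complex_def)
  ultimately have E: "E holomorphic_on S"
    by (intro holomorphic_on_paste_across_line[OF S(1), of \<i> _ 0]) auto
  have E0: "E z = 0" if "z \<in> S" for z
  proof (rule analytic_continuation_open[of "{z. Im z < 0}" S E "\<lambda>_. 0"])
    show "{z. Im z < 0} \<noteq> {}" by (auto intro: exI[of _ "- \<i>"])
  qed (use S E h that in \<open>auto simp: S_def E_def open_halfspace_Im_lt intro: convex_connected\<close>)
  define d where "d t = D (Complex (Re z) t)" for t
  have "d t = 0" if "t \<in> {0<..<h}" for t
    using E0[of "Complex (Re z) t"] that by (simp add: E_def S_def d_def)
  moreover have "continuous_on (closure {0<..<h}) d"
    unfolding d_def Complex_eq using h by (intro continuous_on_compose2[OF cont] continuous_intros) auto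
  ultimately have "d (Im z) = 0"
    by (intro continuous_constant_on_closure[of "{0<..<h}" d 0 "Im z"]) (use h z in auto)
  thus ?thesis by (simp add: d_def)
qed

text \<open>For a primitive \<open>P\<close> on the convex closed strip, periodicity of
  \<open>H\<close> makes P (w + 1) - P w constant, and this constant is the integral over any
  horizontal period. The argument includes the strip that degenerates to the real line.\<close>

lemma strip_integral_shift:
  assumes cont: "continuous_on (strip a) H"
    and holo: "H holomorphic_on interior (strip a)" and per: "\<And>w. w \<in> strip a \<Longrightarrow> H (w + 1) = H w"
    and c: "c \<in> strip a"
  shows "integral {0..1} (\<lambda>m. H (of_real m + c)) = integral {0..1} (\<lambda>m. H (of_real m))"
proof -
  obtain P where P: "\<And>w. w \<in> strip a \<Longrightarrow> (P has_field_derivative H w) (at w within strip a)"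
    using holomorphic_convex_primitive[OF convex_strip finite.emptyI cont] holo
    by (metis Diff_empty holomorphic_on_imp_differentiable_at open_interior)
  have shift: "w + 1 \<in> strip a \<longleftrightarrow> w \<in> strip a" for w by (simp add: strip_def)
  have "(+) 1 ` strip a = strip a"
  proof
    show "strip a \<subseteq> (+) 1 ` strip a"
    proof
      fix w assume "w \<in> strip a"
      thus "w \<in> (+) 1 ` strip a" using shift[of "w - 1"] by (intro image_eqI[of _ _ "w - 1"]) auto
    qed
  qed (auto simp: add.commute shift)
  hence P1: "((\<lambda>w. P (1 + w)) has_field_derivative H w) (at w within strip a)" if "w \<in> strip a" for w
    using DERIV_at_within_shift[of P "H w" 1 w "strip a"] P[of "1 + w"] per[OF that] shift[of w] that by (simp add: add.commute)
  have "\<exists>k. \<forall>w\<in>strip a. P (1 + w) - P w = k"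
  proof (rule has_field_derivative_zero_constant[OF convex_strip])
    show "((\<lambda>w. P (1 + w) - P w) has_field_derivative 0) (at w within strip a)" if "w \<in> strip a" for w
      using DERIV_diff[OF P1[OF that] P[OF that]] by simp
  qed
  then obtain k where k: "\<And>w. w \<in> strip a \<Longrightarrow> P (1 + w) - P w = k" by blast
  have "integral {0..1} (\<lambda>m. H (of_real m + c)) = k" if c: "c \<in> strip a" for c
  proof -
    have "((\<lambda>m. P (of_real m + c)) has_vector_derivative H (of_real m + c)) (at m within {0..1})" for m :: real
    proof -
      have "((\<lambda>m. complex_of_real m + c) has_vector_derivative 1) (at m within {0..1})"
        using has_vector_derivative_add[OF has_vector_derivative_of_real[OF DERIV_ident] has_vector_derivative_const[of c]]
        by (simp add: has_vector_derivative_at_within)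
      moreover have "(\<lambda>m. complex_of_real m + c) ` {0..1} \<subseteq> strip a"
        using strip_real_translate c by (auto simp: add.commute)
      hence "(P has_field_derivative H (of_real m + c)) (at (of_real m + c) within (\<lambda>m. complex_of_real m + c) ` {0..1})"
        using P[of "of_real m + c"] strip_real_translate[of c m a] c by (auto intro: DERIV_subset simp: add.commute)
      ultimately show ?thesis
        using field_vector_diff_chain_within[of "\<lambda>m. complex_of_real m + c" 1 m "{0..1}" P] by (simp add: o_def)
    qed
    hence "((\<lambda>m. H (of_real m + c)) has_integral (P (of_real 1 + c) - P (of_real 0 + c))) {0..1}"
      by (intro fundamental_theorem_of_calculus) auto
    thus ?thesis using k[OF c] by (simp add: integral_unique)
  qed
  from this[OF c] this[of 0] show ?thesis by (simp add: strip_def)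
qed

text \<open>A Phragmen--Lindelof argument, with the convergence factor \<open>(1 - \<i> \<epsilon> (z + \<i>)) ^ -3\<close>.\<close>

lemma strip_decay:
  assumes h: "h > 0" and cont: "continuous_on {z. 0 \<le> Im z \<and> Im z \<le> h} F"
    and holo: "F holomorphic_on {z. 0 < Im z \<and> Im z < h}"
    and bd: "\<And>z. 0 \<le> Im z \<Longrightarrow> Im z \<le> h \<Longrightarrow> norm (F z) \<le> M"
    and bdry: "\<And>z. Im z = 0 \<or> Im z = h \<Longrightarrow> norm (F z) * (1 + Re z ^ 2) \<le> C"
    and z: "0 \<le> Im z" "Im z \<le> h"
  shows "norm (F z) * (1 + Re z ^ 2) \<le> C * (1 + h) ^ 2 + 1"
proof -
  \<comment> \<open>On the horizontal edges |w + i|^2 \<le> (1 + h)^2 (1 + (Re w)^2) gives the first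
    term; the added 1 covers the vertical sides.\<close>
  define C1 where "C1 = C * (1 + h) ^ 2 + 1"
  have C: "C \<ge> 0" using order_trans[OF _ bdry[of 0], of 0] by simp
  have M: "M \<ge> 0" using order_trans[OF norm_ge_zero bd[of 0]] h by simp
  have C1: "C1 \<ge> 1" using C by (simp add: C1_def)
  have ns: "norm (w + \<i>) ^ 2 = Re w ^ 2 + (Im w + 1) ^ 2" for w
    by (simp add: cmod_power2)
  have main: "norm (F z * (z + \<i>) ^ 2) \<le> C1 * norm (1 - \<i> * of_real \<epsilon> * (z + \<i>)) ^ 3" if \<epsilon>: "\<epsilon> > 0" for \<epsilon>
  proof -
    define q where "q w = 1 - \<i> * complex_of_real \<epsilon> * (w + \<i>)" for w
    \<comment> \<open>The factor (w + i)^2 turns quadratic decay into boundedness; the third power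
      of \<open>q\<close> outgrows it by one order, since |q w| \<ge> \<epsilon> |w + i|.\<close>
    define f where "f w = F w * (w + \<i>) ^ 2 / q w ^ 3" for w
    have nq: "norm (q w) ^ 2 = (1 + \<epsilon> * (Im w + 1)) ^ 2 + (\<epsilon> * Re w) ^ 2" for w
      by (simp add: q_def cmod_power2 algebra_simps)
    have q1: "norm (q w) \<ge> 1" if "Im w \<ge> 0" for w
    proof (rule power2_le_imp_le)
      have "1 ^ 2 \<le> (1 + \<epsilon> * (Im w + 1)) ^ 2" using \<epsilon> that by (intro power_mono) auto
      thus "1\<^sup>2 \<le> (norm (q w))\<^sup>2" unfolding nq by (smt (verit) zero_le_power2)
    qed auto
    hence q0: "q w \<noteq> 0" if "Im w \<ge> 0" for w using that by fastforce
    have q2: "\<epsilon> * norm (w + \<i>) \<le> norm (q w)" if "Im w \<ge> 0" for w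
    proof (rule power2_le_imp_le)
      have "(\<epsilon> * (Im w + 1)) ^ 2 \<le> (1 + \<epsilon> * (Im w + 1)) ^ 2" using \<epsilon> that by (intro power_mono) auto
      thus "(\<epsilon> * norm (w + \<i>))\<^sup>2 \<le> (norm (q w))\<^sup>2" unfolding nq power_mult_distrib[of \<epsilon>] ns by (simp add: algebra_simps power_mult_distrib)
    qed auto
    \<comment> \<open>Large enough that \<open>z\<close> lies in the rectangle and that on the
      vertical sides the bound (M / \<epsilon>^3) / |w + i| is at most 1.\<close>
    define X where "X = \<bar>Re z\<bar> + 1 + M / \<epsilon> ^ 3"
    have X: "X \<ge> 1" "\<bar>Re z\<bar> \<le> X" "M / \<epsilon> ^ 3 \<le> X" using M \<epsilon> by (simp_all add: X_def)
    define Q where "Q = cbox (Complex (-X) 0) (Complex X h)"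
    have Q: "w \<in> Q \<longleftrightarrow> \<bar>Re w\<bar> \<le> X \<and> 0 \<le> Im w \<and> Im w \<le> h" for w
      by (auto simp: Q_def in_cbox_complex_iff)
    have iQ: "w \<in> interior Q \<longleftrightarrow> \<bar>Re w\<bar> < X \<and> 0 < Im w \<and> Im w < h" for w
      by (auto simp: Q_def in_box_complex_iff interior_cbox)
    have cQ: "closure Q = Q" by (simp add: Q_def)
    have "norm (f z) \<le> C1"
    proof (rule maximum_modulus_frontier[of f Q])
      show "f holomorphic_on interior Q"
        unfolding f_def q_def
        by (intro holomorphic_intros holomorphic_on_subset[OF holo]) (use q0 in \<open>auto simp: iQ q_def\<close>)
      show "continuous_on (closure Q) f"
        unfolding f_def q_def cQ
        by (intro continuous_intros continuous_on_subset[OF cont]) (use q0 in \<open>auto simp: Q q_def\<close>)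
      show "bounded Q" by (simp add: Q_def)
      show "z \<in> Q" using X z by (simp add: Q)
      fix w assume w: "w \<in> frontier Q"
      hence wQ: "w \<in> Q" and nw: "w \<notin> interior Q" by (simp_all add: frontier_def cQ)
      hence im: "0 \<le> Im w" "Im w \<le> h" by (simp_all add: Q)
      have nf: "norm (f w) = norm (F w) * norm (w + \<i>) ^ 2 / norm (q w) ^ 3"
        by (simp add: f_def norm_mult norm_divide norm_power)
      show "norm (f w) \<le> C1"
      proof (cases "Im w = 0 \<or> Im w = h")
        case True
        have "(Im w + 1) ^ 2 \<le> (1 + h) ^ 2" using im by (intro power_mono) auto
        moreover have "1 \<le> (1 + h) ^ 2" using h by simp
        hence "1 * Re w ^ 2 \<le> (1 + h) ^ 2 * Re w ^ 2" by (intro mult_right_mono) auto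
        ultimately have "norm (w + \<i>) ^ 2 \<le> (1 + h) ^ 2 * (1 + Re w ^ 2)"
          unfolding ns distrib_left by linarith
        hence "norm (F w) * norm (w + \<i>) ^ 2 \<le> norm (F w) * ((1 + h) ^ 2 * (1 + Re w ^ 2))" by (intro mult_left_mono) auto
        also have "\<dots> = (norm (F w) * (1 + Re w ^ 2)) * (1 + h) ^ 2" by simp
        also have "\<dots> \<le> C * (1 + h) ^ 2" by (intro mult_right_mono bdry True) auto
        also have "\<dots> \<le> C1" by (simp add: C1_def)
        finally have le: "norm (F w) * norm (w + \<i>) ^ 2 \<le> C1" .
        have "norm (f w) \<le> norm (F w) * norm (w + \<i>) ^ 2 / 1"
          unfolding nf using one_le_power[OF q1[OF im(1)], of 3] by (intro divide_left_mono) auto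
        with le show ?thesis by simp
      next
        case False
        with nw wQ im have Re: "\<bar>Re w\<bar> = X" by (auto simp: iQ Q)
        have wn: "norm (w + \<i>) \<ge> X" using abs_Re_le_cmod[of "w + \<i>"] Re by simp
        hence wp: "norm (w + \<i>) > 0" using X by linarith
        have "norm (F w) * norm (w + \<i>) ^ 2 / norm (q w) ^ 3 \<le> M * norm (w + \<i>) ^ 2 / (\<epsilon> * norm (w + \<i>)) ^ 3"
          using q2[OF im(1)] \<epsilon> wp bd[OF im] M by (intro frac_le mult_right_mono power_mono) auto
        also have "\<dots> = (M / \<epsilon> ^ 3) / norm (w + \<i>)"
          using wp \<epsilon> by (simp add: field_simps power2_eq_square power3_eq_cube)
        also have "\<dots> \<le> 1" using order_trans[OF X(3) wn] by (simp only: divide_le_eq_1_pos[OF wp])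
        finally show ?thesis using C1 nf by simp
      qed
    qed
    hence "norm (F z * (z + \<i>) ^ 2) / norm (q z) ^ 3 \<le> C1"
      by (simp add: f_def norm_mult norm_divide norm_power)
    moreover have "norm (q z) ^ 3 > 0" using q0[OF z(1)] by simp
    ultimately show ?thesis by (simp add: q_def field_simps)
  qed
  \<comment> \<open>\<open>C1\<close> does not depend on \<epsilon>, and the convergence factor
    tends to 1 as \<epsilon> tends to 0.\<close>
  have "((\<lambda>\<epsilon>. C1 * norm (1 - \<i> * of_real \<epsilon> * (z + \<i>)) ^ 3) \<longlongrightarrow> C1 * norm (1 - \<i> * of_real 0 * (z + \<i>)) ^ 3) (at_right 0)"
    by (intro tendsto_intros)
  hence "norm (F z * (z + \<i>) ^ 2) \<le> C1 * norm (1 - \<i> * of_real 0 * (z + \<i>)) ^ 3"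
    by (rule tendsto_lowerbound) (auto simp: eventually_at_right_less intro!: eventually_at_rightI[of 0 1] main)
  hence le: "norm (F z) * norm (z + \<i>) ^ 2 \<le> C1" by (simp add: norm_mult norm_power)
  have "1 ^ 2 \<le> (Im z + 1) ^ 2" using z by (intro power_mono) auto
  hence "norm (F z) * (1 + Re z ^ 2) \<le> norm (F z) * norm (z + \<i>) ^ 2"
    unfolding ns by (intro mult_left_mono) auto
  with le show ?thesis by (simp add: C1_def)
qed

text \<open>Morera's theorem: the integrals over a triangle and over the parameter commute. The
  parameter interval is treated as the complex segment from 0 to 1, hence \<open>g\<close>, so that
  the interchange of contour integrals applies.\<close>

lemma holomorphic_on_integral:
  fixes h :: "complex \<Rightarrow> real \<Rightarrow> complex"
  assumes U: "open U" and cont: "continuous_on (U \<times> {0..1}) (\<lambda>(z, m). h z m)"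
    and holo: "\<And>m. m \<in> {0..1} \<Longrightarrow> (\<lambda>z. h z m) holomorphic_on U"
  shows "(\<lambda>z. integral {0..1} (h z)) holomorphic_on U"
proof -
  define g where "g z m = h z (Re m)" for z m
  have seg: "closed_segment 0 1 = complex_of_real ` {0..1}"
    using closed_segment_of_real[of 0 1] by (simp add: closed_segment_eq_real_ivl)
  have "continuous_on (U \<times> closed_segment 0 1) (\<lambda>x. case (fst x, Re (snd x)) of (z, m) \<Rightarrow> h z m)"
    by (rule continuous_on_compose2[OF cont]) (auto simp: seg intro!: continuous_intros)
  hence cg: "continuous_on (U \<times> closed_segment 0 1) (\<lambda>(z, m). g z m)"
    by (simp add: g_def case_prod_unfold)
  have ci: "integral {0..1} (h z) = contour_integral (linepath 0 1) (g z)" for z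
    by (simp add: contour_integral_integral g_def linepath_def)
  have "(\<lambda>z. integral {0..1} (h z)) analytic_on U"
  proof (rule Morera_triangle[OF _ U])
    show "continuous_on U (\<lambda>z. integral {0..1} (h z))"
      using integral_continuous_on_param[of U 0 1 h] cont by simp
    fix a b c
    show "convex hull {a, b, c} \<subseteq> U \<longrightarrow> contour_integral (linepath a b) (\<lambda>z. integral {0..1} (h z)) +
      contour_integral (linepath b c) (\<lambda>z. integral {0..1} (h z)) +
      contour_integral (linepath c a) (\<lambda>z. integral {0..1} (h z)) = 0"
    proof
      assume sub: "convex hull {a, b, c} \<subseteq> U"
      have segs: "closed_segment a b \<subseteq> U" "closed_segment b c \<subseteq> U" "closed_segment c a \<subseteq> U"
        using subset_trans[OF segments_subset_convex_hull(1) sub] subset_trans[OF segments_subset_convex_hull(3) sub]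
          subset_trans[OF segments_subset_convex_hull(5) sub] by simp_all
      have swap: "contour_integral (linepath a b) (\<lambda>z. integral {0..1} (h z)) =
          contour_integral (linepath 0 1) (\<lambda>m. contour_integral (linepath a b) (\<lambda>z. g z m))"
        if "closed_segment a b \<subseteq> U" for a b
        unfolding ci
        by (rule contour_integral_swap) (use that in \<open>auto intro!: continuous_on_subset[OF cg]\<close>)
      have int: "(\<lambda>m. contour_integral (linepath a b) (\<lambda>z. g z m)) contour_integrable_on (linepath 0 1)"
        if "closed_segment a b \<subseteq> U" for a b
      proof (rule contour_integrable_continuous_linepath)
        have "continuous_on (closed_segment 0 1) (\<lambda>m. integral (cbox 0 1) (\<lambda>x. g (linepath a b x) m * (b - a)))"
        proof (rule integral_continuous_on_param)
          have "(linepath a b x) \<in> U" if "x \<in> {0..1}" for x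
            using \<open>closed_segment a b \<subseteq> U\<close> that linepath_in_path[of x a b] by auto
          hence "continuous_on (closed_segment 0 1 \<times> {0..1}) (\<lambda>x. case (linepath a b (snd x), fst x) of (z, m) \<Rightarrow> g z m)"
            by (intro continuous_on_compose2[OF cg]) (auto intro!: continuous_intros simp: linepath_def)
          thus "continuous_on (closed_segment 0 1 \<times> cbox 0 1) (\<lambda>(m, x). g (linepath a b x) m * (b - a))"
            by (auto intro!: continuous_intros simp: case_prod_unfold)
        qed
        thus "continuous_on (closed_segment 0 1) (\<lambda>m. contour_integral (linepath a b) (\<lambda>z. g z m))"
          by (simp add: contour_integral_integral)
      qed
      have "contour_integral (linepath a b) (\<lambda>z. integral {0..1} (h z)) +
        contour_integral (linepath b c) (\<lambda>z. integral {0..1} (h z)) +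
        contour_integral (linepath c a) (\<lambda>z. integral {0..1} (h z)) =
        contour_integral (linepath 0 1) (\<lambda>m. contour_integral (linepath a b) (\<lambda>z. g z m) +
           contour_integral (linepath b c) (\<lambda>z. g z m) + contour_integral (linepath c a) (\<lambda>z. g z m))"
        by (simp add: swap segs int contour_integral_add contour_integrable_add)
      also have "\<dots> = contour_integral (linepath 0 1) (\<lambda>m. 0)"
      proof (rule contour_integral_eq)
        fix m assume "m \<in> path_image (linepath 0 1 :: real \<Rightarrow> complex)"
        hence m: "Re m \<in> {0..1}" by (auto simp: seg)
        have hol: "(\<lambda>z. g z m) holomorphic_on convex hull {a, b, c}"
          unfolding g_def by (rule holomorphic_on_subset[OF holo[OF m] sub])
        show "contour_integral (linepath a b) (\<lambda>z. g z m) + contour_integral (linepath b c) (\<lambda>z. g z m) +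
           contour_integral (linepath c a) (\<lambda>z. g z m) = 0"
          using Cauchy_theorem_triangle[OF hol]
          by (metis (no_types, lifting) contour_integral_join contour_integral_unique has_chain_integral_chain_integral3)
      qed
      finally show "contour_integral (linepath a b) (\<lambda>z. integral {0..1} (h z)) +
        contour_integral (linepath b c) (\<lambda>z. integral {0..1} (h z)) +
        contour_integral (linepath c a) (\<lambda>z. integral {0..1} (h z)) = 0" by simp
    qed
  qed
  thus ?thesis by (rule analytic_imp_holomorphic)
qed

section \<open>Multiplication operators\<close>

lemma integral_affine:
  "integral {0..1} (\<lambda>t::real. A + of_real t * B) = A + B / (2::complex)"
proof -
  have "((\<lambda>t. of_real t * A + of_real (t\<^sup>2 / 2) * B) has_vector_derivative A + of_real t * B) (at t within {0..1})" for t :: real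
  proof -
    have "((\<lambda>t::real. t\<^sup>2 / 2) has_field_derivative t) (at t within {0..1})"
      by (auto intro!: derivative_eq_intros)
    from has_vector_derivative_of_real[OF this]
    have 2: "((\<lambda>t. complex_of_real (t\<^sup>2 / 2)) has_vector_derivative of_real t) (at t within {0..1})" .
    have 1: "((\<lambda>t. complex_of_real t) has_vector_derivative 1) (at t within {0..1})"
      using has_vector_derivative_of_real[OF DERIV_ident] by simp
    from has_vector_derivative_add[OF has_vector_derivative_mult_left[OF 1, of A] has_vector_derivative_mult_left[OF 2, of B]]
    show ?thesis by simp
  qed
  hence "((\<lambda>t. A + of_real t * B) has_integral (of_real 1 * A + of_real (1\<^sup>2 / 2) * B - (of_real 0 * A + of_real (0\<^sup>2 / 2) * B))) {0..1::real}"
    by (intro fundamental_theorem_of_calculus) auto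
  thus ?thesis by (simp add: integral_unique)
qed

text \<open>Along the shift an affine coefficient is affine in time, so its integral is the initial
  value plus half of the increment; the half increment is the commutator correction.\<close>

lemma fo_flow_affine:
  "fo_flow (FO a c (\<lambda>n m. q * n + r * m)) 1 S n m = exp (q * n + r * m + (q * a + r * c) / 2) * S (n + a) (m + c)"
proof -
  have "q * (n + of_real t * a) + r * (m + of_real t * c) = (q * n + r * m) + of_real t * (q * a + r * c)" for t
    by (simp add: algebra_simps)
  thus ?thesis by (simp only: fo_flow.simps integral_affine of_real_1 mult_1)
qed

text \<open>Common form of \<open>y_hat\<close> (\<open>\<beta> = b\<close>, \<open>e = 1\<close>)
  and \<open>y_tilde\<close> (\<open>\<beta> = 1/b\<close>, \<open>e = - 1\<close>). The connection
  term in the real direction cancels half of the multiplication term, which leaves pi i e m.\<close>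

definition y_type :: "nat \<Rightarrow> complex \<Rightarrow> int \<Rightarrow> first_order" where
  "y_type N \<beta> e = FO (of_int e / of_nat N) (\<i> * \<beta> / of_nat N) (\<lambda>n m. - (of_real pi * \<beta>) * n + of_int e * \<i> * of_real pi * m)"

text \<open>The counterpart for \<open>x_hat\<close> and \<open>x_tilde\<close>: the roles of the
  real and the complex shift are exchanged and the real shift is reversed.\<close>

definition x_type :: "nat \<Rightarrow> complex \<Rightarrow> int \<Rightarrow> first_order" where
  "x_type N \<beta> e = FO (\<i> * \<beta> / of_nat N) (- of_int e / of_nat N) (\<lambda>n m. of_int e * \<i> * of_real pi * n + of_real pi * \<beta> * m)"

text \<open>The constant term \<open>e \<i> \<beta> / N\<close> is the half increment from
  \<open>fo_flow_affine\<close>, rewritten as an argument of \<open>ee\<close>.\<close>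

abbreviation y_phase :: "nat \<Rightarrow> complex \<Rightarrow> int \<Rightarrow> complex \<Rightarrow> complex \<Rightarrow> complex" where
  "y_phase N \<beta> e n m \<equiv> ee ((of_int e * m + \<i> * \<beta> * n + of_int e * \<i> * \<beta> / of_nat N) / 2)"

abbreviation x_phase :: "nat \<Rightarrow> complex \<Rightarrow> int \<Rightarrow> complex \<Rightarrow> complex \<Rightarrow> complex" where
  "x_phase N \<beta> e n m \<equiv> ee ((of_int e * n - \<i> * \<beta> * m + of_int e * \<i> * \<beta> / of_nat N) / 2)"

abbreviation exp_weight :: "nat \<Rightarrow> complex \<Rightarrow> int \<Rightarrow> real \<Rightarrow> int \<Rightarrow> complex" where
  "exp_weight N \<beta> e z l \<equiv> exp (2 * complex_of_real pi * \<beta> * of_real z) * ee (of_int e * of_int l / of_nat N)"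

lemma y_type_flow:
  "fo_flow (y_type N \<beta> e) 1 S n m = y_phase N \<beta> e n m *
     S (n + of_int e / of_nat N) (m + \<i> * \<beta> / of_nat N)"
proof -
  have "- (of_real pi * \<beta>) * n + of_int e * \<i> * of_real pi * m + (- (of_real pi * \<beta>) * (of_int e / of_nat N) + of_int e * \<i> * of_real pi * (\<i> * \<beta> / of_nat N)) / 2
    = 2 * of_real pi * \<i> * ((of_int e * m + \<i> * \<beta> * n + of_int e * \<i> * \<beta> / of_nat N) / 2)"
    by (simp add: field_simps)
  thus ?thesis unfolding y_type_def fo_flow_affine ee_def by simp
qed

lemma x_type_flow:
  "fo_flow (x_type N \<beta> e) 1 S n m = x_phase N \<beta> e n m *
     S (n + \<i> * \<beta> / of_nat N) (m - of_int e / of_nat N)"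
proof -
  have "of_int e * \<i> * of_real pi * n + of_real pi * \<beta> * m + (of_int e * \<i> * of_real pi * (\<i> * \<beta> / of_nat N) + of_real pi * \<beta> * (- of_int e / of_nat N)) / 2
    = 2 * of_real pi * \<i> * ((of_int e * n - \<i> * \<beta> * m + of_int e * \<i> * \<beta> / of_nat N) / 2)"
    by (simp add: field_simps)
  thus ?thesis unfolding x_type_def fo_flow_affine ee_def by simp
qed

lemma exp_op_y_type:
  "(t, s) \<in> exp_op N (y_type N \<beta> e) \<longleftrightarrow> t \<in> smooth_sections N \<and> s \<in> smooth_sections N \<and>
     (\<exists>S. strip_ext2 (of_int e / of_nat N) (\<i> * \<beta> / of_nat N) t S \<and>
       (\<forall>n m. s n m = y_phase N \<beta> e (of_real n) (of_real m) *
         S (of_real n + of_int e / of_nat N) (of_real m + \<i> * \<beta> / of_nat N)))"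
  unfolding y_type_flow[symmetric] by (simp add: y_type_def)

lemma exp_op_x_type:
  "(t, s) \<in> exp_op N (x_type N \<beta> e) \<longleftrightarrow> t \<in> smooth_sections N \<and> s \<in> smooth_sections N \<and>
     (\<exists>S. strip_ext2 (\<i> * \<beta> / of_nat N) (- of_int e / of_nat N) t S \<and>
       (\<forall>n m. s n m = x_phase N \<beta> e (of_real n) (of_real m) *
         S (of_real n + \<i> * \<beta> / of_nat N) (of_real m - of_int e / of_nat N)))"
  unfolding x_type_flow[symmetric] by (simp add: x_type_def)

lemma x_hat_x_type: "N > 0 \<Longrightarrow> x_hat N b = exp_op N (x_type N b 1)"
  and y_hat_y_type: "N > 0 \<Longrightarrow> y_hat N b = exp_op N (y_type N b 1)"
  and x_tilde_x_type: "N > 0 \<Longrightarrow> x_tilde N b = exp_op N (x_type N (inverse b) (- 1))"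
  and y_tilde_y_type: "N > 0 \<Longrightarrow> y_tilde N b = exp_op N (y_type N (inverse b) (- 1))"
  unfolding x_hat_def y_hat_def x_tilde_def y_tilde_def x_type_def y_type_def nabla_n_def nabla_m_def fo_mult_def
    fo_scale.simps fo_add.simps
  by (intro arg_cong2[where f = exp_op] refl arg_cong[where f = "FO _ _"], simp add: fun_eq_iff field_simps)+

text \<open>The shift by \<open>e\<close> of the summation index is where the translation of \<open>n\<close> by \<open>e / N\<close> is absorbed.\<close>

lemma zc_modulate:
  fixes f g :: "real \<Rightarrow> int \<Rightarrow> complex"
  assumes N: "N > 0"
    and fg: "\<And>x l. f x l = ee (\<i> * \<beta> * of_real x) * ee (- (of_int e * of_int l / of_nat N)) * g x l"
  shows "zc N f p n = ee (\<i> * \<beta> * (of_real n + of_int p / of_nat N)) * zc N g (p - e) (n + of_int e / of_nat N)"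
  unfolding zc_def sum_distrib_left
proof (rule sum.cong[OF refl])
  fix l
  have x: "n + of_int e / real N + of_int (p - e) / real N = n + of_int p / real N"
    by (simp add: diff_divide_distrib)
  have "ee (- (of_int e * of_int l / of_nat N)) * ee (of_int l * of_int p / of_nat N) = ee (of_int l * of_int (p - e) / of_nat N)"
    unfolding ee_add[symmetric] using N by (intro arg_cong[where f = ee]) (simp add: field_simps)
  thus "f (n + of_int p / real N) l * ee (of_int l * of_int p / of_nat N) = ee (\<i> * \<beta> * (of_real n + of_int p / of_nat N)) *
     (g (n + of_int e / real N + of_int (p - e) / real N) l * ee (of_int l * of_int (p - e) / of_nat N))"
    unfolding x fg by (simp add: mult_ac)
qed

text \<open>The series agree term by term after shifting the index by \<open>e\<close>. The total
  phase \<open>P\<close> splits evenly: one half is \<open>y_phase\<close>, the other comes from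
  evaluating the quadratic prefactor at the shifted point.\<close>

lemma zak_modulate:
  fixes f g :: "real \<Rightarrow> int \<Rightarrow> complex"
  assumes N: "N > 0"
    and fg: "\<And>x l. f x l = ee (\<i> * \<beta> * of_real x) * ee (- (of_int e * of_int l / of_nat N)) * g x l"
  shows "zak N f n m = y_phase N \<beta> e (of_real n) (of_real m) *
     zak_ext N (\<lambda>z. g (Re z)) (of_real n + of_int e / of_nat N) (of_real m + \<i> * \<beta> / of_nat N)"
proof -
  define P where "P = ee (of_int e * of_real m + \<i> * \<beta> * of_real n + of_int e * \<i> * \<beta> / of_nat N)"
  have zcr: "zc N (\<lambda>z. g (Re z)) p (of_real n + of_int e / of_nat N) = zc N g p (n + of_int e / of_nat N)" for p
    by (simp add: zc_def)
  have "(\<Sum>\<^sub>\<infinity>p. zc N g p (n + of_int e / of_nat N) * ee (of_int p * (of_real m + \<i> * \<beta> / of_nat N))) =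
    (\<Sum>\<^sub>\<infinity>p. zc N g (p - e) (n + of_int e / of_nat N) * ee (of_int (p - e) * (of_real m + \<i> * \<beta> / of_nat N)))"
    using infsum_int_shift[of "\<lambda>p. zc N g p (n + of_int e / of_nat N) * ee (of_int p * (of_real m + \<i> * \<beta> / of_nat N))" "- e"] by simp
  also have "P * \<dots> = (\<Sum>\<^sub>\<infinity>p. zc N f p n * ee (of_int p * of_real m))"
    unfolding infsum_cmult_right'[symmetric]
  proof (rule infsum_cong)
    fix p
    have "P * ee (of_int (p - e) * (of_real m + \<i> * \<beta> / of_nat N)) = ee (\<i> * \<beta> * (of_real n + of_int p / of_nat N)) * ee (of_int p * of_real m)"
      unfolding P_def ee_add[symmetric] using N by (intro arg_cong[where f = ee]) (simp add: field_simps)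
    from arg_cong[OF this, of "\<lambda>u. u * zc N g (p - e) (n + of_int e / of_nat N)"]
    show "P * (zc N g (p - e) (n + of_int e / of_nat N) * ee (of_int (p - e) * (of_real m + \<i> * \<beta> / of_nat N))) = zc N f p n * ee (of_int p * of_real m)"
      unfolding zc_modulate[OF N fg] by (simp only: mult_ac)
  qed
  finally have sum: "P * (\<Sum>\<^sub>\<infinity>p. zc N g p (n + of_int e / of_nat N) * ee (of_int p * (of_real m + \<i> * \<beta> / of_nat N))) =
     (\<Sum>\<^sub>\<infinity>p. zc N f p n * ee (of_int p * of_real m))" .
  have "y_phase N \<beta> e (of_real n) (of_real m) *
     ee (of_nat N * (of_real m + \<i> * \<beta> / of_nat N) * (of_real n + of_int e / of_nat N) / 2) = ee (of_nat N * of_real m * of_real n / 2) * P"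
    unfolding P_def ee_add[symmetric] using N by (intro arg_cong[where f = ee]) (simp add: field_simps)
  note E = this
  have "k * c * (P * S) = a * (k * b * S)" if "a * b = c * P" for a b c k S :: complex
    using arg_cong[OF that, of "\<lambda>u. k * u * S"] by (simp only: mult_ac)
  from this[OF E] show ?thesis unfolding zak_eq zak_ext_def zcr sum[symmetric] .
qed

lemma sum_int_periodic_shift:
  fixes \<phi> :: "int \<Rightarrow> 'b::comm_monoid_add"
  assumes N: "N > 0" and \<phi>: "\<And>l. \<phi> (l + int N) = \<phi> l"
  shows "(\<Sum>l\<in>{0..<int N}. \<phi> (l + e)) = (\<Sum>l\<in>{0..<int N}. \<phi> l)"
proof -
  have mod: "\<phi> (l mod int N) = \<phi> l" for l
    by (rule int_periodic_mod[of \<phi>, OF \<phi>])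
  show ?thesis
    by (rule sum.reindex_bij_witness[of _ "\<lambda>l. (l - e) mod int N" "\<lambda>l. (l + e) mod int N"])
       (use N mod in \<open>auto simp: mod_simps\<close>)
qed

text \<open>Reindexing \<open>l\<close> by \<open>e\<close> produces \<open>ee (e p / N)\<close>,
  which the real shift of \<open>m\<close> by \<open>- e / N\<close> removes; the change of the
  quadratic prefactor cancels \<open>x_phase\<close>.\<close>

lemma zak_shift:
  fixes f :: "real \<Rightarrow> int \<Rightarrow> complex"
  assumes N: "N > 0" and G: "\<And>z l. G z (l + int N) = G z l"
    and f: "\<And>x l. f x l = G (of_real x + \<i> * \<beta> / of_nat N) (l + e)"
  shows "zak N f n m = x_phase N \<beta> e (of_real n) (of_real m) *
     zak_ext N G (of_real n + \<i> * \<beta> / of_nat N) (of_real m - of_int e / of_nat N)"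
proof -
  have zc: "zc N G p (of_real n + \<i> * \<beta> / of_nat N) = ee (of_int e * of_int p / of_nat N) * zc N f p n" for p
  proof -
    have "zc N G p (of_real n + \<i> * \<beta> / of_nat N) = (\<Sum>l\<in>{0..<int N}. G (of_real n + \<i> * \<beta> / of_nat N + of_int p / of_nat N) (l + e) * ee (of_int (l + e) * of_int p / of_nat N))"
      unfolding zc_def
    proof (rule sum_int_periodic_shift[OF N, symmetric])
      fix l
      have "of_int (l + int N) * of_int p / of_nat N = of_int l * of_int p / of_nat N + complex_of_int p"
        using N by (simp add: field_simps)
      thus "G (of_real n + \<i> * \<beta> / of_nat N + of_int p / of_nat N) (l + int N) * ee (of_int (l + int N) * of_int p / of_nat N) =
         G (of_real n + \<i> * \<beta> / of_nat N + of_int p / of_nat N) l * ee (of_int l * of_int p / of_nat N)"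
        by (simp only: G ee_add ee_of_int mult_1_right)
    qed
    also have "\<dots> = ee (of_int e * of_int p / of_nat N) * zc N f p n"
      unfolding zc_def sum_distrib_left f
      by (intro sum.cong refl) (simp add: ring_distribs add_divide_distrib ee_add add_ac)
    finally show ?thesis .
  qed
  have S: "(\<Sum>\<^sub>\<infinity>p. zc N G p (of_real n + \<i> * \<beta> / of_nat N) * ee (of_int p * (of_real m - of_int e / of_nat N))) =
    (\<Sum>\<^sub>\<infinity>p. zc N f p n * ee (of_int p * of_real m))"
  proof (rule infsum_cong)
    fix p
    have "ee (of_int e * of_int p / of_nat N) * ee (of_int p * (of_real m - of_int e / of_nat N)) = ee (of_int p * of_real m)"
      unfolding ee_add[symmetric] using N by (intro arg_cong[where f = ee]) (simp add: field_simps)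
    from arg_cong[OF this, of "\<lambda>u. zc N f p n * u"]
    show "zc N G p (of_real n + \<i> * \<beta> / of_nat N) * ee (of_int p * (of_real m - of_int e / of_nat N)) = zc N f p n * ee (of_int p * of_real m)"
      unfolding zc by (simp only: mult_ac)
  qed
  have E: "x_phase N \<beta> e (of_real n) (of_real m) *
     ee (of_nat N * (of_real m - of_int e / of_nat N) * (of_real n + \<i> * \<beta> / of_nat N) / 2) = ee (of_nat N * of_real m * of_real n / 2)"
    unfolding ee_add[symmetric] using N by (intro arg_cong[where f = ee]) (simp add: field_simps)
  have "k * c * S = a * (k * b * S)" if "a * b = c" for a b c k S :: complex
    using arg_cong[OF that, of "\<lambda>u. k * u * S"] by (simp only: mult_ac)
  from this[OF E] show ?thesis unfolding zak_eq zak_ext_def S .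
qed

section \<open>Conjugation of the multiplication operators\<close>

text \<open>By periodicity finitely many residues of \<open>l\<close> occur, and the sum of their
  bounds serves for all.\<close>

lemma Schwartz_AN_uniform_decay:
  assumes f: "f \<in> Schwartz_AN N" and N: "N > 0"
  shows "\<exists>K\<ge>0. \<forall>x l. norm (f x l) * (1 + x ^ 2) \<le> K"
proof -
  have "\<exists>C. \<forall>y. (1 + \<bar>y\<bar>) ^ 2 * norm (f y l) \<le> C" for l
    using f schwartz_rapid unfolding Schwartz_AN_def rapid_def by blast
  then obtain C where C: "\<And>l y. (1 + \<bar>y\<bar>) ^ 2 * norm (f y l) \<le> C l" by metis
  have C0: "C l \<ge> 0" for l using order_trans[OF _ C[of 0 l]] by simp
  have mod: "f x (l mod int N) = f x l" for x l
    by (rule int_periodic_mod[of "f x", OF periodic_AN_AN[OF f]])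
  have "norm (f x l) * (1 + x ^ 2) \<le> (\<Sum>l\<in>{0..<int N}. C l)" for x l
  proof -
    have "norm (f x l) * (1 + x ^ 2) \<le> norm (f x l) * (1 + \<bar>x\<bar>) ^ 2"
      by (intro mult_left_mono) (auto simp: power2_eq_square algebra_simps abs_mult_self_eq)
    also have "\<dots> \<le> C (l mod int N)" using C[of x "l mod int N"] by (simp add: mod mult.commute)
    also have "\<dots> \<le> (\<Sum>l\<in>{0..<int N}. C l)" using N C0 by (intro member_le_sum) auto
    finally show ?thesis .
  qed
  moreover have "(\<Sum>l\<in>{0..<int N}. C l) \<ge> 0" by (intro sum_nonneg C0)
  ultimately show ?thesis by blast
qed

lemma Im_i_beta: "Im (\<i> * \<beta> / of_nat N) = Re \<beta> / real N"
  by simp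

text \<open>For 0 \<le> N Im w \<le> Re \<beta> the factor exp (- 2 pi N (Im w) x) is at most the
  sum of its values on the two edges, so its product with |g| is at most |f| + |g|. The shift in
  \<open>n\<close> is real, so the strip there is the real line and \<open>Re\<close> is only a
  coercion.\<close>

lemma zak_modulate_strip_ext:
  assumes N: "N > 0" and \<beta>: "Re \<beta> > 0" and f: "f \<in> Schwartz_AN N" and g: "g \<in> Schwartz_AN N"
    and fg: "\<And>x l. f x l = ee (\<i> * \<beta> * of_real x) * ee (- (of_int e * of_int l / of_nat N)) * g x l"
  shows "strip_ext2 (of_int e / of_nat N) (\<i> * \<beta> / of_nat N) (zak N g) (zak_ext N (\<lambda>z. g (Re z)))"
proof -
  obtain K1 where K1: "\<And>x l. norm (f x l) * (1 + x ^ 2) \<le> K1" using Schwartz_AN_uniform_decay[OF f N] by blast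
  obtain K2 where K2: "\<And>x l. norm (g x l) * (1 + x ^ 2) \<le> K2" using Schwartz_AN_uniform_decay[OF g N] by blast
  let ?a = "of_int e / of_nat N :: complex" and ?c = "\<i> * \<beta> / of_nat N"
  have Im_a: "Im ?a = 0" by simp
  have Im_c: "Im ?c > 0" unfolding Im_i_beta using N \<beta> by simp
  have cont: "continuous_on (strip ?a) (\<lambda>z. g (Re z) l)" for l
    using g by (auto simp: Schwartz_AN_def intro!: continuous_on_compose2[OF schwartz_continuous[of _ UNIV]] continuous_intros)
  have holo: "(\<lambda>z. g (Re z) l) holomorphic_on interior (strip ?a)" for l
    unfolding strip_Im_0(2)[OF Im_a] by (simp add: holomorphic_on_def)
  have decay: "norm (g (Re z) l) * exp (- 2 * pi * real N * Im w * Re z) \<le> (K1 + K2) / (1 + Re z ^ 2)"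
    if "z \<in> strip ?a" "w \<in> strip ?c" for l z w
  proof -
    define x where "x = Re z"
    have w: "0 \<le> Im w" "real N * Im w \<le> Re \<beta>"
      using that(2) N unfolding strip_Im_pos(1)[OF Im_c] Im_i_beta by (auto simp: field_simps)
    have "exp (- 2 * pi * real N * Im w * x) \<le> exp (- 2 * pi * Re \<beta> * x) + 1"
    proof (cases "x \<ge> 0")
      case True
      hence "exp (- 2 * pi * real N * Im w * x) \<le> 1" using w by simp
      thus ?thesis using exp_ge_zero[of "- 2 * pi * Re \<beta> * x"] by linarith
    next
      case False
      hence "(real N * Im w) * (- x) \<le> Re \<beta> * (- x)" using w by (intro mult_right_mono) auto
      hence "2 * pi * ((real N * Im w) * (- x)) \<le> 2 * pi * (Re \<beta> * (- x))" by (intro mult_left_mono) auto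
      hence "exp (- 2 * pi * real N * Im w * x) \<le> exp (- 2 * pi * Re \<beta> * x)" by (simp add: mult_ac)
      thus ?thesis by linarith
    qed
    hence "norm (g x l) * exp (- 2 * pi * real N * Im w * x) \<le> norm (g x l) * (exp (- 2 * pi * Re \<beta> * x) + 1)"
      by (intro mult_left_mono) auto
    also have "\<dots> = norm (f x l) + norm (g x l)"
    proof -
      have "norm (ee (- (of_int e * of_int l / of_nat N))) = 1" by (rule norm_ee_Im0) simp
      thus ?thesis unfolding fg norm_mult by (simp add: norm_ee algebra_simps)
    qed
    finally have le: "norm (g x l) * exp (- 2 * pi * real N * Im w * x) \<le> norm (f x l) + norm (g x l)" .
    have pos: "1 + x ^ 2 > 0" by (simp add: add_pos_nonneg)
    have "norm (f x l) + norm (g x l) \<le> (K1 + K2) / (1 + x ^ 2)"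
      using K1[of x l] K2[of x l] by (simp only: pos_le_divide_eq[OF pos] distrib_right)
    with le show ?thesis unfolding x_def by linarith
  qed
  have ext: "zak_ext N (\<lambda>z. g (Re z)) (of_real n) (of_real m) = zak N g n m" for n m
    by (rule zak_ext_eq_zak) simp
  show ?thesis
    unfolding strip_ext2_def
    using zak_ext_regular[where a = ?a and c = ?c and G = "\<lambda>z. g (Re z)" and K = "K1 + K2", OF N cont holo decay] ext
    by blast
qed

lemma strip_unique':
  assumes h: "Im a > 0" and cont: "continuous_on (strip a) D" and holo: "D holomorphic_on interior (strip a)"
    and zero: "\<And>x. D (of_real x) = 0" and z: "z \<in> strip a"
  shows "D z = 0"
  using strip_unique[OF h, of D z] assms unfolding strip_Im_pos(2)[OF h] unfolding strip_Im_pos(1)[OF h] by simp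

text \<open>The values of \<open>s\<close> are read off on the far edge of the strip; the contour
  shift moves the coefficient integral to the real axis, where \<open>S\<close> equals
  \<open>t\<close>. The shift needs a 1-periodic integrand, hence quasi-periodicity of the
  continuation.\<close>

lemma exp_op_y_type_coeff:
  assumes N: "N > 0" and \<beta>: "Re \<beta> > 0" and t: "t \<in> smooth_sections N"
    and S: "strip_ext2 (of_int e / of_nat N) (\<i> * \<beta> / of_nat N) t S"
    and s: "\<And>n m. s n m = y_phase N \<beta> e (of_real n) (of_real m) *
         S (of_real n + of_int e / of_nat N) (of_real m + \<i> * \<beta> / of_nat N)"
  shows "section_coeff N (s n) p (of_real n) = ee (\<i> * \<beta> * (of_real n + of_int p / of_nat N)) *
     section_coeff N (t (n + of_int e / of_nat N)) (p - e) (of_real (n + of_int e / of_nat N))"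
proof -
  let ?a = "of_int e / of_nat N :: complex" and ?c = "\<i> * \<beta> / of_nat N"
  define n' where "n' = n + of_int e / real N"
  have n': "complex_of_real n' = of_real n + of_int e / of_nat N" by (simp add: n'_def)
  have Im_c: "Im ?c > 0" unfolding Im_i_beta using N \<beta> by simp
  have n's: "complex_of_real n' \<in> strip ?a" by simp
  have Sr: "S (of_real n) (of_real m) = t n m" for n m using S by (simp add: strip_ext2_def)
  have Sc: "continuous_on (strip ?c) (\<lambda>w. S (of_real n') w)"
  proof -
    have "continuous_on (strip ?a \<times> strip ?c) (\<lambda>(z, w). S z w)" using S by (simp add: strip_ext2_def)
    from continuous_on_compose2[OF this, of "strip ?c" "\<lambda>w. (of_real n', w)"] show ?thesis
      by (simp add: image_subset_iff continuous_on_Pair)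
  qed
  have Sh: "(\<lambda>w. S (of_real n') w) holomorphic_on interior (strip ?c)"
    using S n's unfolding strip_ext2_def by blast
  define H where "H w = ee (- (of_nat N * w * of_real n' / 2)) * S (of_real n') w * ee (- (of_int (p - e) * w))" for w
  have shift: "w + 1 \<in> strip ?c \<longleftrightarrow> w \<in> strip ?c" for w by (simp add: strip_def)
  have shifti: "w + 1 \<in> interior (strip ?c) \<longleftrightarrow> w \<in> interior (strip ?c)" for w by (simp add: strip_Im_pos(2)[OF Im_c])
  \<comment> \<open>Both sides continue the same function from the real axis, so they agree on the
    strip.\<close>
  have Sper: "S (of_real n') (w + 1) = ee (of_nat N * of_real n' / 2) * S (of_real n') w" if "w \<in> strip ?c" for w
  proof -
    have "S (of_real n') (w + 1) - ee (of_nat N * of_real n' / 2) * S (of_real n') w = 0"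
    proof (rule strip_unique'[OF Im_c _ _ _ that])
      show "continuous_on (strip ?c) (\<lambda>w. S (of_real n') (w + 1) - ee (of_nat N * of_real n' / 2) * S (of_real n') w)"
        by (intro continuous_intros continuous_on_compose2[OF Sc] Sc) (auto simp: shift)
      have "((\<lambda>w. S (of_real n') w) \<circ> (\<lambda>w. w + 1)) holomorphic_on interior (strip ?c)"
        by (rule holomorphic_on_compose_gen[OF _ Sh]) (auto intro!: holomorphic_intros simp: shifti)
      thus "(\<lambda>w. S (of_real n') (w + 1) - ee (of_nat N * of_real n' / 2) * S (of_real n') w) holomorphic_on interior (strip ?c)"
        by (intro holomorphic_intros Sh) (simp add: o_def)
      show "S (of_real n') (of_real x + 1) - ee (of_nat N * of_real n' / 2) * S (of_real n') (of_real x) = 0" for x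
        using Sr[of n' x] Sr[of n' "x + 1"] smooth_sections_quasi_periodic(2)[OF t, of n' x] by simp
    qed
    thus ?thesis by simp
  qed
  have Hper: "H (w + 1) = H w" if "w \<in> strip ?c" for w
  proof -
    have "ee (- (of_nat N * (w + 1) * of_real n' / 2)) * ee (of_nat N * of_real n' / 2) = ee (- (of_nat N * w * of_real n' / 2))"
      unfolding ee_add[symmetric] by (intro arg_cong[where f = ee]) (simp add: field_simps)
    moreover have "- (of_int (p - e) * (w + 1)) = - (of_int (p - e) * w) + of_int (- (p - e))" by (simp add: algebra_simps)
    hence "ee (- (of_int (p - e) * (w + 1))) = ee (- (of_int (p - e) * w))" by (simp only: ee_add ee_of_int mult_1_right)
    ultimately show ?thesis unfolding H_def Sper[OF that] by (metis mult.assoc)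
  qed
  have Hint: "integral {0..1} (\<lambda>m. H (of_real m + ?c)) = integral {0..1} (\<lambda>m. H (of_real m))"
  proof (rule strip_integral_shift[of ?c])
    show "continuous_on (strip ?c) H" unfolding H_def by (intro continuous_intros Sc) simp
    show "H holomorphic_on interior (strip ?c)" unfolding H_def by (intro holomorphic_intros Sh) simp
    show "?c \<in> strip ?c" using Im_c by (simp add: strip_Im_pos(1)[OF Im_c])
  qed (rule Hper)
  have "ee (- (of_nat N * of_real m * of_real n / 2)) * s n m * ee (- (of_int p * of_real m)) =
     ee (\<i> * \<beta> * (of_real n + of_int p / of_nat N)) * H (of_real m + ?c)" for m
  proof -
    have "ee (- (of_nat N * of_real m * of_real n / 2)) * y_phase N \<beta> e (of_real n) (of_real m) * ee (- (of_int p * of_real m)) =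
      ee (\<i> * \<beta> * (of_real n + of_int p / of_nat N)) * ee (- (of_nat N * (of_real m + ?c) * of_real n' / 2)) * ee (- (of_int (p - e) * (of_real m + ?c)))"
      unfolding ee_add[symmetric] n' using N by (intro arg_cong[where f = ee]) (simp add: field_simps)
    note E = this
    have "a * (b * X) * c = a' * (b' * X * c')" if "a * b * c = a' * b' * c'" for a b c a' b' c' X :: complex
      using arg_cong[OF that, of "\<lambda>u. u * X"] by (simp only: mult_ac)
    from this[OF E] show ?thesis unfolding s H_def n' .
  qed
  hence "integral {0..1} (\<lambda>m. ee (- (of_nat N * of_real m * of_real n / 2)) * s n m * ee (- (of_int p * of_real m))) =
    ee (\<i> * \<beta> * (of_real n + of_int p / of_nat N)) * integral {0..1} (\<lambda>m. H (of_real m))"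
    by (simp only: integral_mult_right Hint)
  moreover have "H (of_real m) = ee (- (of_nat N * of_real m * of_real n' / 2)) * t n' m * ee (- (of_int (p - e) * of_real m))" for m
    by (simp add: H_def Sr)
  ultimately show ?thesis
    unfolding section_coeff_def n'_def[symmetric] by simp
qed

lemma zak_conjugates_mult:
  assumes N: "N > 0" and \<beta>: "Re \<beta> > 0"
  shows "(zak_op N)\<inverse> O mult_op N (exp_weight N \<beta> e) O zak_op N
     = (exp_op N (y_type N \<beta> e))\<inverse>"
proof -
  \<comment> \<open>The relation solved for \<open>f\<close>, because the exponential acts from the
    transform of \<open>g\<close> to that of \<open>f\<close>.\<close>
  have q: "(g x l = exp (2 * complex_of_real pi * \<beta> * of_real x) * ee (of_int e * of_int l / of_nat N) * f x l) \<longleftrightarrow>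
    (f x l = ee (\<i> * \<beta> * of_real x) * ee (- (of_int e * of_int l / of_nat N)) * g x l)" for f g :: "real \<Rightarrow> int \<Rightarrow> complex" and x l
  proof -
    have e: "exp (2 * complex_of_real pi * \<beta> * of_real x) = inverse (ee (\<i> * \<beta> * of_real x))"
      unfolding ee_minus[symmetric] by (simp add: ee_def mult_ac)
    have "v = inverse X * Y * u \<longleftrightarrow> u = X * inverse Y * v" if "X \<noteq> 0" "Y \<noteq> 0" for X Y u v :: complex
      using that by (auto simp: field_simps)
    from this[OF ee_nonzero ee_nonzero] show ?thesis unfolding e ee_minus .
  qed
  have "(s, t) \<in> (zak_op N)\<inverse> O mult_op N (exp_weight N \<beta> e) O zak_op N
     \<longleftrightarrow> (t, s) \<in> exp_op N (y_type N \<beta> e)" (is "?L \<longleftrightarrow> ?R") for s t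
  proof
    assume ?L
    then obtain f g where fg: "f \<in> Schwartz_AN N" "g \<in> Schwartz_AN N" "s = zak N f" "t = zak N g"
      "\<And>x l. f x l = ee (\<i> * \<beta> * of_real x) * ee (- (of_int e * of_int l / of_nat N)) * g x l"
      by (auto simp: zak_op_def mult_op_def q)
    show ?R
      unfolding exp_op_y_type fg(3,4)
      using zak_smooth_section[OF fg(1) N] zak_smooth_section[OF fg(2) N] zak_modulate_strip_ext[OF N \<beta> fg(1,2,5)]
        zak_modulate[OF N fg(5)] by blast
  next
    assume ?R
    then obtain S where ts: "t \<in> smooth_sections N" "s \<in> smooth_sections N" and
      S: "strip_ext2 (of_int e / of_nat N) (\<i> * \<beta> / of_nat N) t S" and
      eq: "\<And>n m. s n m = y_phase N \<beta> e (of_real n) (of_real m) *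
         S (of_real n + of_int e / of_nat N) (of_real m + \<i> * \<beta> / of_nat N)"
      unfolding exp_op_y_type by blast
    obtain g where g: "g \<in> Schwartz_AN N" "t = zak N g" using zak_surj[OF ts(1) N] by blast
    obtain f where f: "f \<in> Schwartz_AN N" "s = zak N f" using zak_surj[OF ts(2) N] by blast
    \<comment> \<open>At this point \<open>f'\<close> is not known to be Schwartz; it is identified
      with \<open>f\<close> by comparing the coefficients \<open>zc\<close>.\<close>
    define f' where "f' x l = ee (\<i> * \<beta> * of_real x) * ee (- (of_int e * of_int l / of_nat N)) * g x l" for x :: real and l
    have "f x l = f' x l" for x l
    proof (rule Schwartz_AN_eqI[OF N, where f = f and g = f' and x = x and l = l])
      show "f x (l + int N) = f x l" for x l by (rule periodic_AN_AN[OF f(1)])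
      show "f' x (l + int N) = f' x l" for x l
      proof -
        have "- (of_int e * of_int (l + int N) / of_nat N) = - (of_int e * of_int l / of_nat N) + complex_of_int (- e)"
          using N by (simp add: field_simps)
        thus ?thesis unfolding f'_def periodic_AN_AN[OF g(1)] by (simp only: ee_add ee_of_int mult_1_right)
      qed
      show "zc N f p x = zc N f' p x" for p x
      proof -
        have "zc N f p x = section_coeff N (s x) p (of_real x)"
          using section_coeff_zak[OF f(1) N] f(2) by simp
        also have "\<dots> = ee (\<i> * \<beta> * (of_real x + of_int p / of_nat N)) * zc N g (p - e) (x + of_int e / of_nat N)"
          unfolding exp_op_y_type_coeff[OF N \<beta> ts(1) S eq] g(2) section_coeff_zak[OF g(1) N] ..
        also have "\<dots> = zc N f' p x" by (rule zc_modulate[OF N f'_def, symmetric])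
        finally show ?thesis .
      qed
    qed
    hence "(f, g) \<in> mult_op N (exp_weight N \<beta> e)"
      using f g by (simp add: mult_op_def q f'_def)
    thus ?L using f g by (auto simp: zak_op_def)
  qed
  thus ?thesis by auto
qed

section \<open>Shift operators\<close>

text \<open>For Im a > 0 the shift operators continue functions downwards by \<open>a\<close>, while
  the exponentials continue sections upwards by \<open>a\<close>; translation by \<open>a\<close>
  carries one strip onto the other.\<close>

lemma strip_uminus:
  "z \<in> strip (- a) \<longleftrightarrow> z + a \<in> strip a" "z \<in> interior (strip (- a)) \<longleftrightarrow> z + a \<in> interior (strip a)"
proof -
  have "strip (- a) = (+) (- a) ` strip a"
  proof (intro equalityI subsetI)
    fix z assume "z \<in> strip (- a)"
    hence "z + a \<in> strip a" by (auto simp: strip_def closed_segment_eq_real_ivl split: if_splits)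
    thus "z \<in> (+) (- a) ` strip a" by (intro image_eqI[of _ _ "z + a"]) auto
  qed (auto simp: strip_def closed_segment_eq_real_ivl split: if_splits)
  moreover from this have "interior (strip (- a)) = (+) (- a) ` interior (strip a)"
    by (simp only: interior_translation)
  moreover have "z \<in> (+) (- a) ` X \<longleftrightarrow> z + a \<in> X" for X by (auto simp: image_iff intro: bexI[of _ "z + a"])
  ultimately show "z \<in> strip (- a) \<longleftrightarrow> z + a \<in> strip a" "z \<in> interior (strip (- a)) \<longleftrightarrow> z + a \<in> interior (strip a)"
    by auto
qed

lemma one_plus_square_le:
  fixes x y :: real
  shows "1 + (x + y) ^ 2 \<le> 2 * (1 + y ^ 2) * (1 + x ^ 2)"
proof -
  have "0 \<le> (x - y) ^ 2 + 1 + 2 * (x ^ 2 * y ^ 2)" by simp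
  thus ?thesis by (simp add: power2_eq_square algebra_simps)
qed

text \<open>The continuation of \<open>f\<close> below the axis, translated by \<open>a\<close>,
  continues \<open>g\<close> above it, with \<open>g\<close> on the lower and \<open>f\<close> on
  the upper edge. Schwartz decay on both edges and boundedness give the decay that
  \<open>zak_ext_regular\<close> requires.\<close>

lemma zak_shift_strip_ext:
  fixes f g :: "real \<Rightarrow> int \<Rightarrow> complex"
  assumes N: "N > 0" and a: "Im a > 0" and c: "Im c = 0" and f: "f \<in> Schwartz_AN N" and g: "g \<in> Schwartz_AN N"
    and F: "\<And>l. strip_ext (- a) (\<lambda>x. f x l) (F l)" and gF: "\<And>x l. g x l = F (l - e) (of_real x - a)"
  obtains G where "\<And>z l. G z (l + int N) = G z l" "\<And>x l. f x l = G (of_real x + a) (l + e)"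
    "strip_ext2 a c (zak N g) (zak_ext N G)"
proof -
  \<comment> \<open>\<open>shift_op\<close> does not ask for \<open>F\<close> to be periodic in
    \<open>l\<close>; reducing modulo \<open>N\<close> enforces it and keeps the values on the
    edges.\<close>
  define G where "G z l = F ((l - e) mod int N) (z - a)" for z l
  have Gper: "G z (l + int N) = G z l" for z l
    unfolding G_def by (metis diff_add_eq mod_add_self2)
  have gmod: "g x l = g x k" if "l mod int N = k mod int N" for x l k
    using int_periodic_mod[of "g x" N] periodic_AN_AN[OF g] that by metis
  have fmod: "f x (l mod int N) = f x l" for x l
    using int_periodic_mod[of "f x" N] periodic_AN_AN[OF f] by metis
  have Gg: "G (of_real x) l = g x l" for x l
  proof -
    have "G (of_real x) l = g x ((l - e) mod int N + e)" by (simp add: G_def gF)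
    also have "\<dots> = g x l" by (rule gmod) (simp add: mod_simps)
    finally show ?thesis .
  qed
  have Ff: "F l (of_real x) = f x l" for x l using F[of l] by (simp add: strip_ext_def)
  have fG: "f x l = G (of_real x + a) (l + e)" for x l
    by (simp add: G_def Ff fmod)
  have sub: "z - a \<in> strip (- a) \<longleftrightarrow> z \<in> strip a" "z - a \<in> interior (strip (- a)) \<longleftrightarrow> z \<in> interior (strip a)" for z
    using strip_uminus[of "z - a" a] by simp_all
  have cont: "continuous_on (strip a) (\<lambda>z. G z l)" for l
  proof -
    have "continuous_on (strip (- a)) (F ((l - e) mod int N))" using F by (simp add: strip_ext_def)
    from continuous_on_compose2[OF this, of "strip a" "\<lambda>z. z - a"] show ?thesis
      unfolding G_def by (simp add: image_subset_iff sub continuous_on_diff)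
  qed
  have holo: "(\<lambda>z. G z l) holomorphic_on interior (strip a)" for l
  proof -
    have "F ((l - e) mod int N) holomorphic_on interior (strip (- a))" using F by (simp add: strip_ext_def)
    hence "(F ((l - e) mod int N) \<circ> (\<lambda>z. z - a)) holomorphic_on interior (strip a)"
      by (rule holomorphic_on_compose_gen[rotated]) (auto simp: sub intro!: holomorphic_intros)
    thus ?thesis unfolding G_def o_def .
  qed
  obtain K1 where K1: "\<And>x l. norm (f x l) * (1 + x ^ 2) \<le> K1" using Schwartz_AN_uniform_decay[OF f N] by blast
  obtain K2 where K2: "\<And>x l. norm (g x l) * (1 + x ^ 2) \<le> K2" using Schwartz_AN_uniform_decay[OF g N] by blast
  \<comment> \<open>\<open>K2\<close> bounds the lower edge; the second term bounds the upper edge,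
    where the real part is displaced by \<open>Re a\<close>.\<close>
  define C where "C = K2 + 2 * (1 + Re a ^ 2) * K1"
  have K0: "K1 \<ge> 0" "K2 \<ge> 0" using order_trans[OF _ K1[of 0 0]] order_trans[OF _ K2[of 0 0]] by simp_all
  have Gdecay: "norm (G z l) * (1 + Re z ^ 2) \<le> C * (1 + Im a) ^ 2 + 1" if z: "z \<in> strip a" for z l
  proof -
    have "bounded (F ((l - e) mod int N) ` strip (- a))" using F by (simp add: strip_ext_def)
    then obtain M where M: "\<And>z. z \<in> strip (- a) \<Longrightarrow> norm (F ((l - e) mod int N) z) \<le> M"
      unfolding bounded_iff by blast
    have GM: "norm (G z l) \<le> M" if "z \<in> strip a" for z unfolding G_def using that by (intro M) (simp add: sub)
    show ?thesis
    proof (rule strip_decay[OF a, where M = M])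
      show "continuous_on {z. 0 \<le> Im z \<and> Im z \<le> Im a} (\<lambda>z. G z l)" using cont[of l] unfolding strip_Im_pos(1)[OF a] .
      show "(\<lambda>z. G z l) holomorphic_on {z. 0 < Im z \<and> Im z < Im a}" using holo[of l] unfolding strip_Im_pos(2)[OF a] .
      show "norm (G z l) \<le> M" if "0 \<le> Im z" "Im z \<le> Im a" for z using that by (intro GM) (simp add: strip_Im_pos(1)[OF a])
      show "norm (G z l) * (1 + Re z ^ 2) \<le> C" if "Im z = 0 \<or> Im z = Im a" for z
        using that
      proof
        assume "Im z = 0"
        hence "z = of_real (Re z)" by (simp add: complex_eq_iff)
        hence "norm (G z l) * (1 + Re z ^ 2) \<le> K2" using K2[of "Re z" l] Gg[of "Re z" l] by simp
        also have "\<dots> \<le> C" using K0 by (simp add: C_def)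
        finally show ?thesis .
      next
        assume "Im z = Im a"
        define x where "x = Re z - Re a"
        have "z = of_real x + a" using \<open>Im z = Im a\<close> by (simp add: complex_eq_iff x_def)
        hence "G z l = f x (l - e)" using fG[of x "l - e"] by simp
        moreover have "1 + Re z ^ 2 \<le> 2 * (1 + Re a ^ 2) * (1 + x ^ 2)"
          using one_plus_square_le[of x "Re a"] by (simp add: x_def)
        ultimately have "norm (G z l) * (1 + Re z ^ 2) \<le> norm (f x (l - e)) * (2 * (1 + Re a ^ 2) * (1 + x ^ 2))"
          by (simp only:) (intro mult_left_mono; simp)
        also have "\<dots> = 2 * (1 + Re a ^ 2) * (norm (f x (l - e)) * (1 + x ^ 2))" by (simp only: mult_ac)
        also have "\<dots> \<le> 2 * (1 + Re a ^ 2) * K1" by (intro mult_left_mono K1) simp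
        also have "\<dots> \<le> C" using K0 by (simp add: C_def)
        finally show ?thesis .
      qed
    qed (use z in \<open>simp_all add: strip_Im_pos(1)[OF a]\<close>)
  qed
  have decay: "norm (G z l) * exp (- 2 * pi * real N * Im w * Re z) \<le> (C * (1 + Im a) ^ 2 + 1) / (1 + Re z ^ 2)"
    if "z \<in> strip a" "w \<in> strip c" for l z w
  proof -
    have "Im w = 0" using that(2) unfolding strip_Im_0(1)[OF c] by simp
    moreover have "1 + Re z ^ 2 > 0" by (simp add: add_pos_nonneg)
    ultimately show ?thesis using Gdecay[OF that(1), of l] by (simp add: pos_le_divide_eq)
  qed
  have "strip_ext2 a c (zak N g) (zak_ext N G)"
    unfolding strip_ext2_def
    using zak_ext_regular[where a = a and c = c and G = G and K = "C * (1 + Im a) ^ 2 + 1", OF N cont holo decay]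
      zak_ext_eq_zak[of G g, OF Gg] by blast
  with Gper fG show ?thesis by (rule that)
qed

text \<open>A coefficient is an integral over one period of \<open>m\<close>, with \<open>z\<close>
  as parameter. Boundedness comes from quasi-periodicity: for real \<open>m\<close> the modulus of
  the integrand is 1-periodic in \<open>z\<close>, so a compact rectangle decides.\<close>

lemma section_coeff_strip:
  assumes N: "N > 0" and a: "Im a > 0" and t: "t \<in> smooth_sections N" and S: "strip_ext2 a c t S"
  defines "C \<equiv> \<lambda>p z. section_coeff N (\<lambda>m. S z (of_real m)) p z"
  shows "continuous_on (strip a) (C p)" "C p holomorphic_on interior (strip a)" "bounded (C p ` strip a)"
proof -
  have Sr: "S (of_real n) (of_real m) = t n m" for n m using S by (simp add: strip_ext2_def)
  have Scz: "continuous_on (strip a) (\<lambda>z. S z (of_real m))" for m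
  proof -
    have "continuous_on (strip a \<times> strip c) (\<lambda>(z, w). S z w)" using S by (simp add: strip_ext2_def)
    from continuous_on_compose2[OF this, of "strip a" "\<lambda>z. (z, of_real m)"] show ?thesis
      by (simp add: image_subset_iff continuous_on_Pair)
  qed
  have Sh: "(\<lambda>z. S z (of_real m)) holomorphic_on interior (strip a)" for m
    using S of_real_in_strip unfolding strip_ext2_def by blast
  define k where "k z m = ee (- (of_nat N * of_real m * z / 2)) * S z (of_real m) * ee (- (of_int p * of_real m))" for z and m :: real
  have C: "C p = (\<lambda>z. of_real (sqrt (real N)) * integral {0..1} (k z))"
    unfolding C_def section_coeff_def k_def[abs_def] by (rule refl)
  have kc: "continuous_on (strip a \<times> {0..1}) (\<lambda>(z, m). k z m)"
  proof -
    have "continuous_on (strip a \<times> strip c) (\<lambda>(z, w). S z w)" using S by (simp add: strip_ext2_def)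
    hence "continuous_on (strip a \<times> {0..1}) (\<lambda>x. case (fst x, complex_of_real (snd x)) of (z, w) \<Rightarrow> S z w)"
      by (rule continuous_on_compose2) (auto intro!: continuous_intros)
    thus ?thesis unfolding k_def case_prod_unfold
      by (intro continuous_intros) auto
  qed
  have khol: "(\<lambda>z. k z m) holomorphic_on interior (strip a)" for m
    unfolding k_def by (intro holomorphic_intros Sh) auto
  show "continuous_on (strip a) (C p)"
    unfolding C using integral_continuous_on_param[of "strip a" 0 1 k] kc by (intro continuous_intros) simp
  show "C p holomorphic_on interior (strip a)"
    unfolding C
    by (intro holomorphic_intros holomorphic_on_integral open_interior khol continuous_on_subset[OF kc])
       (use interior_subset in blast)
  have shift: "z + 1 \<in> strip a \<longleftrightarrow> z \<in> strip a" for z by (simp add: strip_def)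
  have shifti: "z + 1 \<in> interior (strip a) \<longleftrightarrow> z \<in> interior (strip a)" for z by (simp add: strip_Im_pos(2)[OF a])
  have Sper: "S (z + 1) (of_real m) = ee (- (of_nat N * of_real m / 2)) * S z (of_real m)" if "z \<in> strip a" for z m
  proof -
    have "S (z + 1) (of_real m) - ee (- (of_nat N * of_real m / 2)) * S z (of_real m) = 0"
    proof (rule strip_unique'[OF a _ _ _ that])
      show "continuous_on (strip a) (\<lambda>z. S (z + 1) (of_real m) - ee (- (of_nat N * of_real m / 2)) * S z (of_real m))"
        by (intro continuous_intros continuous_on_compose2[OF Scz] Scz) (auto simp: shift)
      have "((\<lambda>z. S z (of_real m)) \<circ> (\<lambda>z. z + 1)) holomorphic_on interior (strip a)"
        by (rule holomorphic_on_compose_gen[OF _ Sh]) (auto intro!: holomorphic_intros simp: shifti)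
      thus "(\<lambda>z. S (z + 1) (of_real m) - ee (- (of_nat N * of_real m / 2)) * S z (of_real m)) holomorphic_on interior (strip a)"
        by (intro holomorphic_intros Sh) (simp add: o_def)
      show "S (of_real x + 1) (of_real m) - ee (- (of_nat N * of_real m / 2)) * S (of_real x) (of_real m) = 0" for x
        using Sr[of x m] Sr[of "x + 1" m] smooth_sections_quasi_periodic(1)[OF t, of x m] by simp
    qed
    thus ?thesis by simp
  qed
  have norm1: "norm (k (z + 1) m) = norm (k z m)" if "z \<in> strip a" for z m
  proof -
    have "norm (ee (- (of_nat N * of_real m * (z + 1) / 2))) = norm (ee (- (of_nat N * of_real m * z / 2)))"
      by (simp add: norm_ee algebra_simps)
    moreover have "norm (ee (- (of_nat N * complex_of_real m / 2))) = 1" by (rule norm_ee_Im0) simp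
    ultimately show ?thesis unfolding k_def Sper[OF that] norm_mult by simp
  qed
  have normr: "norm (k (z + of_int r) m) = norm (k z m)" if "z \<in> strip a" for z r m
  proof (induction r rule: int_induct[where k = 0])
    case (step1 i)
    thus ?case using norm1[of "z + of_int i" m] that strip_real_translate[of z "of_int i" a] by (simp add: add_ac)
  next
    case (step2 i)
    thus ?case using norm1[of "z + of_int (i - 1)" m] that strip_real_translate[of z "of_int (i - 1)" a] by (simp add: add_ac)
  qed simp
  define Q where "Q = cbox (Complex 0 0) (Complex 1 (Im a))"
  have Q: "Q \<subseteq> strip a" by (auto simp: Q_def in_cbox_complex_iff strip_Im_pos(1)[OF a])
  have "compact ((\<lambda>(z, m). k z m) ` (Q \<times> {0..1}))"
    by (intro compact_continuous_image continuous_on_subset[OF kc] compact_Times) (use Q in \<open>auto simp: Q_def\<close>)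
  then obtain M where "\<forall>z\<in>Q. \<forall>m\<in>{0..1}. norm (k z m) \<le> M"
    by (auto dest!: compact_imp_bounded simp: bounded_iff)
  hence M: "\<And>z m. z \<in> Q \<Longrightarrow> m \<in> {0..1} \<Longrightarrow> norm (k z m) \<le> M" by blast
  have kM: "norm (k z m) \<le> M" if z: "z \<in> strip a" and m: "m \<in> {0..1}" for z m
  proof -
    define z0 where "z0 = z - of_int \<lfloor>Re z\<rfloor>"
    have "z0 \<in> strip a" using z strip_real_translate[of z0 "of_int \<lfloor>Re z\<rfloor>" a] by (simp add: z0_def)
    hence "norm (k z m) = norm (k z0 m)" using normr[of z0 "\<lfloor>Re z\<rfloor>" m] by (simp add: z0_def)
    also have "z0 \<in> Q"
      using z frac_lt_1[of "Re z"] frac_ge_0[of "Re z"]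
      by (simp add: Q_def in_cbox_complex_iff z0_def strip_Im_pos(1)[OF a] frac_def)
    hence "norm (k z0 m) \<le> M" using m by (rule M)
    finally show ?thesis .
  qed
  have "norm (C p z) \<le> sqrt (real N) * M" if z: "z \<in> strip a" for z
  proof -
    have "continuous_on {0..1} (\<lambda>m. case (z, m) of (z, m) \<Rightarrow> k z m)"
      by (rule continuous_on_compose2[OF kc]) (use z in \<open>auto intro!: continuous_intros\<close>)
    hence "norm (integral {0..1} (k z)) \<le> integral {0..1} (\<lambda>m::real. M)"
      by (intro integral_norm_bound_integral kM z) (auto intro!: integrable_continuous_real)
    thus ?thesis using N by (simp add: C norm_mult)
  qed
  thus "bounded (C p ` strip a)" by (auto simp: bounded_iff)
qed

text \<open>Here the shift of \<open>m\<close> is real and the strip in \<open>m\<close> is the real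
  line, so \<open>strip_integral_shift\<close> reduces to translation over a period. It leaves the
  factor \<open>ee (- e p / N)\<close>.\<close>

lemma exp_op_x_type_coeff:
  assumes N: "N > 0" and \<beta>: "Re \<beta> > 0" and t: "t \<in> smooth_sections N"
    and S: "strip_ext2 (\<i> * \<beta> / of_nat N) (- of_int e / of_nat N) t S"
    and s: "\<And>n m. s n m = x_phase N \<beta> e (of_real n) (of_real m) *
         S (of_real n + \<i> * \<beta> / of_nat N) (of_real m - of_int e / of_nat N)"
  shows "section_coeff N (s n) p (of_real n) = ee (- (of_int e * of_int p / of_nat N)) *
     section_coeff N (\<lambda>m. S (of_real n + \<i> * \<beta> / of_nat N) (of_real m)) p (of_real n + \<i> * \<beta> / of_nat N)"
proof -
  let ?a = "\<i> * \<beta> / of_nat N" and ?c = "- of_int e / of_nat N :: complex"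
  define z where "z = of_real n + ?a"
  have Im_a: "Im ?a > 0" unfolding Im_i_beta using N \<beta> by simp
  have Im_c: "Im ?c = 0" by simp
  have zs: "z \<in> strip ?a" unfolding z_def strip_Im_pos(1)[OF Im_a] using Im_a by simp
  have Sr: "S (of_real n) (of_real m) = t n m" for n m using S by (simp add: strip_ext2_def)
  have Scz: "continuous_on (strip ?a) (\<lambda>z. S z (of_real m))" for m
  proof -
    have "continuous_on (strip ?a \<times> strip ?c) (\<lambda>(z, w). S z w)" using S by (simp add: strip_ext2_def)
    from continuous_on_compose2[OF this, of "strip ?a" "\<lambda>z. (z, of_real m)"] show ?thesis
      by (simp add: image_subset_iff continuous_on_Pair)
  qed
  have Sh: "(\<lambda>z. S z (of_real m)) holomorphic_on interior (strip ?a)" for m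
    using S of_real_in_strip unfolding strip_ext2_def by blast
  have Sc: "continuous_on (strip ?c) (\<lambda>w. S z w)"
  proof -
    have "continuous_on (strip ?a \<times> strip ?c) (\<lambda>(z, w). S z w)" using S by (simp add: strip_ext2_def)
    from continuous_on_compose2[OF this, of "strip ?c" "\<lambda>w. (z, w)"] show ?thesis
      using zs by (simp add: image_subset_iff continuous_on_Pair)
  qed
  \<comment> \<open>The relation is known for real first argument and is carried to \<open>z\<close>
    by uniqueness in the first variable, with \<open>m\<close> fixed.\<close>
  have Sper: "S z (of_real m + 1) = ee (of_nat N * z / 2) * S z (of_real m)" for m
  proof -
    have "S z (of_real (m + 1)) - ee (of_nat N * z / 2) * S z (of_real m) = 0"
    proof (rule strip_unique'[OF Im_a _ _ _ zs])
      show "continuous_on (strip ?a) (\<lambda>z. S z (of_real (m + 1)) - ee (of_nat N * z / 2) * S z (of_real m))"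
        by (intro continuous_intros Scz) simp
      show "(\<lambda>z. S z (of_real (m + 1)) - ee (of_nat N * z / 2) * S z (of_real m)) holomorphic_on interior (strip ?a)"
        by (intro holomorphic_intros Sh) simp
      show "S (of_real x) (of_real (m + 1)) - ee (of_nat N * of_real x / 2) * S (of_real x) (of_real m) = 0" for x
        unfolding Sr smooth_sections_quasi_periodic(2)[OF t, of x m] by simp
    qed
    thus ?thesis by simp
  qed
  define H where "H w = ee (- (of_nat N * w * z / 2)) * S z w * ee (- (of_int p * w))" for w
  have Hint: "integral {0..1} (\<lambda>m. H (of_real m + ?c)) = integral {0..1} (\<lambda>m. H (of_real m))"
  proof (rule strip_integral_shift[of ?c])
    show "continuous_on (strip ?c) H" unfolding H_def by (intro continuous_intros Sc) simp
    show "H holomorphic_on interior (strip ?c)" unfolding strip_Im_0(2)[OF Im_c] by (simp add: holomorphic_on_def)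
    show "?c \<in> strip ?c" unfolding strip_Im_0(1)[OF Im_c] by simp
    fix w assume "w \<in> strip ?c"
    then obtain m where w: "w = of_real m"
      unfolding strip_Im_0(1)[OF Im_c] by (metis complex_is_Real_iff Reals_cases mem_Collect_eq)
    have "ee (- (of_nat N * (w + 1) * z / 2)) * ee (of_nat N * z / 2) = ee (- (of_nat N * w * z / 2))"
      unfolding ee_add[symmetric] by (intro arg_cong[where f = ee]) (simp add: field_simps)
    moreover have "- (of_int p * (w + 1)) = - (of_int p * w) + of_int (- p)" by (simp add: algebra_simps)
    hence "ee (- (of_int p * (w + 1))) = ee (- (of_int p * w))" by (simp only: ee_add ee_of_int mult_1_right)
    ultimately show "H (w + 1) = H w"
      unfolding H_def w Sper by (metis mult.assoc)
  qed
  have "ee (- (of_nat N * of_real m * of_real n / 2)) * s n m * ee (- (of_int p * of_real m)) =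
     ee (- (of_int e * of_int p / of_nat N)) * H (of_real m + ?c)" for m
  proof -
    have E: "ee (- (of_nat N * of_real m * of_real n / 2)) * x_phase N \<beta> e (of_real n) (of_real m) * ee (- (of_int p * of_real m)) =
      ee (- (of_int e * of_int p / of_nat N)) * ee (- (of_nat N * (of_real m + ?c) * z / 2)) * ee (- (of_int p * (of_real m + ?c)))"
      unfolding ee_add[symmetric] z_def using N by (intro arg_cong[where f = ee]) (simp add: field_simps)
    have "a * (b * X) * c = a' * (b' * X * c')" if "a * b * c = a' * b' * c'" for a b c a' b' c' X :: complex
      using arg_cong[OF that, of "\<lambda>u. u * X"] by (simp only: mult_ac)
    from this[OF E] show ?thesis unfolding s H_def z_def[symmetric] by simp
  qed
  hence "integral {0..1} (\<lambda>m. ee (- (of_nat N * of_real m * of_real n / 2)) * s n m * ee (- (of_int p * of_real m))) =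
    ee (- (of_int e * of_int p / of_nat N)) * integral {0..1} (\<lambda>m. H (of_real m))"
    by (simp only: integral_mult_right Hint)
  thus ?thesis
    unfolding section_coeff_def z_def[symmetric] H_def by simp
qed

lemma strip_minus_fraction:
  "z - of_int p / of_nat N \<in> strip a \<longleftrightarrow> z \<in> strip a"
  "Im a > 0 \<Longrightarrow> z - of_int p / of_nat N \<in> interior (strip a) \<longleftrightarrow> z \<in> interior (strip a)"
  by (simp add: strip_def) (simp add: strip_Im_pos(2))

lemma zinv_strip:
  assumes a: "Im a > 0" and C: "\<And>p. continuous_on (strip a) (C p)" "\<And>p. C p holomorphic_on interior (strip a)" "\<And>p. bounded (C p ` strip a)"
  shows "continuous_on (strip a) (\<lambda>z. zinv N C z l)" "(\<lambda>z. zinv N C z l) holomorphic_on interior (strip a)"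
    "bounded ((\<lambda>z. zinv N C z l) ` strip a)"
proof -
  have "continuous_on (strip a) (\<lambda>z. C p (z - of_int p / of_nat N))" for p
    by (intro continuous_on_compose2[OF C(1)] continuous_intros) (auto simp: strip_minus_fraction)
  thus "continuous_on (strip a) (\<lambda>z. zinv N C z l)"
    unfolding zinv_def divide_inverse[of "sum _ _"] by (intro continuous_intros)
  have "(C p \<circ> (\<lambda>z. z - of_int p / of_nat N)) holomorphic_on interior (strip a)" for p
    by (rule holomorphic_on_compose_gen[OF _ C(2)]) (auto intro!: holomorphic_intros simp: strip_minus_fraction(2)[OF a])
  thus "(\<lambda>z. zinv N C z l) holomorphic_on interior (strip a)"
    unfolding zinv_def divide_inverse[of "sum _ _"] o_def by (intro holomorphic_intros)
  obtain M where M: "\<And>p z. z \<in> strip a \<Longrightarrow> norm (C p z) \<le> M p"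
    using C(3) unfolding bounded_iff by (metis image_eqI)
  have "norm (zinv N C z l) \<le> (\<Sum>p\<in>{0..<int N}. M p) / real N" if z: "z \<in> strip a" for z
  proof -
    have "norm (\<Sum>p\<in>{0..<int N}. C p (z - of_int p / of_nat N) * ee (- (of_int l * of_int p / of_nat N))) \<le> (\<Sum>p\<in>{0..<int N}. M p)"
    proof (rule sum_norm_le)
      fix p
      have "norm (ee (- (of_int l * of_int p / of_nat N))) = 1" by (rule norm_ee_Im0) simp
      thus "norm (C p (z - of_int p / of_nat N) * ee (- (of_int l * of_int p / of_nat N))) \<le> M p"
        using M[of "z - of_int p / of_nat N" p] z by (simp add: norm_mult strip_minus_fraction)
    qed
    thus ?thesis by (simp add: zinv_def norm_divide divide_right_mono)
  qed
  thus "bounded ((\<lambda>z. zinv N C z l) ` strip a)" by (auto simp: bounded_iff)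
qed

lemma zak_conjugates_shift:
  assumes N: "N > 0" and \<beta>: "Re \<beta> > 0"
  shows "(zak_op N)\<inverse> O shift_op N (- (\<i> * \<beta> / of_nat N)) (- e) O zak_op N = (exp_op N (x_type N \<beta> e))\<inverse>"
proof -
  let ?a = "\<i> * \<beta> / of_nat N" and ?c = "- of_int e / of_nat N :: complex"
  have Im_a: "Im ?a > 0" unfolding Im_i_beta using N \<beta> by simp
  have Im_c: "Im ?c = 0" by simp
  have "(s, t) \<in> (zak_op N)\<inverse> O shift_op N (- ?a) (- e) O zak_op N \<longleftrightarrow> (t, s) \<in> exp_op N (x_type N \<beta> e)" (is "?L \<longleftrightarrow> ?R") for s t
  proof
    assume ?L
    then obtain f g F where fg: "f \<in> Schwartz_AN N" "g \<in> Schwartz_AN N" "s = zak N f" "t = zak N g"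
      and F: "\<And>l. strip_ext (- ?a) (\<lambda>x. f x l) (F l)" "\<And>x l. g x l = F (l - e) (of_real x - ?a)"
      by (auto simp: zak_op_def shift_op_def)
    obtain G where G: "\<And>z l. G z (l + int N) = G z l" "\<And>x l. f x l = G (of_real x + ?a) (l + e)"
      "strip_ext2 ?a ?c (zak N g) (zak_ext N G)"
      using zak_shift_strip_ext[OF N Im_a Im_c fg(1,2) F] by blast
    show ?R
      unfolding exp_op_x_type fg(3,4)
      using zak_smooth_section[OF fg(1) N] zak_smooth_section[OF fg(2) N] zak_shift[where G = G and \<beta> = \<beta> and e = e, OF N G(1,2)] G(3) by blast
  next
    assume ?R
    then obtain S where ts: "t \<in> smooth_sections N" "s \<in> smooth_sections N" and
      S: "strip_ext2 ?a ?c t S" and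
      eq: "\<And>n m. s n m = x_phase N \<beta> e (of_real n) (of_real m) *
         S (of_real n + ?a) (of_real m - of_int e / of_nat N)"
      unfolding exp_op_x_type by blast
    obtain g where g: "g \<in> Schwartz_AN N" "t = zak N g" using zak_surj[OF ts(1) N] by blast
    obtain f where f: "f \<in> Schwartz_AN N" "s = zak N f" using zak_surj[OF ts(2) N] by blast
    define C where "C = (\<lambda>p z. section_coeff N (\<lambda>m. S z (of_real m)) p z)"
    have C': "continuous_on (strip ?a) (C p)" "C p holomorphic_on interior (strip ?a)" "bounded (C p ` strip ?a)" for p
      unfolding C_def by (fact section_coeff_strip[OF N Im_a ts(1) S])+
    \<comment> \<open>The coefficients of the continued section continue those of \<open>g\<close>,
      so finite inversion yields a bounded continuation of \<open>g\<close> to the upper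
      strip.\<close>
    define G where "G = zinv N C"
    have Greg: "continuous_on (strip ?a) (\<lambda>z. G z l)" "(\<lambda>z. G z l) holomorphic_on interior (strip ?a)"
      "bounded ((\<lambda>z. G z l) ` strip ?a)" for l
      unfolding G_def by (intro zinv_strip[OF Im_a] C')+
    have Gg: "G (of_real x) l = g x l" for x l
    proof -
      have "C p (of_real x - of_int p / of_nat N) = zc N g p (x - of_int p / of_nat N)" for p
      proof -
        have "C p (of_real (x - of_int p / real N)) = section_coeff N (t (x - of_int p / real N)) p (of_real (x - of_int p / real N))"
          using S by (simp add: C_def strip_ext2_def section_coeff_def del: of_real_diff of_real_divide)
        also have "\<dots> = zc N g p (x - of_int p / real N)" unfolding g(2) by (rule section_coeff_zak[OF g(1) N])
        finally show ?thesis by simp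
      qed
      hence "G (of_real x) l = zinv N (zc N g) x l" by (simp add: G_def zinv_def)
      also have "\<dots> = g x l" by (rule zinv_zc[of N g x, OF N periodic_AN_AN[OF g(1)]])
      finally show ?thesis .
    qed
    have fG: "f x l = G (of_real x + ?a) (l + e)" for x l
    proof -
      have zcf: "zc N f p (x - of_int p / of_nat N) * ee (- (of_int l * of_int p / of_nat N)) =
         C p (of_real x + ?a - of_int p / of_nat N) * ee (- (of_int (l + e) * of_int p / of_nat N))" for p
      proof -
        have "zc N f p (x - of_int p / real N) = section_coeff N (s (x - of_int p / real N)) p (of_real (x - of_int p / real N))"
          unfolding f(2) by (rule section_coeff_zak[OF f(1) N, symmetric])
        also have "\<dots> = ee (- (of_int e * of_int p / of_nat N)) * C p (of_real (x - of_int p / real N) + ?a)"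
          unfolding C_def by (rule exp_op_x_type_coeff[OF N \<beta> ts(1) S eq])
        also have "of_real (x - of_int p / real N) + ?a = of_real x + ?a - of_int p / of_nat N" by simp
        finally have 1: "zc N f p (x - of_int p / real N) = ee (- (of_int e * of_int p / of_nat N)) * C p (of_real x + ?a - of_int p / of_nat N)" .
        have 2: "ee (- (of_int (l + e) * of_int p / of_nat N)) = ee (- (of_int e * of_int p / of_nat N)) * ee (- (of_int l * of_int p / of_nat N))"
          unfolding ee_add[symmetric] by (intro arg_cong[where f = ee]) (simp add: algebra_simps add_divide_distrib)
        show ?thesis unfolding 1 2 by (simp only: mult_ac)
      qed
      have "f x l = zinv N (zc N f) x l" by (rule zinv_zc[of N f x, OF N periodic_AN_AN[OF f(1)], symmetric])
      also have "\<dots> = G (of_real x + ?a) (l + e)" unfolding G_def zinv_def zcf ..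
      finally show ?thesis .
    qed
    \<comment> \<open>Moved down by \<open>a\<close>, \<open>G\<close> is the continuation of
      \<open>f\<close> that \<open>shift_op\<close> demands.\<close>
    define F where "F l z = G (z + ?a) (l + e)" for l z
    have "strip_ext (- ?a) (\<lambda>x. f x l) (F l)" for l
      unfolding strip_ext_def
    proof (intro conjI allI)
      show "F l (of_real x) = f x l" for x by (simp add: F_def fG)
      show "continuous_on (strip (- ?a)) (F l)"
        unfolding F_def
        by (rule continuous_on_compose2[OF Greg(1)[of "l + e"]]) (auto simp: strip_uminus intro!: continuous_intros)
      have "((\<lambda>z. G z (l + e)) \<circ> (\<lambda>z. z + ?a)) holomorphic_on interior (strip (- ?a))"
        by (rule holomorphic_on_compose_gen[OF _ Greg(2)]) (auto intro!: holomorphic_intros simp: strip_uminus)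
      thus "F l holomorphic_on interior (strip (- ?a))" unfolding F_def[abs_def] o_def .
      have "F l ` strip (- ?a) \<subseteq> (\<lambda>z. G z (l + e)) ` strip ?a" by (auto simp: F_def strip_uminus)
      thus "bounded (F l ` strip (- ?a))" using Greg(3) bounded_subset by blast
    qed
    moreover have "g x l = F (l + (- e)) (of_real x + (- ?a))" for x l by (simp add: F_def Gg)
    ultimately have "(f, g) \<in> shift_op N (- ?a) (- e)"
      unfolding shift_op_def using f(1) g(1) by blast
    thus ?L using f g by (auto simp: zak_op_def)
  qed
  thus ?thesis by auto
qed

section \<open>Density of the domains\<close>

text \<open>These entire functions are closed under complex translation and under multiplication by
  exponentials, so all four operators preserve them. With imaginary \<open>\<mu>\<close> they
  include a Gaussian times a trigonometric polynomial.\<close>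

inductive gauss_span :: "(complex \<Rightarrow> complex) \<Rightarrow> bool" where
  gauss_span_exp: "gauss_span (\<lambda>z. exp (- z\<^sup>2 + \<mu> * z))"
| gauss_span_scale: "gauss_span f \<Longrightarrow> gauss_span (\<lambda>z. c * f z)"
| gauss_span_add: "gauss_span f \<Longrightarrow> gauss_span g \<Longrightarrow> gauss_span (\<lambda>z. f z + g z)"

lemma gauss_span_translate: "gauss_span f \<Longrightarrow> gauss_span (\<lambda>z. f (z + a))"
proof (induction rule: gauss_span.induct)
  case (gauss_span_exp \<mu>)
  have "(\<lambda>z. exp (- (z + a)\<^sup>2 + \<mu> * (z + a))) = (\<lambda>z. exp (\<mu> * a - a\<^sup>2) * exp (- z\<^sup>2 + (\<mu> - 2 * a) * z))"
    by (intro ext) (simp add: power2_eq_square algebra_simps flip: exp_add)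
  thus ?case by (simp only:) (intro gauss_span.intros)
qed (auto intro: gauss_span.intros)

lemma gauss_span_exp_mult: "gauss_span f \<Longrightarrow> gauss_span (\<lambda>z. exp (\<nu> * z) * f z)"
proof (induction rule: gauss_span.induct)
  case (gauss_span_exp \<mu>)
  have "(\<lambda>z. exp (\<nu> * z) * exp (- z\<^sup>2 + \<mu> * z)) = (\<lambda>z. exp (- z\<^sup>2 + (\<mu> + \<nu>) * z))"
    by (intro ext) (simp add: algebra_simps flip: exp_add)
  thus ?case by (simp only:) (intro gauss_span.intros)
next
  case (gauss_span_scale f c)
  from gauss_span.gauss_span_scale[OF this(2), of c] show ?case by (simp only: mult_ac)
next
  case (gauss_span_add f g)
  from gauss_span.gauss_span_add[OF this(3,4)] show ?case by (simp only: distrib_left)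
qed

lemma gauss_span_holomorphic: "gauss_span f \<Longrightarrow> f holomorphic_on A"
  by (induction rule: gauss_span.induct) (auto intro!: holomorphic_intros)

text \<open>The real part of the exponent contains - (Re z)^2 + Re \<mu> Re z, which is bounded
  above by completing the square; the remaining terms involve only Im z.\<close>

lemma gauss_span_bounded_strip:
  assumes "gauss_span f"
  shows "bounded (f ` strip a)"
proof -
  define b where "b = \<bar>Im a\<bar>"
  have "\<exists>M. \<forall>z. \<bar>Im z\<bar> \<le> b \<longrightarrow> norm (f z) \<le> M"
    using assms
  proof induction
    case (gauss_span_exp \<mu>)
    have "norm (exp (- z\<^sup>2 + \<mu> * z)) \<le> exp (b\<^sup>2 + \<bar>Im \<mu>\<bar> * b + (Re \<mu>)\<^sup>2)" if z: "\<bar>Im z\<bar> \<le> b" for z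
    proof -
      have "Re (- z\<^sup>2 + \<mu> * z) = (Im z)\<^sup>2 - (Re z)\<^sup>2 + Re \<mu> * Re z - Im \<mu> * Im z"
        by (simp add: power2_eq_square)
      moreover have "(Im z)\<^sup>2 \<le> b\<^sup>2" using z by (metis abs_ge_zero power2_abs power_mono)
      moreover have "- (Im \<mu> * Im z) \<le> \<bar>Im \<mu>\<bar> * b"
        using mult_left_mono[OF z abs_ge_zero[of "Im \<mu>"]] abs_ge_minus_self[of "Im \<mu> * Im z"] by (simp add: abs_mult)
      moreover have "Re \<mu> * Re z \<le> (Re z)\<^sup>2 + (Re \<mu>)\<^sup>2"
      proof -
        have "2 * (Re \<mu> * Re z) \<le> (Re z)\<^sup>2 + (Re \<mu>)\<^sup>2"
          using zero_le_power2[of "Re z - Re \<mu>"] by (simp add: power2_diff mult_ac)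
        thus ?thesis using zero_le_power2[of "Re z"] zero_le_power2[of "Re \<mu>"] by linarith
      qed
      ultimately show ?thesis by simp
    qed
    thus ?case by blast
  next
    case (gauss_span_scale f c)
    then obtain M where "\<And>z. \<bar>Im z\<bar> \<le> b \<Longrightarrow> norm (f z) \<le> M" by blast
    hence "norm (c * f z) \<le> norm c * M" if "\<bar>Im z\<bar> \<le> b" for z
      using that by (simp add: norm_mult mult_left_mono)
    thus ?case by blast
  next
    case (gauss_span_add f g)
    then obtain M M' where "\<And>z. \<bar>Im z\<bar> \<le> b \<Longrightarrow> norm (f z) \<le> M" "\<And>z. \<bar>Im z\<bar> \<le> b \<Longrightarrow> norm (g z) \<le> M'" by blast
    hence "norm (f z + g z) \<le> M + M'" if "\<bar>Im z\<bar> \<le> b" for z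
      using that by (intro order_trans[OF norm_triangle_ineq] add_mono)
    thus ?case by blast
  qed
  then obtain M where M: "\<And>z. \<bar>Im z\<bar> \<le> b \<Longrightarrow> norm (f z) \<le> M" by blast
  have "\<bar>Im z\<bar> \<le> b" if "z \<in> strip a" for z
    using that by (auto simp: strip_def b_def closed_segment_eq_real_ivl split: if_splits)
  with M show ?thesis unfolding bounded_iff by blast
qed

lemma exp_minus_square_le:
  fixes x :: real
  shows "exp (- x\<^sup>2) \<le> 1 / (1 + x\<^sup>2)"
proof -
  have "1 + x\<^sup>2 \<le> exp (x\<^sup>2)" by (rule exp_ge_add_one_self)
  moreover have "1 + x\<^sup>2 > 0" by (simp add: add_pos_nonneg)
  ultimately show ?thesis by (simp add: exp_minus field_simps)
qed

text \<open>For fixed \<mu> the polynomial multiples of one Gaussian are closed under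
  differentiation, which supplies the jet in \<open>schwartz\<close>.\<close>

inductive gauss_mult :: "complex \<Rightarrow> (real \<Rightarrow> complex) \<Rightarrow> bool" for \<mu> where
  gauss_mult_base: "gauss_mult \<mu> (\<lambda>x. exp (- (of_real x)\<^sup>2 + \<mu> * of_real x))"
| gauss_mult_x: "gauss_mult \<mu> f \<Longrightarrow> gauss_mult \<mu> (\<lambda>x. of_real x * f x)"
| gauss_mult_scale: "gauss_mult \<mu> f \<Longrightarrow> gauss_mult \<mu> (\<lambda>x. c * f x)"
| gauss_mult_add: "gauss_mult \<mu> f \<Longrightarrow> gauss_mult \<mu> g \<Longrightarrow> gauss_mult \<mu> (\<lambda>x. f x + g x)"

lemma rapid_gauss: "rapid (\<lambda>x. exp (- (of_real x)\<^sup>2 + \<mu> * of_real x))"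
  unfolding rapid_def
proof
  fix K
  \<comment> \<open>One term of the exponential series gives (1 + t)^K \<le> K! exp (1 + t); its
    \<open>t\<close> accounts for the 1 in \<open>c\<close>, and completing the square in c t - t^2
    gives the bound.\<close>
  define c where "c = 1 + \<bar>Re \<mu>\<bar>"
  have "(1 + \<bar>y\<bar>) ^ K * norm (exp (- (complex_of_real y)\<^sup>2 + \<mu> * of_real y)) \<le> fact K * exp (1 + c\<^sup>2)" for y
  proof -
    define t where "t = \<bar>y\<bar>"
    have "(1 + t) ^ K / fact K \<le> exp (1 + t)"
    proof -
      have s: "(\<lambda>n. (1 + t) ^ n /\<^sub>R fact n) sums exp (1 + t)" by (rule exp_converges)
      have "(\<Sum>n\<in>{K}. (1 + t) ^ n /\<^sub>R fact n) \<le> (\<Sum>n. (1 + t) ^ n /\<^sub>R fact n)"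
        by (intro sum_le_suminf sums_summable[OF s]) (auto simp: t_def)
      thus ?thesis using sums_unique[OF s] by (simp add: divide_inverse mult.commute)
    qed
    hence 1: "(1 + t) ^ K \<le> fact K * exp (1 + t)" by (simp add: field_simps)
    have "Re (- (complex_of_real y)\<^sup>2 + \<mu> * of_real y) = - t\<^sup>2 + Re \<mu> * y" by (simp add: t_def power2_eq_square)
    also have "Re \<mu> * y \<le> \<bar>Re \<mu>\<bar> * t" unfolding t_def by (metis abs_ge_self abs_mult)
    finally have 2: "norm (exp (- (complex_of_real y)\<^sup>2 + \<mu> * of_real y)) \<le> exp (- t\<^sup>2 + \<bar>Re \<mu>\<bar> * t)" by simp
    have "(1 + t) ^ K * norm (exp (- (complex_of_real y)\<^sup>2 + \<mu> * of_real y)) \<le> fact K * exp (1 + t) * exp (- t\<^sup>2 + \<bar>Re \<mu>\<bar> * t)"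
      by (intro mult_mono 1 2) auto
    also have "\<dots> = fact K * exp (1 + c * t - t\<^sup>2)" by (simp add: c_def algebra_simps flip: exp_add)
    also have "1 + c * t - t\<^sup>2 \<le> 1 + c\<^sup>2"
    proof -
      have "2 * (c * t) \<le> t\<^sup>2 + c\<^sup>2" using zero_le_power2[of "t - c"] by (simp add: power2_diff mult_ac)
      thus ?thesis using zero_le_power2[of c] zero_le_power2[of t] by linarith
    qed
    hence "fact K * exp (1 + c * t - t\<^sup>2) \<le> fact K * exp (1 + c\<^sup>2)" by simp
    finally show ?thesis by (simp add: t_def)
  qed
  thus "\<exists>C. \<forall>y. (1 + \<bar>y\<bar>) ^ K * norm (exp (- (complex_of_real y)\<^sup>2 + \<mu> * of_real y)) \<le> C" by blast
qed

lemma rapid_gauss_mult: "gauss_mult \<mu> f \<Longrightarrow> rapid f"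
proof (induction rule: gauss_mult.induct)
  case gauss_mult_base
  show ?case by (rule rapid_gauss)
next
  case (gauss_mult_x f)
  show ?case
    unfolding rapid_def
  proof
    fix K
    obtain C where C: "\<And>y. (1 + \<bar>y\<bar>) ^ Suc K * norm (f y) \<le> C" using gauss_mult_x(2) unfolding rapid_def by blast
    have "(1 + \<bar>y\<bar>) ^ K * norm (of_real y * f y) \<le> C" for y
    proof -
      have "(1 + \<bar>y\<bar>) ^ K * norm (of_real y * f y) = \<bar>y\<bar> * ((1 + \<bar>y\<bar>) ^ K * norm (f y))" by (simp add: norm_mult)
      also have "\<dots> \<le> (1 + \<bar>y\<bar>) * ((1 + \<bar>y\<bar>) ^ K * norm (f y))" by (intro mult_right_mono) auto
      also have "\<dots> \<le> C" using C[of y] by (simp add: mult.assoc)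
      finally show ?thesis .
    qed
    thus "\<exists>C. \<forall>y. (1 + \<bar>y\<bar>) ^ K * norm (of_real y * f y) \<le> C" by blast
  qed
qed (auto intro: rapid_gauss rapid_add rapid_mult_bounded)

lemma gauss_mult_deriv:
  "gauss_mult \<mu> f \<Longrightarrow> \<exists>f'. gauss_mult \<mu> f' \<and> (\<forall>x. (f has_vector_derivative f' x) (at x))"
proof (induction rule: gauss_mult.induct)
  case gauss_mult_base
  let ?E = "\<lambda>x::real. exp (- (of_real x)\<^sup>2 + \<mu> * of_real x)"
  have "(?E has_vector_derivative (\<mu> * ?E x + (- 2) * (of_real x * ?E x))) (at x)" for x
  proof -
    have "((\<lambda>z. exp (- z\<^sup>2 + \<mu> * z)) has_field_derivative (\<mu> * ?E x + (- 2) * (of_real x * ?E x))) (at (of_real x))"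
      by (auto intro!: derivative_eq_intros simp: algebra_simps)
    thus ?thesis by (rule has_vector_derivative_real_field)
  qed
  moreover have "gauss_mult \<mu> (\<lambda>x. \<mu> * ?E x + (- 2) * (of_real x * ?E x))" by (intro gauss_mult.intros)
  ultimately show ?case by blast
next
  case (gauss_mult_x f)
  then obtain f' where f': "gauss_mult \<mu> f'" "\<And>x. (f has_vector_derivative f' x) (at x)" by blast
  have i: "((\<lambda>x. complex_of_real x) has_vector_derivative 1) (at x)" for x
    using has_vector_derivative_of_real[OF DERIV_ident] by simp
  have "((\<lambda>x. of_real x * f x) has_vector_derivative of_real x * f' x + 1 * f x) (at x)" for x
    by (rule has_vector_derivative_mult[OF i f'(2)])
  moreover have "gauss_mult \<mu> (\<lambda>x. of_real x * f' x + 1 * f x)" by (intro gauss_mult.intros f' gauss_mult_x)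
  ultimately show ?case by blast
next
  case (gauss_mult_scale f c)
  then obtain f' where f': "gauss_mult \<mu> f'" "\<And>x. (f has_vector_derivative f' x) (at x)" by blast
  thus ?case by (intro exI[of _ "\<lambda>x. c * f' x"]) (auto intro!: gauss_mult.intros has_vector_derivative_mult_right)
next
  case (gauss_mult_add f g)
  then obtain f' g' where "gauss_mult \<mu> f'" "\<And>x. (f has_vector_derivative f' x) (at x)"
    "gauss_mult \<mu> g'" "\<And>x. (g has_vector_derivative g' x) (at x)" by blast
  thus ?case by (intro exI[of _ "\<lambda>x. f' x + g' x"]) (auto intro!: gauss_mult.intros has_vector_derivative_add)
qed

lemma schwartz_gauss_span:
  assumes "gauss_span f" shows "schwartz (\<lambda>x. f (of_real x))"
  using assms
proof induction
  case (gauss_span_exp \<mu>)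
  obtain d where d: "\<And>f. gauss_mult \<mu> f \<Longrightarrow> gauss_mult \<mu> (d f) \<and> (\<forall>x. (f has_vector_derivative d f x) (at x))"
    using gauss_mult_deriv[of \<mu>] by metis
  define D where "D k = (d ^^ k) (\<lambda>x. exp (- (of_real x)\<^sup>2 + \<mu> * of_real x))" for k
  have D: "gauss_mult \<mu> (D k)" for k
  proof (induction k)
    case 0
    show ?case unfolding D_def funpow_0 by (rule gauss_mult_base)
  next
    case (Suc k)
    thus ?case using d by (simp only: D_def funpow.simps o_apply)
  qed
  show ?case
    unfolding schwartz_iff
    by (rule exI[of _ D]) (use d[OF D] rapid_gauss_mult[OF D] in \<open>auto simp: D_def\<close>)
qed (auto intro: schwartz_cmult schwartz_add)

text \<open>On the half line arctan is a bounded primitive; the other half follows by reflection.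
  The halves overlap at 0, so the conclusion is by domination.\<close>

lemma integrable_inverse_one_plus_square: "integrable lborel (\<lambda>x::real. 1 / (1 + x\<^sup>2))"
proof -
  have pos: "1 + x\<^sup>2 > 0" for x :: real by (simp add: add_pos_nonneg)
  define g where "g x = (1 / (1 + x\<^sup>2)) * indicator {0..} x" for x :: real
  have m: "(\<lambda>x::real. 1 / (1 + x\<^sup>2)) \<in> borel_measurable borel" by measurable
  have "(\<integral>\<^sup>+x. ennreal (1 / (1 + x\<^sup>2)) * indicator {0..} x \<partial>lborel) = ennreal (pi / 2 - arctan 0)"
  proof (rule nn_integral_FTC_atLeast[OF m])
    show "DERIV arctan x :> 1 / (1 + x\<^sup>2)" for x :: real
      using DERIV_arctan[of x] by (simp add: divide_inverse)
    show "(arctan \<longlongrightarrow> pi / 2) at_top" by (rule tendsto_arctan_at_top)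
  qed (use pos in \<open>auto simp: less_imp_le\<close>)
  moreover have "ennreal (1 / (1 + x\<^sup>2)) * indicator {0..} x = ennreal (g x)" for x
    by (auto simp: g_def indicator_def)
  ultimately have "(\<integral>\<^sup>+x. ennreal (g x) \<partial>lborel) = ennreal (pi / 2 - arctan 0)" by simp
  hence g: "integrable lborel g"
    by (intro integrableI_nn_integral_finite[where x = "pi / 2 - arctan 0"]) (auto simp: g_def[abs_def] indicator_def)
  have "integrable lborel (\<lambda>x. g (0 + (- 1) * x))"
    by (rule lborel_integrable_real_affine[OF g]) simp
  with g have "integrable lborel (\<lambda>x. g x + g (0 + (- 1) * x))" by (rule Bochner_Integration.integrable_add)
  thus ?thesis
    by (rule Bochner_Integration.integrable_bound) (use pos in \<open>auto simp: g_def indicator_def less_imp_le intro!: AE_I2\<close>)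
qed

section \<open>Approximation in L^2 by Gaussians\<close>

lemma square_add_le:
  fixes a b :: complex
  shows "(norm (a + b))\<^sup>2 \<le> 2 * (norm a)\<^sup>2 + 2 * (norm b)\<^sup>2"
proof -
  have "(norm (a + b))\<^sup>2 \<le> (norm a + norm b)\<^sup>2" by (intro power_mono norm_triangle_ineq) auto
  also have "\<dots> \<le> 2 * (norm a)\<^sup>2 + 2 * (norm b)\<^sup>2"
    using zero_le_power2[of "norm a - norm b"] by (simp add: power2_diff power2_sum)
  finally show ?thesis .
qed

text \<open>Squared distances satisfy a triangle inequality with factor 2 that follows from a
  pointwise estimate.\<close>

definition L2_dist_sq :: "(real \<Rightarrow> complex) \<Rightarrow> (real \<Rightarrow> complex) \<Rightarrow> real" where
  "L2_dist_sq f g = (LINT x|lborel. (norm (f x - g x))\<^sup>2)"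

definition L2_fun :: "(real \<Rightarrow> complex) \<Rightarrow> bool" where
  "L2_fun f \<longleftrightarrow> f \<in> borel_measurable lborel \<and> integrable lborel (\<lambda>x. (norm (f x))\<^sup>2)"

lemma L2_fun_diff:
  assumes "L2_fun f" "L2_fun g" shows "L2_fun (\<lambda>x. f x - g x)"
  unfolding L2_fun_def
proof
  have [measurable]: "f \<in> borel_measurable lborel" "g \<in> borel_measurable lborel" using assms by (auto simp: L2_fun_def)
  show "(\<lambda>x. f x - g x) \<in> borel_measurable lborel" by measurable
  have "integrable lborel (\<lambda>x. 2 * (norm (f x))\<^sup>2 + 2 * (norm (g x))\<^sup>2)"
    using assms by (auto simp: L2_fun_def)
  thus "integrable lborel (\<lambda>x. (norm (f x - g x))\<^sup>2)"
    by (rule Bochner_Integration.integrable_bound) (use square_add_le[of "f _" "- g _"] in \<open>auto intro!: AE_I2\<close>)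
qed

lemma L2_dist_sq_triangle:
  assumes "L2_fun f" "L2_fun g" "L2_fun h"
  shows "L2_dist_sq f h \<le> 2 * L2_dist_sq f g + 2 * L2_dist_sq g h"
proof -
  have i: "integrable lborel (\<lambda>x. (norm (f x - g x))\<^sup>2)" "integrable lborel (\<lambda>x. (norm (g x - h x))\<^sup>2)"
    "integrable lborel (\<lambda>x. (norm (f x - h x))\<^sup>2)"
    using L2_fun_diff assms unfolding L2_fun_def by blast+
  have "(norm (f x - h x))\<^sup>2 \<le> 2 * (norm (f x - g x))\<^sup>2 + 2 * (norm (g x - h x))\<^sup>2" for x
    using square_add_le[of "f x - g x" "g x - h x"] by simp
  hence "L2_dist_sq f h \<le> (LINT x|lborel. 2 * (norm (f x - g x))\<^sup>2 + 2 * (norm (g x - h x))\<^sup>2)"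
    unfolding L2_dist_sq_def
    using i by (intro integral_mono) auto
  also have "\<dots> = 2 * L2_dist_sq f g + 2 * L2_dist_sq g h"
    unfolding L2_dist_sq_def using i by simp
  finally show ?thesis .
qed

lemma L2_fun_continuous_bound:
  assumes "continuous_on UNIV f" "\<And>x. (norm (f x))\<^sup>2 \<le> C * (1 / (1 + x\<^sup>2))"
  shows "L2_fun f"
  unfolding L2_fun_def
proof
  show [measurable]: "f \<in> borel_measurable lborel"
    using borel_measurable_continuous_onI[OF assms(1)] by simp
  show "integrable lborel (\<lambda>x. (norm (f x))\<^sup>2)"
    by (rule Bochner_Integration.integrable_bound[OF integrable_mult_right[OF integrable_inverse_one_plus_square, of C]])
       (use order_trans[OF assms(2) abs_ge_self] in \<open>auto intro!: AE_I2\<close>)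
qed

lemma L2_fun_schwartz:
  assumes "schwartz f" shows "L2_fun f"
proof -
  obtain C where C: "\<And>y. (1 + \<bar>y\<bar>) ^ 1 * norm (f y) \<le> C" using schwartz_rapid[OF assms] unfolding rapid_def by blast
  have "(norm (f x))\<^sup>2 \<le> C\<^sup>2 * (1 / (1 + x\<^sup>2))" for x
  proof -
    have pos: "1 + x\<^sup>2 > 0" by (simp add: add_pos_nonneg)
    have "(1 + x\<^sup>2) * (norm (f x))\<^sup>2 \<le> (1 + \<bar>x\<bar>)\<^sup>2 * (norm (f x))\<^sup>2"
      by (intro mult_right_mono) (auto simp: power2_eq_square algebra_simps abs_mult_self_eq)
    also have "\<dots> = ((1 + \<bar>x\<bar>) ^ 1 * norm (f x))\<^sup>2" by (simp add: power_mult_distrib)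
    also have "\<dots> \<le> C\<^sup>2" by (intro power_mono C) auto
    finally show ?thesis using pos by (simp add: field_simps)
  qed
  thus ?thesis by (intro L2_fun_continuous_bound schwartz_continuous assms)
qed

text \<open>Truncation in argument and in value at once, by dominated convergence with majorant
  |h|^2; a single \<open>R\<close> bounds support and size.\<close>

lemma L2_approx_bounded:
  assumes h: "L2_fun h" and \<epsilon>: "\<epsilon> > 0"
  obtains k and R :: real where "R > 0" "k \<in> borel_measurable lborel" "\<And>x. norm (k x) \<le> R" "\<And>x. \<bar>x\<bar> > R \<Longrightarrow> k x = 0"
    "L2_dist_sq h k < \<epsilon>"
proof -
  have [measurable]: "h \<in> borel_measurable borel" and int: "integrable lborel (\<lambda>x. (norm (h x))\<^sup>2)"
    using h by (auto simp: L2_fun_def)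
  define k where "k n x = (if \<bar>x\<bar> \<le> real (Suc n) \<and> norm (h x) \<le> real (Suc n) then h x else 0)" for n x
  have [measurable]: "k n \<in> borel_measurable borel" for n
    unfolding k_def[abs_def] by measurable
  have "(\<lambda>n. LINT x|lborel. (norm (h x - k n x))\<^sup>2) \<longlonglongrightarrow> (LINT x|(lborel :: real measure). 0 :: real)"
  proof (rule integral_dominated_convergence)
    show "integrable lborel (\<lambda>x. (norm (h x))\<^sup>2)" by (rule int)
    show "AE x in lborel. (\<lambda>n. (norm (h x - k n x))\<^sup>2) \<longlonglongrightarrow> 0"
    proof (rule AE_I2)
      fix x :: real
      obtain m where m: "max \<bar>x\<bar> (norm (h x)) \<le> real m" using real_arch_simple by blast
      have "eventually (\<lambda>n. (norm (h x - k n x))\<^sup>2 = 0) sequentially"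
        using eventually_ge_at_top[of m] by eventually_elim (use m in \<open>auto simp: k_def\<close>)
      thus "(\<lambda>n. (norm (h x - k n x))\<^sup>2) \<longlonglongrightarrow> 0" by (rule tendsto_eventually)
    qed
    show "AE x in lborel. norm ((norm (h x - k n x))\<^sup>2) \<le> (norm (h x))\<^sup>2" for n
      by (rule AE_I2) (auto simp: k_def)
  qed measurable
  hence "eventually (\<lambda>n. L2_dist_sq h (k n) < \<epsilon>) sequentially"
    unfolding L2_dist_sq_def using \<epsilon> by (intro order_tendstoD(2)[of _ 0]) auto
  then obtain n where "L2_dist_sq h (k n) < \<epsilon>" by (auto simp: eventually_sequentially)
  thus ?thesis by (intro that[of "real (Suc n)" "k n"]) (auto simp: k_def)
qed

text \<open>Measurability yields continuous functions that converge almost everywhere, but without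
  domination. The retraction \<open>clip\<close> onto the ball of radius \<open>R\<close> and the
  cutoff \<open>cut\<close> provide it; they leave the limit intact, because |k| \<le> R and
  \<open>k\<close> vanishes for |x| > R.\<close>

lemma L2_approx_continuous:
  assumes R: "R > 0" and k: "k \<in> borel_measurable lborel" "\<And>x. norm (k x) \<le> R" "\<And>x. \<bar>x\<bar> > R \<Longrightarrow> k x = 0" and \<epsilon>: "\<epsilon> > 0"
  obtains g :: "real \<Rightarrow> complex" where "continuous_on UNIV g" "\<And>x. norm (g x) \<le> R" "\<And>x. \<bar>x\<bar> > R + 1 \<Longrightarrow> g x = 0"
    "L2_dist_sq k g < \<epsilon>"
proof -
  have [measurable]: "k \<in> borel_measurable borel" using k(1) by simp
  have "k measurable_on UNIV"
    by (rule lebesgue_measurable_imp_measurable_on) (use k(1) in \<open>auto intro: measurable_completion\<close>)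
  then obtain X g where X: "negligible X" and cg: "\<And>n. continuous_on UNIV (g n)"
    and lim: "\<And>x. x \<notin> X \<Longrightarrow> (\<lambda>n. g n x) \<longlonglongrightarrow> k x"
    unfolding measurable_on_def by auto
  have AE: "AE x in lborel. x \<notin> X"
    using X AE_not_in[of X lebesgue] by (simp add: negligible_iff_null_sets AE_completion_iff)
  define clip where "clip z = z * of_real (R / max R (norm z))" for z :: complex
  define cut where "cut x = max 0 (min 1 (R + 1 - \<bar>x\<bar>))" for x :: real
  have pos: "max R (norm z) > 0" for z :: complex using R by simp
  have ccl: "continuous_on UNIV clip"
    unfolding clip_def using pos by (intro continuous_intros) (auto simp: less_le)
  have ncl: "norm (clip z) \<le> R" for z
  proof -
    have "R / max R (norm z) \<ge> 0" using R by simp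
    hence "norm (clip z) = norm z * R / max R (norm z)"
      by (simp only: clip_def norm_mult norm_of_real abs_of_nonneg times_divide_eq_right)
    also have "\<dots> \<le> max R (norm z) * R / max R (norm z)" using R pos[of z] by (intro divide_right_mono mult_right_mono) auto
    also have "\<dots> = R" using pos[of z] by simp
    finally show ?thesis .
  qed
  have clid: "clip z = z" if "norm z \<le> R" for z using that R by (simp add: clip_def max_def)
  define G where "G n x = of_real (cut x) * clip (g n x)" for n x
  have cG: "continuous_on UNIV (G n)" for n
    unfolding G_def cut_def by (intro continuous_intros continuous_on_compose2[OF ccl cg]) auto
  have nG: "norm (G n x) \<le> R" for n x
  proof -
    have "norm (G n x) \<le> 1 * R"
      unfolding G_def norm_mult by (intro mult_mono ncl) (auto simp: cut_def)
    thus ?thesis by simp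
  qed
  have G0: "G n x = 0" if "\<bar>x\<bar> > R + 1" for n x using that by (simp add: G_def cut_def)
  have [measurable]: "G n \<in> borel_measurable borel" for n
    by (rule borel_measurable_continuous_onI[OF cG])
  have "(\<lambda>n. LINT x|lborel. (norm (k x - G n x))\<^sup>2) \<longlonglongrightarrow> (LINT x|(lborel :: real measure). 0 :: real)"
  proof (rule integral_dominated_convergence)
    show "integrable lborel (\<lambda>x. indicator {-(R+1)..R+1} x * (2 * R)\<^sup>2)"
      by (intro integrable_mult_left integrable_real_indicator) (simp_all add: emeasure_lborel_Icc_eq)
    show "AE x in lborel. (\<lambda>n. (norm (k x - G n x))\<^sup>2) \<longlonglongrightarrow> 0"
      using AE
    proof eventually_elim
      case (elim x)
      have "isCont clip (k x)" using ccl continuous_on_eq_continuous_at by blast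
      hence "(\<lambda>n. clip (g n x)) \<longlonglongrightarrow> clip (k x)"
        using lim[OF elim] by (rule isCont_tendsto_compose)
      hence "(\<lambda>n. (norm (k x - G n x))\<^sup>2) \<longlonglongrightarrow> (norm (k x - of_real (cut x) * clip (k x)))\<^sup>2"
        unfolding G_def by (intro tendsto_intros)
      moreover have "of_real (cut x) * clip (k x) = k x"
      proof (cases "\<bar>x\<bar> \<le> R")
        case True
        hence "cut x = 1" by (simp add: cut_def)
        thus ?thesis using clid[OF k(2)] by simp
      next
        case False
        thus ?thesis using k(3)[of x] by (simp add: clip_def)
      qed
      ultimately show ?case by simp
    qed
    show "AE x in lborel. norm ((norm (k x - G n x))\<^sup>2) \<le> indicator {-(R+1)..R+1} x * (2 * R)\<^sup>2" for n
    proof (rule AE_I2)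
      fix x :: real
      show "norm ((norm (k x - G n x))\<^sup>2) \<le> indicator {-(R+1)..R+1} x * (2 * R)\<^sup>2"
      proof (cases "\<bar>x\<bar> \<le> R + 1")
        case True
        have "norm (k x - G n x) \<le> 2 * R" using norm_triangle_ineq4[of "k x" "G n x"] k(2)[of x] nG[of n x] by simp
        hence "(norm (k x - G n x))\<^sup>2 \<le> (2 * R)\<^sup>2" by (intro power_mono) auto
        thus ?thesis using True by (simp add: indicator_def abs_le_iff)
      next
        case False
        thus ?thesis using G0[of x n] k(3)[of x] by (simp add: indicator_def)
      qed
    qed
  qed measurable
  hence "eventually (\<lambda>n. L2_dist_sq k (G n) < \<epsilon>) sequentially"
    unfolding L2_dist_sq_def using \<epsilon> by (intro order_tendstoD(2)[of _ 0]) auto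
  then obtain n where "L2_dist_sq k (G n) < \<epsilon>" by (auto simp: eventually_sequentially)
  with cG nG G0 show ?thesis by (intro that[of "G n"]) auto
qed

text \<open>The map x / L + 1/2 carries the interval from - L/2 to L/2 onto the unit period.\<close>

lemma gauss_span_trig_poly:
  assumes "trig_poly q"
  shows "\<exists>\<phi>. gauss_span \<phi> \<and> (\<forall>x. \<phi> (of_real x) = exp (- (of_real x)\<^sup>2) * q (x / L + 1 / 2))"
  using assms
proof induction
  case (trig_poly_ee k)
  define \<mu> where "\<mu> = 2 * of_real pi * \<i> * of_int k / of_real L"
  have "ee (of_int k / 2) * exp (- (of_real x)\<^sup>2 + \<mu> * of_real x) = exp (- (of_real x)\<^sup>2) * ee (of_int k * of_real (x / L + 1 / 2))" for x
  proof -
    have "ee (of_int k * of_real (x / L + 1 / 2)) = ee (of_int k / 2) * exp (\<mu> * of_real x)"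
      unfolding ee_def exp_add[symmetric] by (intro arg_cong[where f = exp]) (simp add: \<mu>_def ring_distribs)
    thus ?thesis by (simp only: exp_add mult_ac)
  qed
  moreover have "gauss_span (\<lambda>z. ee (of_int k / 2) * exp (- z\<^sup>2 + \<mu> * z))" by (intro gauss_span.intros)
  ultimately show ?case by blast
next
  case (trig_poly_scale f c)
  then obtain \<phi> where "gauss_span \<phi>" "\<And>x. \<phi> (of_real x) = exp (- (of_real x)\<^sup>2) * f (x / L + 1 / 2)" by blast
  thus ?case by (intro exI[of _ "\<lambda>z. c * \<phi> z"]) (auto intro: gauss_span_scale)
next
  case (trig_poly_add f g)
  then obtain \<phi> \<psi> where "gauss_span \<phi>" "\<And>x. \<phi> (of_real x) = exp (- (of_real x)\<^sup>2) * f (x / L + 1 / 2)"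
    "gauss_span \<psi>" "\<And>x. \<psi> (of_real x) = exp (- (of_real x)\<^sup>2) * g (x / L + 1 / 2)" by blast
  thus ?case by (intro exI[of _ "\<lambda>z. \<phi> z + \<psi> z"]) (auto intro: gauss_span_add simp: distrib_left)
qed

text \<open>The function \<open>g x * exp (x\<^sup>2)\<close> is approximated by a trigonometric polynomial of large period \<open>L\<close>;
  beyond the period interval the polynomial stays bounded and the Gaussian weight makes it negligible.\<close>

lemma L2_approx_gauss_continuous:
  assumes R: "R > 0" and g: "continuous_on UNIV g" "\<And>x. norm (g x) \<le> R" "\<And>x. \<bar>x\<bar> > R \<Longrightarrow> g x = 0" and \<epsilon>: "\<epsilon> > 0"
  obtains \<phi> where "gauss_span \<phi>" "L2_dist_sq g (\<lambda>x. \<phi> (of_real x)) < \<epsilon>"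
proof -
  define J where "J = (LINT x|lborel. 1 / (1 + (x::real)\<^sup>2))"
  have J: "J \<ge> 0" unfolding J_def by (intro integral_nonneg_AE AE_I2) (simp add: add_nonneg_nonneg)
  \<comment> \<open>Ensures 2 \<eta> J < \<epsilon>, where 2 \<eta> / (1 + x^2) will majorise the
    squared error.\<close>
  define \<eta> where "\<eta> = \<epsilon> / (2 * (J + 1))"
  have \<eta>: "\<eta> > 0" using J \<epsilon> by (simp add: \<eta>_def)
  \<comment> \<open>The minimum with 1 yields both \<delta>^2 \<le> \<eta> and the bound V + 1 for
    \<open>q\<close>.\<close>
  define \<delta> where "\<delta> = min 1 \<eta>"
  have \<delta>: "\<delta> > 0" "\<delta> \<le> 1" "\<delta>\<^sup>2 \<le> \<eta>"
  proof -
    show "\<delta> > 0" "\<delta> \<le> 1" using \<eta> by (auto simp: \<delta>_def)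
    hence "\<delta> * \<delta> \<le> 1 * \<delta>" by (intro mult_right_mono) auto
    also have "\<dots> \<le> \<eta>" by (simp add: \<delta>_def)
    finally show "\<delta>\<^sup>2 \<le> \<eta>" by (simp add: power2_eq_square)
  qed
  define v where "v x = g x * of_real (exp (x\<^sup>2))" for x
  define V where "V = R * exp (R\<^sup>2)"
  have V: "norm (v x) \<le> V" for x
  proof (cases "\<bar>x\<bar> \<le> R")
    case True
    hence "x\<^sup>2 \<le> R\<^sup>2" by (metis abs_ge_zero power2_abs power_mono)
    thus ?thesis unfolding v_def V_def norm_mult using R by (intro mult_mono g(2)) auto
  next
    case False
    thus ?thesis using R g(3)[of x] by (simp add: v_def V_def)
  qed
  have V0: "V \<ge> 0" using R by (simp add: V_def)
  \<comment> \<open>Above 2 R, so the support fits strictly inside one period; the last term makes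
    (4 / L) (V + 1)^2 \<le> \<eta> in the tail.\<close>
  define L where "L = 2 * R + 1 + 4 * (V + 1)\<^sup>2 / \<eta>"
  have L: "L > 2 * R" "L \<ge> 1" "4 * (V + 1)\<^sup>2 / \<eta> \<le> L" using R \<eta> by (auto simp: L_def add_pos_nonneg)
  define u where "u y = v (L * (y - 1 / 2))" for y
  have "continuous_on {0..1} u"
    unfolding u_def v_def by (intro continuous_intros continuous_on_compose2[OF g(1)]) auto
  moreover have "u 1 = u 0"
    using g(3)[of "L / 2"] g(3)[of "- L / 2"] L R by (simp add: u_def v_def)
  ultimately obtain q where q: "trig_poly q" "\<And>y. y \<in> {0..1} \<Longrightarrow> norm (u y - q y) < \<delta>"
    using trig_poly_approx_interval[OF _ _ \<delta>(1)] by metis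
  obtain \<phi> where \<phi>: "gauss_span \<phi>" "\<And>x. \<phi> (of_real x) = exp (- (of_real x)\<^sup>2) * q (x / L + 1 / 2)"
    using gauss_span_trig_poly[OF q(1), of L] by blast
  have qV: "norm (q y) \<le> V + 1" for y
  proof -
    have f: "frac y \<in> {0..1}" using frac_lt_1[of y] by (auto simp: less_imp_le)
    have "norm (q y) = norm (q (frac y))" using periodic_frac[of q y] trig_poly_periodic[OF q(1)] by simp
    also have "\<dots> \<le> norm (u (frac y)) + norm (u (frac y) - q (frac y))"
      by (metis norm_minus_commute norm_triangle_sub)
    also have "\<dots> \<le> V + 1" using V[of "L * (frac y - 1 / 2)"] q(2)[OF f] \<delta> by (intro add_mono) (auto simp: u_def)
    finally show ?thesis .
  qed
  have bound: "(norm (g x - \<phi> (of_real x)))\<^sup>2 \<le> (2 * \<eta>) * (1 / (1 + x\<^sup>2))" for x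
  proof -
    define w where "w = norm (v x - q (x / L + 1 / 2))"
    have "g x - \<phi> (of_real x) = of_real (exp (- x\<^sup>2)) * (v x - q (x / L + 1 / 2))"
      unfolding \<phi>(2) v_def by (simp add: exp_of_real[symmetric] right_diff_distrib exp_minus)
    \<comment> \<open>The Gaussian enters the square twice: one factor secures integrability, the
      other controls the tail.\<close>
    hence "(norm (g x - \<phi> (of_real x)))\<^sup>2 = exp (- x\<^sup>2) * (exp (- x\<^sup>2) * w\<^sup>2)"
      by (simp add: w_def norm_mult power_mult_distrib power2_eq_square)
    also have "\<dots> \<le> (1 / (1 + x\<^sup>2)) * (2 * \<eta>)"
    proof (rule mult_mono[OF exp_minus_square_le])
      show "exp (- x\<^sup>2) * w\<^sup>2 \<le> 2 * \<eta>"
      proof (cases "\<bar>x\<bar> \<le> L / 2")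
        case True
        have y: "x / L + 1 / 2 \<in> {0..1}" using True L by (auto simp: field_simps abs_le_iff)
        have "u (x / L + 1 / 2) = v x" using L by (simp add: u_def)
        hence "w \<le> \<delta>" using q(2)[OF y] by (simp add: w_def)
        hence "w\<^sup>2 \<le> \<delta>\<^sup>2" by (intro power_mono) (auto simp: w_def)
        also have "\<dots> \<le> \<eta>" by (rule \<delta>(3))
        finally have "exp (- x\<^sup>2) * w\<^sup>2 \<le> 1 * \<eta>" by (intro mult_mono) auto
        thus ?thesis using \<eta> by simp
      next
        case False
        hence "v x = 0" using g(3)[of x] L by (simp add: v_def)
        hence "w\<^sup>2 \<le> (V + 1)\<^sup>2" using qV by (intro power_mono) (auto simp: w_def)
        moreover have "exp (- x\<^sup>2) \<le> 4 / L"
        proof -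
          have "(L / 2)\<^sup>2 \<le> \<bar>x\<bar>\<^sup>2" using False L by (intro power_mono) auto
          hence "L\<^sup>2 / 4 \<le> x\<^sup>2" by (simp add: power_divide)
          moreover have "L \<le> L\<^sup>2" using L mult_right_mono[of 1 L L] by (simp add: power2_eq_square)
          ultimately have "L / 4 \<le> 1 + x\<^sup>2" by simp
          hence "1 / (1 + x\<^sup>2) \<le> 1 / (L / 4)" using L by (intro divide_left_mono) auto
          thus ?thesis using exp_minus_square_le[of x] by simp
        qed
        ultimately have "exp (- x\<^sup>2) * w\<^sup>2 \<le> 4 / L * (V + 1)\<^sup>2" using L by (intro mult_mono) auto
        also have "\<dots> \<le> \<eta>" using L \<eta> by (simp add: field_simps)
        finally show ?thesis using \<eta> by simp
      qed
    qed (auto simp: add_nonneg_nonneg)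
    finally show ?thesis by (simp add: mult.commute)
  qed
  have "continuous_on UNIV (\<lambda>x. g x - \<phi> (of_real x))"
    by (intro continuous_intros g(1) schwartz_continuous schwartz_gauss_span \<phi>(1))
  from L2_fun_continuous_bound[OF this bound] have int: "integrable lborel (\<lambda>x. (norm (g x - \<phi> (of_real x)))\<^sup>2)"
    by (simp add: L2_fun_def)
  have "L2_dist_sq g (\<lambda>x. \<phi> (of_real x)) \<le> (LINT x|lborel. (2 * \<eta>) * (1 / (1 + x\<^sup>2)))"
    unfolding L2_dist_sq_def
    by (rule integral_mono[OF int integrable_mult_right[OF integrable_inverse_one_plus_square]]) (rule bound)
  also have "\<dots> = 2 * \<eta> * J" unfolding J_def by (rule integral_mult_right_zero)
  also have "\<dots> < \<epsilon>" using J \<epsilon> by (simp add: \<eta>_def field_simps)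
  finally show ?thesis using \<phi>(1) that by blast
qed

lemma L2_approx_gauss:
  assumes h: "L2_fun h" and \<epsilon>: "\<epsilon> > 0"
  obtains \<phi> where "gauss_span \<phi>" "L2_dist_sq h (\<lambda>x. \<phi> (of_real x)) < \<epsilon>"
proof -
  \<comment> \<open>Two uses of the triangle inequality with factor 2 cost 2 + 4 + 4 = 10 sixteenths
    of \<epsilon>.\<close>
  have e: "\<epsilon> / 16 > 0" using \<epsilon> by simp
  obtain k R where k: "R > 0" "k \<in> borel_measurable lborel" "\<And>x. norm (k x) \<le> R" "\<And>x. \<bar>x\<bar> > R \<Longrightarrow> k x = 0"
    "L2_dist_sq h k < \<epsilon> / 16"
    using L2_approx_bounded[OF h e] by metis
  obtain g where g: "continuous_on UNIV g" "\<And>x. norm (g x) \<le> R" "\<And>x. \<bar>x\<bar> > R + 1 \<Longrightarrow> g x = 0"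
    "L2_dist_sq k g < \<epsilon> / 16"
    using L2_approx_continuous[OF k(1-4) e] by metis
  have R1: "R + 1 > 0" "norm (g x) \<le> R + 1" for x using k(1) g(2)[of x] by simp_all
  obtain \<phi> where \<phi>: "gauss_span \<phi>" "L2_dist_sq g (\<lambda>x. \<phi> (of_real x)) < \<epsilon> / 16"
    using L2_approx_gauss_continuous[OF R1(1) g(1) R1(2) g(3) e] by metis
  have bnd: "L2_fun f" if [measurable]: "f \<in> borel_measurable lborel" and f: "\<And>x. norm (f x) \<le> R" "\<And>x. \<bar>x\<bar> > R + 1 \<Longrightarrow> f x = 0" for f
    unfolding L2_fun_def
  proof
    have "integrable lborel (\<lambda>x. indicator {-(R+1)..R+1} x * R\<^sup>2)"
      by (intro integrable_mult_left) (use k(1) in simp)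
    thus "integrable lborel (\<lambda>x. (norm (f x))\<^sup>2)"
    proof (rule Bochner_Integration.integrable_bound)
      show "AE x in lborel. norm ((norm (f x))\<^sup>2) \<le> norm (indicator {-(R+1)..R+1} x * R\<^sup>2)"
      proof (rule AE_I2)
        fix x
        show "norm ((norm (f x))\<^sup>2) \<le> norm (indicator {-(R+1)..R+1} x * R\<^sup>2)"
          using f(1)[of x] f(2)[of x] by (cases "\<bar>x\<bar> \<le> R + 1") (auto simp: indicator_def abs_le_iff intro!: power_mono)
      qed
    qed measurable
  qed (rule that)
  have L: "L2_fun k" "L2_fun g" "L2_fun (\<lambda>x. \<phi> (of_real x))"
    using bnd[of k] bnd[of g] k g borel_measurable_continuous_onI[OF g(1)] L2_fun_schwartz[OF schwartz_gauss_span[OF \<phi>(1)]] by auto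
  have "L2_dist_sq h (\<lambda>x. \<phi> (of_real x)) < \<epsilon>"
    using L2_dist_sq_triangle[OF h L(1,3)] L2_dist_sq_triangle[OF L] k(5) g(4) \<phi>(2) \<epsilon> by linarith
  with \<phi>(1) show ?thesis by (rule that)
qed

section \<open>Density of the domains of the four operators\<close>

text \<open>The residue of \<open>l\<close> selects the Gaussian sum, which builds in periodicity
  and lets every component be chosen independently.\<close>

definition gauss_AN :: "nat \<Rightarrow> (real \<Rightarrow> int \<Rightarrow> complex) set" where
  "gauss_AN N = {f. \<exists>\<phi>. (\<forall>j::int. gauss_span (\<phi> j)) \<and> f = (\<lambda>x l. \<phi> (l mod int N) (of_real x))}"

lemma Schwartz_AN_subset_L2_AN: "Schwartz_AN N \<subseteq> L2_AN N"
  using L2_fun_schwartz by (auto simp: Schwartz_AN_def L2_AN_def L2_fun_def)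

lemma gauss_AN_dense:
  assumes N: "N > 0" and D: "gauss_AN N \<subseteq> D" "D \<subseteq> Schwartz_AN N"
  shows "dense_in_L2_AN N D"
  unfolding dense_in_L2_AN_def
proof (intro conjI ballI allI impI)
  show "D \<subseteq> L2_AN N" using D(2) Schwartz_AN_subset_L2_AN by blast
  fix f and \<epsilon> :: real assume f: "f \<in> L2_AN N" and \<epsilon>: "\<epsilon> > 0"
  \<comment> \<open>\<open>N\<close> summands below \<delta>, scaled by 1 / sqrt N, stay below
    \<epsilon>^2.\<close>
  define \<delta> where "\<delta> = \<epsilon>\<^sup>2 / sqrt (real N)"
  have \<delta>: "\<delta> > 0" using N \<epsilon> by (simp add: \<delta>_def)
  have "\<exists>\<phi>. gauss_span \<phi> \<and> L2_dist_sq (\<lambda>x. f x l) (\<lambda>x. \<phi> (of_real x)) < \<delta>" for l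
  proof -
    have "L2_fun (\<lambda>x. f x l)" using f by (simp add: L2_AN_def L2_fun_def)
    from L2_approx_gauss[OF this \<delta>] show ?thesis by metis
  qed
  then obtain \<phi> where \<phi>: "\<And>l. gauss_span (\<phi> l)" "\<And>l. L2_dist_sq (\<lambda>x. f x l) (\<lambda>x. \<phi> l (of_real x)) < \<delta>" by metis
  define g where "g = (\<lambda>x l. \<phi> (l mod int N) (of_real x :: complex))"
  have "g \<in> gauss_AN N" using \<phi>(1) by (auto simp: gauss_AN_def g_def)
  moreover have "L2_norm_AN N (\<lambda>x l. f x l - g x l) < \<epsilon>"
  proof -
    have "(\<Sum>l\<in>{0..<int N}. LINT x|lborel. (norm (f x l - g x l))\<^sup>2) = (\<Sum>l\<in>{0..<int N}. L2_dist_sq (\<lambda>x. f x l) (\<lambda>x. \<phi> l (of_real x)))"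
      by (intro sum.cong refl) (simp add: L2_dist_sq_def g_def)
    also have "\<dots> < (\<Sum>l\<in>{0..<int N}. \<delta>)" using N by (intro sum_strict_mono \<phi>(2)) auto
    also have "\<dots> = real N * \<delta>" by simp
    also have "\<dots> = sqrt (real N) * \<epsilon>\<^sup>2" using N by (simp add: \<delta>_def field_simps)
    finally have "1 / sqrt (real N) * (\<Sum>l\<in>{0..<int N}. LINT x|lborel. (norm (f x l - g x l))\<^sup>2) < \<epsilon>\<^sup>2"
      using N by (simp add: field_simps)
    hence "L2_norm_AN N (\<lambda>x l. f x l - g x l) < sqrt (\<epsilon>\<^sup>2)" unfolding L2_norm_AN_def by (rule real_sqrt_less_mono)
    thus ?thesis using \<epsilon> by simp
  qed
  ultimately show "\<exists>g\<in>D. L2_norm_AN N (\<lambda>x l. f x l - g x l) < \<epsilon>" using D(1) by blast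
qed

text \<open>The exponential weight only changes the linear term in the exponent of each
  Gaussian.\<close>

lemma mult_op_dense:
  assumes N: "N > 0"
  shows "dense_in_L2_AN N (Domain (mult_op N (exp_weight N \<beta> e)))"
proof (rule gauss_AN_dense[OF N])
  show "gauss_AN N \<subseteq> Domain (mult_op N (exp_weight N \<beta> e))"
  proof
    fix f assume "f \<in> gauss_AN N"
    then obtain \<phi> where \<phi>: "\<And>j. gauss_span (\<phi> j)" "f = (\<lambda>x l. \<phi> (l mod int N) (of_real x))" by (auto simp: gauss_AN_def)
    define g where "g x l = exp (2 * complex_of_real pi * \<beta> * of_real x) * ee (of_int e * of_int l / of_nat N) * f x l" for x l
    have f: "f \<in> Schwartz_AN N"
      using schwartz_gauss_span[OF \<phi>(1)] by (auto simp: Schwartz_AN_def periodic_AN_def \<phi>(2))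
    have "g \<in> Schwartz_AN N"
    proof -
      have "schwartz (\<lambda>x. g x l)" for l
      proof -
        have "(\<lambda>x. g x l) = (\<lambda>x. ee (of_int e * of_int l / of_nat N) * (exp (2 * complex_of_real pi * \<beta> * of_real x) * \<phi> (l mod int N) (of_real x)))"
          by (simp add: g_def \<phi>(2) fun_eq_iff)
        thus ?thesis by (simp only:) (intro schwartz_cmult schwartz_gauss_span gauss_span_exp_mult \<phi>(1))
      qed
      moreover have "g x (l + int N) = g x l" for x l
      proof -
        have "of_int e * of_int (l + int N) / of_nat N = of_int e * of_int l / of_nat N + complex_of_int e"
          using N by (simp add: field_simps)
        thus ?thesis unfolding g_def periodic_AN_AN[OF f] by (simp only: ee_add ee_of_int mult_1_right)
      qed
      ultimately show ?thesis by (simp add: Schwartz_AN_def periodic_AN_def)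
    qed
    with f show "f \<in> Domain (mult_op N (exp_weight N \<beta> e))"
      unfolding Domain_iff by (intro exI[of _ g]) (simp add: mult_op_def g_def)
  qed
qed (auto simp: mult_op_def)

text \<open>A Gaussian sum is entire and bounded on every strip, hence is its own
  continuation.\<close>

lemma shift_op_dense:
  assumes N: "N > 0"
  shows "dense_in_L2_AN N (Domain (shift_op N a j))"
proof (rule gauss_AN_dense[OF N])
  show "gauss_AN N \<subseteq> Domain (shift_op N a j)"
  proof
    fix f assume "f \<in> gauss_AN N"
    then obtain \<phi> where \<phi>: "\<And>j. gauss_span (\<phi> j)" "f = (\<lambda>x l. \<phi> (l mod int N) (of_real x))" by (auto simp: gauss_AN_def)
    define F where "F l = \<phi> (l mod int N)" for l
    define g where "g x l = F (l + j) (of_real x + a)" for x :: real and l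
    have f: "f \<in> Schwartz_AN N"
      using schwartz_gauss_span[OF \<phi>(1)] by (auto simp: Schwartz_AN_def periodic_AN_def \<phi>(2))
    have g: "g \<in> Schwartz_AN N"
    proof -
      have "schwartz (\<lambda>x. g x l)" for l
        unfolding g_def F_def by (rule schwartz_gauss_span[OF gauss_span_translate[OF \<phi>(1)]])
      moreover have "(l + int N + j) mod int N = (l + j) mod int N" for l
        by (metis add.assoc add.commute mod_add_self2)
      ultimately show ?thesis by (simp add: Schwartz_AN_def periodic_AN_def g_def F_def)
    qed
    have "strip_ext a (\<lambda>x. f x l) (F l)" for l
      unfolding strip_ext_def
      using gauss_span_holomorphic[OF \<phi>(1)] gauss_span_bounded_strip[OF \<phi>(1)]
      by (auto simp: F_def \<phi>(2) intro: holomorphic_on_imp_continuous_on)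
    with f g show "f \<in> Domain (shift_op N a j)"
      unfolding Domain_iff shift_op_def g_def by blast
  qed
qed (auto simp: shift_op_def)

theorem proposition5p6:
  fixes N :: nat and b :: complex
  assumes "odd N"
    and "Re b > 0"
    and "cmod b = 1 \<or> b \<in> \<real>"
  shows "(zak_op N)\<inverse> O u_star N b O zak_op N = (y_hat N b)\<inverse> \<and>
         (zak_op N)\<inverse> O v_star N b O zak_op N = (x_hat N b)\<inverse> \<and>
         (zak_op N)\<inverse> O u_hat N b O zak_op N = (y_tilde N b)\<inverse> \<and>
         (zak_op N)\<inverse> O v_hat N b O zak_op N = (x_tilde N b)\<inverse> \<and>
         (\<forall>T\<in>{u_star N b, v_star N b, u_hat N b, v_hat N b}. dense_in_L2_AN N (Domain T))"
proof -
  have N: "N > 0" using \<open>odd N\<close> by (cases N) auto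
  \<comment> \<open>The tilde operators have \<open>\<beta> = 1/b\<close>; positivity of its real
    part makes their strips nondegenerate.\<close>
  have b': "Re (inverse b) > 0"
    using \<open>Re b > 0\<close> by (simp add: divide_pos_pos add_pos_nonneg)
  have u: "u_star N b = mult_op N (\<lambda>z l. exp (2 * complex_of_real pi * b * of_real z) * ee (of_int 1 * of_int l / of_nat N))"
    "u_hat N b = mult_op N (\<lambda>z l. exp (2 * complex_of_real pi * inverse b * of_real z) * ee (of_int (- 1) * of_int l / of_nat N))"
    unfolding u_star_def u_hat_def ee_def by simp_all
  \<comment> \<open>The double negation matches \<open>zak_conjugates_shift\<close> at
    \<open>e = - 1\<close>.\<close>
  have v: "v_star N b = shift_op N (- (\<i> * b / of_nat N)) (- 1)"
    "v_hat N b = shift_op N (- (\<i> * inverse b / of_nat N)) (- (- 1))"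
    unfolding v_star_def v_hat_def by simp_all
  show ?thesis
    unfolding x_hat_x_type[OF N] y_hat_y_type[OF N] x_tilde_x_type[OF N] y_tilde_y_type[OF N] u v
    using zak_conjugates_mult[OF N \<open>Re b > 0\<close>, of 1] zak_conjugates_mult[OF N b', of "- 1"]
      zak_conjugates_shift[OF N \<open>Re b > 0\<close>, of 1] zak_conjugates_shift[OF N b', of "- 1"]
      mult_op_dense[OF N] shift_op_dense[OF N]
    by blast
qed

end
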